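(* Suppose that $-\infty<\theta_{\ast}<0$ and $\varphi(\theta_{\ast})=0$. Let $\alpha\in(0,1)$. Then almost surely $G_{n,n^\alpha}\sim(1-\alpha)C_{\ast}\ln n$ as $n\to\infty$. Moreover, $$G_{n,n^\alpha}\ge(1-\alpha)C_{\ast}\ln n+O(\ln\ln n)\quad\text{a.s.},$$ and this inequality is an equality, i.e. $G_{n,n^\alpha}=(1-\alpha)C_{\ast}\ln n+O(\ln\ln n)$ a.s., if there exists $\delta>0$ such that $$\mathrm{L}(-\delta)<\infty\quad\text{and}\quad \int \Big(\sum_{i\in\mathbb N}\mathbf 1_{p_i>0}\Big)^{1+\delta}\nu(\mathrm d\mathbf p)<\infty .$$
   Context: Model. Let $\mathbb N=\{1,2,\dots\}$ and $\mathcal U=\bigcup_{k\ge 0}\mathbb N^k$ with $\mathbb N^0=\{\varnothing\}$; write $|i|=k$ if $i\in\mathbb N^k$ (generation $k$), and $ij\in\mathbb N^{k+1}$ for the $j$-th child of $i\in\mathbb N^k$. Let $\rho=(\rho_1,\rho_2,\dots)$ be a random probability measure on $\mathbb N$, with law $\nu$ (a probability measure on the space of probability measures $\mathbf p=(p_1,p_2,\dots)$ on $\mathbb N$). Standing assumption: $\nu$ is not geometric, i.e. there is no $r\in(0,1)$ such that almost surely all masses of the atoms of $\rho$ belong to $\{r^n:n\in\mathbb Z_+\}$ (in particular $\rho$ is not a.s. a Dirac mass). Let $(\rho(i),i\in\mathcal U)$ be i.i.d. copies of $\rho$, and define $p_\varnothing=1$, $p_{ij}=p_i\rho_j(i)$.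 Each $i$ with $p_i>0$ is a box, of size $p_i$ (individuals with $p_i=0$ are ignored). An infinite sequence of balls is thrown: conditionally on $(\rho(i))_{i\in\mathcal U}$ the balls behave independently, each ball starts in $\varnothing$, and a ball located in box $i$ goes to the sub-box $ij$ with probability $\rho_j(i)=p_{ij}/p_i$ (so each ball occupies exactly one box at each generation). For real $y$, $G_{n,y}$ (saturation level) is the first generation $k$ at which there exists a box (of positive size) containing less than $y$ balls when the first $n$ balls have been thrown; $G_{n,n^\alpha}$ is this with $y=n^\alpha$. Constants. $\mathrm L(\theta)=\mathbb E\big[\sum_{j\in\mathbb N}\rho_j^\theta\big]$ for $\theta\in\mathbb R$, with the convention $0^\theta=0$ for all $\theta\in\mathbb{R}$; $\underline\theta=\inf\{\theta\in\mathbb R:\mathrm L(\theta)<\infty\}$; $\varphi(\theta)=\ln \mathrm L(\theta)-\theta\,\mathrm L'(\theta)/\mathrm L(\theta)$ for $\theta>\underline\theta$; $\theta_{\ast}=\inf\{\theta>\underline\theta:\varphi(\theta)>0\}$; $C_{\ast}=\lim_{\theta\downarrow\theta_{\ast}}-\mathrm L(\theta)/\mathrm L'(\theta)$ (a decreasing limit). Since $\varphi$ is defined on $(\underline\theta,\infty)$, the condition $\varphi(\theta_{\ast})=0$ includes $\theta_{\ast}>\underline\theta$. Asymptotic notation: $X_n\ge a\ln n+O(\ln\ln n)$ a.s. means that almost surely there is a finite (random) constant $K$ with $X_n\ge a\ln n-K\ln\ln n$ for all large $n$; $X_n=a\ln n+O(\ln\ln n)$ a.s. means that almost surely $|X_n-a\ln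 n|\le K\ln\ln n$ for some finite random $K$ and all large $n$. *)

theory Defs
  imports "HOL-Probability.Probability" "HOL-Library.Landau_Symbols"
begin

section \<open>Random probability measures on a countable set\<close>

text \<open>
  Children are labelled by all of \<open>nat\<close> instead of the positive integers; a box is a finite word,
  that is, a \<open>nat list\<close>, whose length is its generation and whose \<open>j\<close>-th child is \<open>i @ [j]\<close>.
  The law \<open>\<nu>\<close> of the random probability measure lives on \<open>mass_space\<close>, where the mass of the
  atom \<open>j\<close> is the coordinate \<open>\<lambda>p. measure p {j}\<close>.
\<close>

abbreviation mass_space :: "nat measure measure" where
  "mass_space \<equiv> prob_algebra (count_space (UNIV :: nat set))"

definition geometric_law :: "nat measure measure \<Rightarrow> bool" where
  "geometric_law \<nu> \<longleftrightarrow>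
     (\<exists>r\<in>{0<..<1::real}. AE p in \<nu>. \<forall>j. measure p {j} > 0 \<longrightarrow> (\<exists>n::nat. measure p {j} = r ^ n))"

text \<open>
  The convention \<open>0\<^sup>\<theta> = 0\<close> for every real \<open>\<theta>\<close>, including \<open>\<theta> \<le> 0\<close>, is built into \<open>powr\<close>.
\<close>

definition laplace :: "nat measure measure \<Rightarrow> real \<Rightarrow> ennreal" where
  "laplace \<nu> \<theta> = (\<integral>\<^sup>+ p. (\<Sum>j. ennreal (measure p {j} powr \<theta>)) \<partial>\<nu>)"

definition laplace_real :: "nat measure measure \<Rightarrow> real \<Rightarrow> real" where
  "laplace_real \<nu> \<theta> = enn2real (laplace \<nu> \<theta>)"

definition theta_low :: "nat measure measure \<Rightarrow> ereal" where
  "theta_low \<nu> = Inf (ereal ` {\<theta>. laplace \<nu> \<theta> < \<infinity>})"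

text \<open>Meaningful only for \<open>\<theta> > theta_low \<nu>\<close>, where \<open>laplace \<nu>\<close> is finite and differentiable.\<close>

definition phi :: "nat measure measure \<Rightarrow> real \<Rightarrow> real" where
  "phi \<nu> \<theta> = ln (laplace_real \<nu> \<theta>) - \<theta> * deriv (laplace_real \<nu>) \<theta> / laplace_real \<nu> \<theta>"

definition theta_star :: "nat measure measure \<Rightarrow> ereal" where
  "theta_star \<nu> = Inf (ereal ` {\<theta>. theta_low \<nu> < ereal \<theta> \<and> phi \<nu> \<theta> > 0})"

definition C_star :: "nat measure measure \<Rightarrow> real" where
  "C_star \<nu> = Lim (at_right (real_of_ereal (theta_star \<nu>)))
                (\<lambda>\<theta>. - laplace_real \<nu> \<theta> / deriv (laplace_real \<nu>) \<theta>)"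

text \<open>
  \<open>atom_moment \<nu> a\<close> is the moment of order \<open>a\<close> of the number of atoms; the case distinction
  keeps \<open>card\<close> from counting an infinite set of atoms as zero.
\<close>

definition atom_moment :: "nat measure measure \<Rightarrow> real \<Rightarrow> ennreal" where
  "atom_moment \<nu> a =
     (\<integral>\<^sup>+ p. (if finite {j. measure p {j} > 0}
              then ennreal (real (card {j. measure p {j} > 0}) powr a) else \<infinity>) \<partial>\<nu>)"


section \<open>Nested boxes and balls\<close>

definition box_size :: "(nat list \<Rightarrow> 'a \<Rightarrow> nat measure) \<Rightarrow> nat list \<Rightarrow> 'a \<Rightarrow> real" where
  "box_size \<rho> i \<omega> = (\<Prod>k<length i. measure (\<rho> (take k i) \<omega>) {i ! k})"

lemma box_size_Nil: "box_size \<rho> [] \<omega> = 1"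
  by (simp add: box_size_def)

lemma box_size_snoc: "box_size \<rho> (i @ [j]) \<omega> = box_size \<rho> i \<omega> * measure (\<rho> i \<omega>) {j}"
  by (simp add: box_size_def nth_append)

text \<open>
  \<open>Y b \<omega> k\<close> is the label of the child that the ball \<open>b\<close> enters when it leaves generation \<open>k\<close>, so
  \<open>ball_box Y b k \<omega>\<close> is the box which it occupies at generation \<open>k\<close>.
\<close>

definition ball_box :: "(nat \<Rightarrow> 'a \<Rightarrow> nat \<Rightarrow> nat) \<Rightarrow> nat \<Rightarrow> nat \<Rightarrow> 'a \<Rightarrow> nat list" where
  "ball_box Y b k \<omega> = map (Y b \<omega>) [0..<k]"

text \<open>The first \<open>n\<close> balls are those with index \<open>b < n\<close>.\<close>

definition ball_count :: "(nat \<Rightarrow> 'a \<Rightarrow> nat \<Rightarrow> nat) \<Rightarrow> nat \<Rightarrow> nat list \<Rightarrow> 'a \<Rightarrow> nat" where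
  "ball_count Y n i \<omega> = card {b. b < n \<and> ball_box Y b (length i) \<omega> = i}"

text \<open>Infinite if there is no box with fewer than \<open>y\<close> balls.\<close>

definition saturation_level ::
    "(nat list \<Rightarrow> 'a \<Rightarrow> nat measure) \<Rightarrow> (nat \<Rightarrow> 'a \<Rightarrow> nat \<Rightarrow> nat) \<Rightarrow> nat \<Rightarrow> real \<Rightarrow> 'a \<Rightarrow> enat" where
  "saturation_level \<rho> Y n y \<omega> =
     Inf (enat ` {k. \<exists>i. length i = k \<and> box_size \<rho> i \<omega> > 0 \<and> real (ball_count Y n i \<omega>) < y})"


section \<open>The probabilistic model\<close>

definition cond_indep_vars ::
    "'a measure \<Rightarrow> 'a measure \<Rightarrow> 'b measure \<Rightarrow> ('i \<Rightarrow> 'a \<Rightarrow> 'b) \<Rightarrow> 'i set \<Rightarrow> bool" where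
  "cond_indep_vars M F N X I \<longleftrightarrow>
     (\<forall>i\<in>I. X i \<in> measurable M N) \<and>
     (\<forall>J A. J \<subseteq> I \<longrightarrow> finite J \<longrightarrow> (\<forall>i\<in>J. A i \<in> sets N) \<longrightarrow>
        (AE \<omega> in M. real_cond_exp M F (indicator {\<omega>\<in>space M. \<forall>i\<in>J. X i \<omega> \<in> A i}) \<omega>
           = (\<Prod>i\<in>J. real_cond_exp M F (indicator {\<omega>\<in>space M. X i \<omega> \<in> A i}) \<omega>)))"

text \<open>The sigma-algebra generated by the whole environment.\<close>

definition env_algebra :: "'a measure \<Rightarrow> (nat list \<Rightarrow> 'a \<Rightarrow> nat measure) \<Rightarrow> 'a measure" where
  "env_algebra M \<rho> =
     vimage_algebra (space M) (\<lambda>\<omega> i. \<rho> i \<omega>) (\<Pi>\<^sub>M i\<in>(UNIV :: nat list set). mass_space)"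

text \<open>
  In \<open>ball_step\<close>, being in \<open>i @ [j]\<close> means having been in \<open>i\<close> one generation earlier and having
  moved to its child \<open>j\<close> from there; so the equation says that, given the environment, a ball
  located in \<open>i\<close> moves to \<open>i @ [j]\<close> with probability \<open>\<rho>\<^sub>j(i)\<close>.
\<close>

locale nested_occupancy = prob_space M
  for M :: "'a measure" +
  fixes \<nu> :: "nat measure measure"
    and \<rho> :: "nat list \<Rightarrow> 'a \<Rightarrow> nat measure"
    and Y :: "nat \<Rightarrow> 'a \<Rightarrow> nat \<Rightarrow> nat"
  assumes law: "\<nu> \<in> space (prob_algebra mass_space)"
    and env_indep: "indep_vars (\<lambda>_. mass_space) \<rho> UNIV"
    and env_distr: "\<And>i. distr M mass_space (\<rho> i) = \<nu>"
    and balls_indep: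
      "cond_indep_vars M (env_algebra M \<rho>) (\<Pi>\<^sub>M k\<in>(UNIV :: nat set). count_space UNIV) Y UNIV"
    and ball_step: "\<And>b i j. AE \<omega> in M.
      real_cond_exp M (env_algebra M \<rho>)
          (indicator {\<omega>\<in>space M. ball_box Y b (Suc (length i)) \<omega> = i @ [j]}) \<omega>
        = real_cond_exp M (env_algebra M \<rho>)
            (indicator {\<omega>\<in>space M. ball_box Y b (length i) \<omega> = i}) \<omega> * measure (\<rho> i \<omega>) {j}"

end

theory Submission
  imports Defs "HOL-Real_Asymp.Real_Asymp"
begin

text \<open>
  Write \<open>\<beta> = - \<theta>\<^sub>*\<close>, \<open>v = 1 / C\<^sub>*\<close> and \<open>V(i) = - ln p\<^sub>i\<close>. As \<open>\<phi>(\<theta>\<^sub>*) = 0\<close> means \<open>L(\<theta>\<^sub>*) = exp (\<beta> v)\<close>,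
  the first moment bound shows that almost surely \<open>V \<le> v k + O(ln k)\<close> on generation \<open>k\<close>; with
  Chernoff bounds for the balls this gives the lower bound on the saturation level.

  For the upper bound, let \<open>u\<^sub>r(t)\<close> be the probability that a particle starting from \<open>t\<close> has a
  descendant at position at least \<open>v r - c\<close> in generation \<open>r\<close>. Since
  \<open>1 - u\<^sub>r\<^sub>+\<^sub>1(t) = E (\<Prod>\<^sub>j (1 - u\<^sub>r(t + \<xi>\<^sub>j)))\<close> and \<open>\<Prod>\<^sub>j (1 - w\<^sub>j) \<le> 1 / (1 + \<Sum>\<^sub>j w\<^sub>j)\<close>, the function
  \<open>u\<^sub>r(t)\<close> dominates a multiple of \<open>exp (\<beta> t)\<close> times the probability that the walk with the tilted
  step law, started from \<open>t\<close>, stays below a barrier, ends above \<open>- c\<close> and only sees offspring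
  whose total weight \<open>W = \<Sum>\<^sub>j exp (\<beta> (V(j) - v))\<close> is at most \<open>B\<close>. This replaces a truncated second
  moment. The barrier costs a factor \<open>1 / k\<close>, by cyclic rotation of the steps. That the walk ends
  near \<open>0\<close> has polynomial probability: a window of \<open>k\<close> steps slides from a positive sum to an
  independent negative one, and all window sums have the same law. The moment condition makes
  the tail of \<open>W\<close> under the tilted law polynomial, so that \<open>B\<close> and the total loss are
  polynomial in \<open>k\<close>; without it exponential losses of arbitrarily small rate remain.
  Independent trials started from the descendants in generation \<open>O(ln k)\<close>, respectively in a small
  fraction of \<open>k\<close>, make the probability of failure summable.
\<close>

section \<open>Random walks\<close>

text \<open>Weighting a child by its mass to the power of the critical parameter and dividing by
  \<open>\<kappa>\<close> turns the children of a box into one random step. The equation for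
  \<open>phi\<close> makes this step centred, and the room above \<open>theta_low\<close> gives it
  exponential moments. The obstacle is that the weight W (\<open>total\<close>) need not have a
  second moment under \<open>\<nu>\<close>, so the good boxes cannot be counted by a second moment
  argument. In the nonlinear recursion, by contrast, a start below the barrier b gives a candidate
  bound of at most 1/(kB); on offspring with W at most B the contributions of the children then sum
  to at most 1/k, and the product inequality costs a factor 1 + 1/k per generation, at most e over k
  generations. The resulting probability is positive but small. It is amplified because
  displacements are nonnegative: a child that succeeds for a threshold makes its parent succeed, and
  the odds of failure shrink by 1 + P(two atoms) per generation. That \<open>\<nu>\<close> is not
  geometric excludes zero speed, a constant step and the absence of branching. The balls add only
  errors of order exp(- const n^\<alpha>), up to powers of n.\<close>

text \<open>Start the rotation where the prefix sum is largest: up to the end of the word the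
  rotated sums are nonpositive, and after wrapping around they are the full sum plus a nonpositive
  term. The maximum is at least the empty prefix sum 0, which covers the wrap-around point
  itself.\<close>

lemma cyclic_shift_partial_sums_le:
  fixes x :: "nat \<Rightarrow> real"
  assumes "0 < k"
  obtains r where "r < k" "\<And>l. l \<le> k \<Longrightarrow> (\<Sum>i<l. x ((i + r) mod k)) \<le> max 0 (\<Sum>i<k. x i)"
proof -
  define P where "P l = (\<Sum>i<l. x i)" for l
  have "finite (P ` {..<k})" "P ` {..<k} \<noteq> {}" using assms by auto
  from Max_in[OF this] obtain r where r: "r < k" "P r = Max (P ` {..<k})" by auto
  have max: "P l \<le> P r" if "l < k" for l using that r(2) by simp
  have P0: "P r \<ge> 0" using max[of 0] assms by (simp add: P_def)
  have shift: "(\<Sum>i<l. x (i + r)) = P (l + r) - P r" for l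
  proof -
    have "P (l + r) = P r + (\<Sum>i<l. x (i + r))"
      by (induction l) (auto simp: P_def algebra_simps)
    thus ?thesis by simp
  qed
  have A: "(\<Sum>i<l. x ((i + r) mod k)) = P (l + r) - P r" if "l + r \<le> k" for l
  proof -
    have "(\<Sum>i<l. x ((i + r) mod k)) = (\<Sum>i<l. x (i + r))"
      using that by (intro sum.cong) auto
    thus ?thesis by (simp add: shift)
  qed
  have B: "(\<Sum>i<k - r + l. x ((i + r) mod k)) = P k - P r + P l" if "l < k" for l
    using that
  proof (induction l)
    case 0
    then show ?case using A[of "k - r"] r(1) by (simp add: P_def)
  next
    case (Suc l)
    have "k - r + l + r = l + k" using r(1) by simp
    hence "(k - r + l + r) mod k = l" using Suc.prems by simp
    then show ?case using Suc by (simp add: P_def)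
  qed
  show ?thesis
  proof (rule that[OF r(1)])
    fix l assume l: "l \<le> k"
    show "(\<Sum>i<l. x ((i + r) mod k)) \<le> max 0 (\<Sum>i<k. x i)"
    proof (cases "l + r \<le> k")
      case True
      have "P (l + r) \<le> max (P r) (P k)"
        using max[of "l + r"] True by (cases "l + r = k") auto
      then show ?thesis using A[OF True] P0 by (auto simp: P_def[symmetric])
    next
      case False
      then have "l = k - r + (l + r - k)" "l + r - k < k" using r(1) l by auto
      then show ?thesis using B[of "l + r - k"] max[of "l + r - k"] by (auto simp: P_def[symmetric])
    qed
  qed
qed

locale iid_walk = Q: prob_space Q for Q :: "'b measure" +
  fixes \<xi> :: "'b \<Rightarrow> real"
  assumes meas_step[measurable]: "\<xi> \<in> borel_measurable Q"
begin

sublocale sequence_space Q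
  by unfold_locales

definition walk :: "nat \<Rightarrow> (nat \<Rightarrow> 'b) \<Rightarrow> real" where
  "walk k \<omega> = (\<Sum>i<k. \<xi> (\<omega> i))"

lemma meas_walk[measurable]: "walk k \<in> borel_measurable S"
  unfolding walk_def by measurable

lemma walk_case_nat: "walk (Suc k) (case_nat s \<omega>) = \<xi> s + walk k \<omega>"
  by (simp add: walk_def sum.lessThan_Suc_shift del: sum.lessThan_Suc)

lemma distr_reindex:
  assumes "inj \<pi>"
  shows "distr S S (\<lambda>\<omega> i. \<omega> (\<pi> i)) = S"
  using distr_PiM_reindex[of UNIV "\<lambda>_. Q" \<pi> UNIV] assms Q.prob_space_axioms
  by (simp add: restrict_def)

lemma meas_reindex: "(\<lambda>\<omega> i. \<omega> (\<pi> i)) \<in> measurable S S"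
  by (rule measurable_PiM_single') (auto simp: space_PiM)

text \<open>Used both for rotations of the first steps and for sliding windows.\<close>

lemma measure_reindex:
  assumes "inj \<pi>" "{\<omega>\<in>space S. R \<omega>} \<in> sets S"
  shows "\<P>(\<omega> in S. R (\<lambda>i. \<omega> (\<pi> i))) = \<P>(\<omega> in S. R \<omega>)"
proof -
  have "\<P>(\<omega> in S. R \<omega>) = measure (distr S S (\<lambda>\<omega> i. \<omega> (\<pi> i))) {\<omega>\<in>space S. R \<omega>}"
    by (simp add: distr_reindex assms)
  also have "\<dots> = \<P>(\<omega> in S. R (\<lambda>i. \<omega> (\<pi> i)))"
    using assms by (subst measure_distr[OF meas_reindex]) (auto intro!: arg_cong[where f="measure S"] simp: space_PiM)
  finally show ?thesis ..
qed

lemma meas_case_nat: "(\<lambda>(s, \<omega>). case_nat s \<omega>) \<in> measurable (Q \<Otimes>\<^sub>M S) S"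
  by simp

lemma nn_integral_iter:
  assumes [measurable]: "f \<in> borel_measurable S"
  shows "(\<integral>\<^sup>+\<omega>. f \<omega> \<partial>S) = (\<integral>\<^sup>+s. \<integral>\<^sup>+\<omega>. f (case_nat s \<omega>) \<partial>S \<partial>Q)"
proof -
  have "(\<integral>\<^sup>+\<omega>. f \<omega> \<partial>S) = (\<integral>\<^sup>+\<omega>. f \<omega> \<partial>(distr (Q \<Otimes>\<^sub>M S) S (\<lambda>(s, \<omega>). case_nat s \<omega>)))"
    by (simp only: PiM_iter)
  also have "\<dots> = (\<integral>\<^sup>+z. f (case z of (s, \<omega>) \<Rightarrow> case_nat s \<omega>) \<partial>(Q \<Otimes>\<^sub>M S))"
    by (rule nn_integral_distr[OF meas_case_nat]) simp
  also have "\<dots> = (\<integral>\<^sup>+s. \<integral>\<^sup>+\<omega>. f (case_nat s \<omega>) \<partial>S \<partial>Q)"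
    using measurable_compose[OF meas_case_nat assms] by (subst P.nn_integral_fst[symmetric]) auto
  finally show ?thesis .
qed

lemma nn_integral_prod:
  assumes [measurable]: "f \<in> borel_measurable Q"
  shows "(\<integral>\<^sup>+\<omega>. (\<Prod>i<k. f (\<omega> i)) \<partial>S) = (\<integral>\<^sup>+x. f x \<partial>Q) ^ k"
proof (induction k)
  case 0
  then show ?case by (simp add: P.emeasure_space_1)
next
  case (Suc k)
  have "(\<integral>\<^sup>+\<omega>. (\<Prod>i<Suc k. f (\<omega> i)) \<partial>S) = (\<integral>\<^sup>+s. \<integral>\<^sup>+\<omega>. f s * (\<Prod>i<k. f (\<omega> i)) \<partial>S \<partial>Q)"
    by (subst nn_integral_iter) (simp_all add: prod.lessThan_Suc_shift del: prod.lessThan_Suc)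
  also have "\<dots> = (\<integral>\<^sup>+x. f x \<partial>Q) ^ Suc k"
    by (simp add: nn_integral_cmult nn_integral_multc Suc)
  finally show ?case .
qed

text \<open>Every path in the left event has one of its \<open>k\<close> rotations in the right
  event, and rotations preserve the law, so a union bound costs the factor \<open>k\<close>. That
  all steps lie in \<open>G\<close> is invariant under rotation, which lets the truncation pass
  through.\<close>

lemma measure_rotation:
  assumes "0 < k" "0 \<le> b" and [measurable]: "G \<in> sets Q"
  shows "\<P>(\<omega> in S. \<bar>walk k \<omega>\<bar> \<le> b \<and> (\<forall>i<k. \<omega> i \<in> G))
    \<le> k * \<P>(\<omega> in S. (\<forall>l\<le>k. walk l \<omega> \<le> b) \<and> - b \<le> walk k \<omega> \<and> (\<forall>i<k. \<omega> i \<in> G))"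
    (is "measure S ?A \<le> k * \<P>(\<omega> in S. ?R \<omega>)")
proof -
  have predR[measurable]: "Measurable.pred S ?R" by measurable
  \<comment> \<open>The rotation acts on the first \<open>k\<close> coordinates and fixes the
    others, so that it is injective on all of \<open>nat\<close>.\<close>
  define \<pi> where "\<pi> r i = (if i < k then (i + r) mod k else i)" for r i
  have inj_mod: "i = j" if "(i + r) mod k = (j + r) mod k" "i < k" "j < k" for i j r
  proof -
    have "i = j" if "(i + r) mod k = (j + r) mod k" "i < k" "j < k" "i \<le> j" for i j
    proof -
      have "k dvd (j + r) - (i + r)" using that by (subst mod_eq_dvd_iff_nat[symmetric]) auto
      thus ?thesis using that by (auto dest: dvd_imp_le)
    qed
    thus ?thesis using that by (metis nat_le_linear)
  qed
  have inj: "inj (\<pi> r)" for r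
  proof (rule injI)
    fix i j assume *: "\<pi> r i = \<pi> r j"
    show "i = j"
      using * inj_mod[of i r j] mod_less_divisor[OF assms(1), of "i + r"] mod_less_divisor[OF assms(1), of "j + r"]
      unfolding \<pi>_def by (metis)
  qed
  have im: "\<pi> r ` {..<k} = {..<k}" for r
  proof (rule endo_inj_surj)
    show "\<pi> r ` {..<k} \<subseteq> {..<k}" using assms(1) by (auto simp: \<pi>_def)
    show "inj_on (\<pi> r) {..<k}" by (rule inj_on_subset[OF inj]) simp
  qed simp
  have "?A \<subseteq> (\<Union>r<k. {\<omega>\<in>space S. ?R (\<lambda>i. \<omega> (\<pi> r i))})"
  proof
    fix \<omega> assume w: "\<omega> \<in> ?A"
    obtain r where r: "r < k" "\<And>l. l \<le> k \<Longrightarrow> (\<Sum>i<l. \<xi> (\<omega> ((i + r) mod k))) \<le> max 0 (\<Sum>i<k. \<xi> (\<omega> i))"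
      by (rule cyclic_shift_partial_sums_le[OF assms(1), where x="\<lambda>i. \<xi> (\<omega> i)"]) (rule that)
    have 1: "walk l (\<lambda>i. \<omega> (\<pi> r i)) = (\<Sum>i<l. \<xi> (\<omega> ((i + r) mod k)))" if "l \<le> k" for l
      unfolding walk_def \<pi>_def using that by (intro sum.cong) auto
    have 2: "walk k (\<lambda>i. \<omega> (\<pi> r i)) = walk k \<omega>"
      unfolding walk_def
      by (rule sum.reindex_bij_betw) (simp add: bij_betw_def im inj_on_subset[OF inj])
    have 3: "\<pi> r i < k" if "i < k" for i using im[of r] that by auto
    have "max 0 (\<Sum>i<k. \<xi> (\<omega> i)) \<le> b" using w assms(2) by (auto simp: walk_def dest: abs_le_D1)
    hence "walk l (\<lambda>i. \<omega> (\<pi> r i)) \<le> b" if "l \<le> k" for l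
      using r(2)[OF that] 1[OF that] by linarith
    hence "?R (\<lambda>i. \<omega> (\<pi> r i))"
      using w 3 unfolding 2 by auto
    thus "\<omega> \<in> (\<Union>r<k. {\<omega>\<in>space S. ?R (\<lambda>i. \<omega> (\<pi> r i))})" using r(1) w by blast
  qed
  moreover have meas: "{\<omega>\<in>space S. ?R (\<lambda>i. \<omega> (\<pi> r i))} \<in> sets S" for r
  proof -
    have "Measurable.pred S (\<lambda>\<omega>. ?R (\<lambda>i. \<omega> (\<pi> r i)))"
      by (rule measurable_compose[OF meas_reindex predR])
    thus ?thesis by (simp only: pred_def)
  qed
  ultimately have "measure S ?A \<le> measure S (\<Union>r<k. {\<omega>\<in>space S. ?R (\<lambda>i. \<omega> (\<pi> r i))})"
    by (intro P.finite_measure_mono sets.finite_UN finite_lessThan)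
  also have "\<dots> \<le> (\<Sum>r<k. \<P>(\<omega> in S. ?R (\<lambda>i. \<omega> (\<pi> r i))))"
    by (intro P.finite_measure_subadditive_finite finite_lessThan image_subsetI meas)
  also have "\<dots> = (\<Sum>r<k. \<P>(\<omega> in S. ?R \<omega>))"
    by (intro sum.cong refl measure_reindex[OF inj] predR[unfolded pred_def])
  finally show ?thesis by simp
qed

lemma walk_chernoff:
  assumes "0 \<le> s"
  shows "emeasure S {\<omega>\<in>space S. a \<le> walk k \<omega>}
    \<le> ennreal (exp (- s * a)) * (\<integral>\<^sup>+x. ennreal (exp (s * \<xi> x)) \<partial>Q) ^ k"
proof -
  have "emeasure S {\<omega>\<in>space S. a \<le> walk k \<omega>} = (\<integral>\<^sup>+\<omega>. indicator {\<omega>\<in>space S. a \<le> walk k \<omega>} \<omega> \<partial>S)"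
    by simp
  also have "\<dots> \<le> (\<integral>\<^sup>+\<omega>. ennreal (exp (- s * a)) * (\<Prod>i<k. ennreal (exp (s * \<xi> (\<omega> i)))) \<partial>S)"
  proof (rule nn_integral_mono)
    fix \<omega> :: "nat \<Rightarrow> 'b"
    have "ennreal (exp (- s * a)) * (\<Prod>i<k. ennreal (exp (s * \<xi> (\<omega> i)))) = ennreal (exp (s * (walk k \<omega> - a)))"
      by (simp add: prod_ennreal ennreal_mult[symmetric] exp_sum[symmetric] walk_def sum_distrib_left
          exp_add[symmetric] algebra_simps)
    moreover have "1 \<le> exp (s * (walk k \<omega> - a))" if "a \<le> walk k \<omega>" using that assms by simp
    ultimately show "indicator {\<omega>\<in>space S. a \<le> walk k \<omega>} \<omega>
        \<le> ennreal (exp (- s * a)) * (\<Prod>i<k. ennreal (exp (s * \<xi> (\<omega> i))))"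
      by (auto simp: indicator_def simp del: one_le_exp_iff)
  qed
  also have "\<dots> = ennreal (exp (- s * a)) * (\<integral>\<^sup>+x. ennreal (exp (s * \<xi> x)) \<partial>Q) ^ k"
    by (subst nn_integral_cmult) (auto simp: nn_integral_prod[of "\<lambda>x. ennreal (exp (s * \<xi> x))"])
  finally show ?thesis .
qed

text \<open>An elementary substitute for a local limit theorem. Shifting a window by one changes its
  sum by a difference of two steps, at most \<open>2 * r\<close> unless one of the
  \<open>2 * k\<close> steps is large. A nonnegative first and a nonpositive last window then force
  one of the \<open>k + 1\<close> windows to have a sum within \<open>2 * r\<close> of 0.\<close>

lemma measure_window:
  assumes "0 < k" "0 \<le> r"
  shows "\<P>(\<omega> in S. 0 \<le> walk k \<omega>) * \<P>(\<omega> in S. walk k \<omega> \<le> 0)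
      - 2 * k * \<P>(x in Q. r < \<bar>\<xi> x\<bar>)
    \<le> (k + 1) * \<P>(\<omega> in S. \<bar>walk k \<omega>\<bar> \<le> 2 * r)"
proof -
  let ?A = "{\<omega>\<in>space S. 0 \<le> walk k \<omega>}" and ?B = "{\<omega>\<in>space S. walk k \<omega> \<le> 0}"
  let ?C = "{\<omega>\<in>space S. \<bar>walk k \<omega>\<bar> \<le> 2 * r}"
  define w where "w j \<omega> = walk k (\<lambda>i. \<omega> (i + j))" for j and \<omega> :: "nat \<Rightarrow> 'b"
  have [measurable]: "w j \<in> borel_measurable S" for j
    unfolding w_def walk_def by measurable
  \<comment> \<open>\<open>comb_seq k\<close> takes its first \<open>k\<close> entries from the
    first sequence and the rest from the second, so the windows starting at 0 and at
    \<open>k\<close> are independent.\<close>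
  have "measure S ?A * measure S ?B = measure (S \<Otimes>\<^sub>M S) (?A \<times> ?B)"
    unfolding measure_def by (subst P.emeasure_pair_measure_Times) (auto simp: enn2real_mult)
  also have "\<dots> = measure (S \<Otimes>\<^sub>M S) {z\<in>space (S \<Otimes>\<^sub>M S). case z of (\<omega>, \<omega>') \<Rightarrow>
       0 \<le> w 0 (comb_seq k \<omega> \<omega>') \<and> w k (comb_seq k \<omega> \<omega>') \<le> 0}"
    by (intro arg_cong[where f="measure (S \<Otimes>\<^sub>M S)"])
       (auto simp: space_pair_measure w_def walk_def comb_seq_less comb_seq_add)
  also have "\<dots> = measure (distr (S \<Otimes>\<^sub>M S) S (\<lambda>(\<omega>, \<omega>'). comb_seq k \<omega> \<omega>')) {\<omega>\<in>space S. 0 \<le> w 0 \<omega> \<and> w k \<omega> \<le> 0}"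
  proof (subst measure_distr)
    show "{\<omega>\<in>space S. 0 \<le> w 0 \<omega> \<and> w k \<omega> \<le> 0} \<in> sets S" by measurable
  qed (auto intro!: arg_cong[where f="measure (S \<Otimes>\<^sub>M S)"] simp: space_pair_measure space_PiM PiE_iff comb_seq_def)
  also have "\<dots> = \<P>(\<omega> in S. 0 \<le> w 0 \<omega> \<and> w k \<omega> \<le> 0)"
    by (simp add: PiM_comb_seq)
  also have "\<dots> \<le> measure S ((\<Union>j\<le>k. {\<omega>\<in>space S. \<bar>w j \<omega>\<bar> \<le> 2 * r}) \<union> (\<Union>i<2*k. {\<omega>\<in>space S. r < \<bar>\<xi> (\<omega> i)\<bar>}))"
  proof (rule P.finite_measure_mono)
    show "{\<omega>\<in>space S. 0 \<le> w 0 \<omega> \<and> w k \<omega> \<le> 0} \<subseteq>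
      (\<Union>j\<le>k. {\<omega>\<in>space S. \<bar>w j \<omega>\<bar> \<le> 2 * r}) \<union> (\<Union>i<2*k. {\<omega>\<in>space S. r < \<bar>\<xi> (\<omega> i)\<bar>})"
    proof safe
      fix \<omega> assume w: "\<omega> \<in> space S" "0 \<le> w 0 \<omega>" "w k \<omega> \<le> 0" and "\<omega> \<notin> (\<Union>i<2*k. {\<omega>\<in>space S. r < \<bar>\<xi> (\<omega> i)\<bar>})"
      then have small: "\<bar>\<xi> (\<omega> i)\<bar> \<le> r" if "i < 2 * k" for i using that by force
      \<comment> \<open>The first window with nonpositive sum: its predecessor is positive, so the
        crossing lands within one jump of 0.\<close>
      define j where "j = (LEAST j. w j \<omega> \<le> 0)"
      have j: "w j \<omega> \<le> 0" "j \<le> k" unfolding j_def using w(3) by (auto intro: LeastI Least_le)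
      have "\<bar>w j \<omega>\<bar> \<le> 2 * r"
      proof (cases j)
        case 0
        then show ?thesis using w j assms by auto
      next
        case (Suc i)
        have "\<not> w i \<omega> \<le> 0" using not_less_Least[of i "\<lambda>j. w j \<omega> \<le> 0"] Suc by (auto simp: j_def)
        moreover have "w (Suc i) \<omega> = w i \<omega> + \<xi> (\<omega> (k + i)) - \<xi> (\<omega> i)"
        proof -
          have "(\<Sum>l<Suc k. \<xi> (\<omega> (l + i))) = \<xi> (\<omega> i) + (\<Sum>l<k. \<xi> (\<omega> (l + Suc i)))"
            by (subst sum.lessThan_Suc_shift) simp
          thus ?thesis by (simp add: w_def walk_def)
        qed
        moreover have "\<bar>\<xi> (\<omega> (k + i))\<bar> \<le> r" "\<bar>\<xi> (\<omega> i)\<bar> \<le> r" using j(2) Suc small by auto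
        moreover have "w (Suc i) \<omega> \<le> 0" using j(1) Suc by simp
        ultimately show ?thesis unfolding Suc by linarith
      qed
      thus "\<omega> \<in> (\<Union>j\<le>k. {\<omega>\<in>space S. \<bar>w j \<omega>\<bar> \<le> 2 * r})" using w(1) j(2) by blast
    qed
  qed auto
  also have "\<dots> \<le> measure S (\<Union>j\<le>k. {\<omega>\<in>space S. \<bar>w j \<omega>\<bar> \<le> 2 * r}) + measure S (\<Union>i<2*k. {\<omega>\<in>space S. r < \<bar>\<xi> (\<omega> i)\<bar>})"
    by (rule measure_Un_le) auto
  also have "measure S (\<Union>j\<le>k. {\<omega>\<in>space S. \<bar>w j \<omega>\<bar> \<le> 2 * r}) \<le> (\<Sum>j\<le>k. \<P>(\<omega> in S. \<bar>w j \<omega>\<bar> \<le> 2 * r))"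
    by (rule P.finite_measure_subadditive_finite) auto
  also have "\<dots> = (\<Sum>j\<le>k. measure S ?C)"
    unfolding w_def by (intro sum.cong refl measure_reindex) (auto simp: inj_def)
  also have "measure S (\<Union>i<2*k. {\<omega>\<in>space S. r < \<bar>\<xi> (\<omega> i)\<bar>}) \<le> (\<Sum>i<2*k. \<P>(\<omega> in S. r < \<bar>\<xi> (\<omega> i)\<bar>))"
    by (rule P.finite_measure_subadditive_finite) auto
  also have "\<dots> = (\<Sum>i<2*k. \<P>(x in Q. r < \<bar>\<xi> x\<bar>))"
  proof (intro sum.cong refl)
    fix i :: nat
    have "\<P>(x in Q. r < \<bar>\<xi> x\<bar>) = measure (distr S Q (\<lambda>\<omega>. \<omega> i)) {x\<in>space Q. r < \<bar>\<xi> x\<bar>}"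
      by (subst PiM_component) auto
    also have "\<dots> = \<P>(\<omega> in S. r < \<bar>\<xi> (\<omega> i)\<bar>)"
      by (subst measure_distr) (auto intro!: arg_cong[where f="measure S"] simp: space_PiM)
    finally show "\<P>(\<omega> in S. r < \<bar>\<xi> (\<omega> i)\<bar>) = \<P>(x in Q. r < \<bar>\<xi> x\<bar>)" ..
  qed
  finally show ?thesis by (simp add: algebra_simps)
qed

lemma integral_component:
  fixes f :: "'b \<Rightarrow> real"
  assumes "f \<in> borel_measurable Q"
  shows "(\<integral>\<omega>. f (\<omega> i) \<partial>S) = (\<integral>x. f x \<partial>Q)" "integrable Q f \<Longrightarrow> integrable S (\<lambda>\<omega>. f (\<omega> i))"
  using integral_distr[of "\<lambda>\<omega>. \<omega> i" S Q f] integrable_distr[of "\<lambda>\<omega>. \<omega> i" S Q f] assms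
  by (simp_all add: PiM_component)

text \<open>Jensen's inequality conditionally on the first step: the other \<open>m\<close> steps
  are centred and average out.\<close>

lemma integral_abs_walk_ge:
  assumes "0 < k" and int: "integrable Q \<xi>" and mean: "(\<integral>x. \<xi> x \<partial>Q) = 0"
  shows "(\<integral>x. \<bar>\<xi> x\<bar> \<partial>Q) \<le> (\<integral>\<omega>. \<bar>walk k \<omega>\<bar> \<partial>S)"
proof -
  obtain m where k: "k = Suc m" using assms(1) by (cases k) auto
  have intw: "integrable S (walk n)" for n
    unfolding walk_def using integral_component(2)[OF _ int] by auto
  have meanw: "(\<integral>\<omega>. walk n \<omega> \<partial>S) = 0" for n
    unfolding walk_def using integral_component(2)[OF _ int]
    by (subst Bochner_Integration.integral_sum) (auto simp: integral_component(1) mean)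
  interpret PP: pair_prob_space Q S ..
  have i2: "integrable (Q \<Otimes>\<^sub>M S) (\<lambda>z. \<bar>walk k ((\<lambda>(s, \<omega>). case_nat s \<omega>) z)\<bar>)"
    using integrable_distr[OF meas_case_nat, of "\<lambda>\<omega>. \<bar>walk k \<omega>\<bar>"] intw[of k]
    unfolding PiM_iter by simp
  have "(\<integral>x. \<bar>\<xi> x\<bar> \<partial>Q) \<le> (\<integral>s. (\<integral>\<omega>. \<bar>\<xi> s + walk m \<omega>\<bar> \<partial>S) \<partial>Q)"
  proof (rule integral_mono)
    show "integrable Q (\<lambda>x. \<bar>\<xi> x\<bar>)" using int by simp
    show "integrable Q (\<lambda>s. \<integral>\<omega>. \<bar>\<xi> s + walk m \<omega>\<bar> \<partial>S)"
      using PP.integrable_fst[of "\<lambda>s \<omega>. \<bar>walk k (case_nat s \<omega>)\<bar>"] i2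
      by (simp add: k walk_case_nat case_prod_unfold)
    fix s
    have "\<bar>\<integral>\<omega>. \<xi> s + walk m \<omega> \<partial>S\<bar> \<le> (\<integral>\<omega>. \<bar>\<xi> s + walk m \<omega>\<bar> \<partial>S)"
      by (rule integral_abs_bound)
    thus "\<bar>\<xi> s\<bar> \<le> (\<integral>\<omega>. \<bar>\<xi> s + walk m \<omega>\<bar> \<partial>S)"
      using intw[of m] by (simp add: meanw P.prob_space)
  qed
  also have "\<dots> = (\<integral>z. \<bar>walk k ((\<lambda>(s, \<omega>). case_nat s \<omega>) z)\<bar> \<partial>(Q \<Otimes>\<^sub>M S))"
    using PP.integral_fst[of "\<lambda>s \<omega>. \<bar>walk k (case_nat s \<omega>)\<bar>"] i2
    by (simp add: k walk_case_nat case_prod_unfold)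
  also have "\<dots> = (\<integral>\<omega>. \<bar>walk k \<omega>\<bar> \<partial>(distr (Q \<Otimes>\<^sub>M S) S (\<lambda>(s, \<omega>). case_nat s \<omega>)))"
    by (subst integral_distr) auto
  finally show ?thesis by (simp add: PiM_iter)
qed

text \<open>The walk is centred, so its positive part has half the mean of its absolute value;
  truncating the positive part at a level \<open>R\<close> turns this mean into a probability. The
  second moment is bounded by Cauchy-Schwarz alone, which gives \<open>k ^ 2\<close> and is enough
  for a polynomial bound.\<close>

lemma measure_walk_nonneg_ge:
  assumes k: "0 < k" and int: "integrable Q \<xi>" and mean: "(\<integral>x. \<xi> x \<partial>Q) = 0"
    and int2: "integrable Q (\<lambda>x. (\<xi> x)\<^sup>2)" and nz: "0 < (\<integral>x. \<bar>\<xi> x\<bar> \<partial>Q)"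
  shows "(\<integral>x. \<bar>\<xi> x\<bar> \<partial>Q)\<^sup>2 / (16 * (1 + (\<integral>x. (\<xi> x)\<^sup>2 \<partial>Q))) / real k ^ 2 \<le> \<P>(\<omega> in S. 0 \<le> walk k \<omega>)"
proof -
  define m where "m = (\<integral>x. \<bar>\<xi> x\<bar> \<partial>Q)"
  define v where "v = 1 + (\<integral>x. (\<xi> x)\<^sup>2 \<partial>Q)"
  \<comment> \<open>Chosen so that the truncation error \<open>k ^ 2 * v / R\<close> is
    \<open>m / 4\<close>, half of the mean \<open>m / 2\<close> that is available.\<close>
  define R where "R = 4 * real k ^ 2 * v / m"
  have v: "v > 0" unfolding v_def by (intro add_pos_nonneg integral_nonneg) auto
  have m: "m > 0" using nz by (simp add: m_def)
  have R: "R > 0" unfolding R_def using v m k by simp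
  have intw: "integrable S (walk k)"
    unfolding walk_def using integral_component(2)[OF _ int] by auto
  have meanw: "(\<integral>\<omega>. walk k \<omega> \<partial>S) = 0"
    unfolding walk_def using integral_component(2)[OF _ int]
    by (subst Bochner_Integration.integral_sum) (auto simp: integral_component(1) mean)
  have ic: "integrable S (\<lambda>\<omega>. (\<xi> (\<omega> i))\<^sup>2)" "(\<integral>\<omega>. (\<xi> (\<omega> i))\<^sup>2 \<partial>S) = (\<integral>x. (\<xi> x)\<^sup>2 \<partial>Q)" for i
    using int2 by (simp_all add: integral_component(1)[of "\<lambda>x. (\<xi> x)\<^sup>2"] integral_component(2)[of "\<lambda>x. (\<xi> x)\<^sup>2"])
  have cs: "(walk k \<omega>)\<^sup>2 \<le> real k * (\<Sum>i<k. (\<xi> (\<omega> i))\<^sup>2)" for \<omega>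
    unfolding walk_def using Cauchy_Schwarz_ineq_sum[of "\<lambda>_. 1" "\<lambda>i. \<xi> (\<omega> i)" "{..<k}"] by simp
  have int_w2: "integrable S (\<lambda>\<omega>. (walk k \<omega>)\<^sup>2)"
    by (rule Bochner_Integration.integrable_bound[where f="\<lambda>\<omega>. real k * (\<Sum>i<k. (\<xi> (\<omega> i))\<^sup>2)"])
       (use ic cs in \<open>auto intro!: AE_I2 order_trans[OF _ abs_ge_self]\<close>)
  have "(\<integral>\<omega>. (walk k \<omega>)\<^sup>2 \<partial>S) \<le> (\<integral>\<omega>. real k * (\<Sum>i<k. (\<xi> (\<omega> i))\<^sup>2) \<partial>S)"
    using ic cs int_w2 by (intro integral_mono) auto
  also have "\<dots> = real k * (real k * (\<integral>x. (\<xi> x)\<^sup>2 \<partial>Q))"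
    using ic by (simp add: Bochner_Integration.integral_sum)
  also have "\<dots> \<le> real k ^ 2 * v" by (simp add: v_def power2_eq_square algebra_simps)
  finally have w2: "(\<integral>\<omega>. (walk k \<omega>)\<^sup>2 \<partial>S) \<le> real k ^ 2 * v" .
  have "m / 2 \<le> (\<integral>\<omega>. (\<bar>walk k \<omega>\<bar> + walk k \<omega>) / 2 \<partial>S)"
    using intw meanw integral_abs_walk_ge[OF k int mean] by (simp add: m_def)
  also have "\<dots> \<le> (\<integral>\<omega>. R * indicator {\<omega>\<in>space S. 0 \<le> walk k \<omega>} \<omega> + (walk k \<omega>)\<^sup>2 / R \<partial>S)"
  proof (rule integral_mono)
    show "integrable S (\<lambda>\<omega>. (\<bar>walk k \<omega>\<bar> + walk k \<omega>) / 2)" using intw by auto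
    show "integrable S (\<lambda>\<omega>. R * indicator {\<omega>\<in>space S. 0 \<le> walk k \<omega>} \<omega> + (walk k \<omega>)\<^sup>2 / R)"
      using int_w2 by (intro Bochner_Integration.integrable_add integrable_mult_right integrable_real_indicator) (auto simp: P.emeasure_eq_measure)
    fix \<omega> assume w: "\<omega> \<in> space S"
    have "t \<le> R + t\<^sup>2 / R" if "0 \<le> t" for t :: real
    proof -
      have "0 \<le> t * R" using that R by simp
      hence "t * R \<le> R\<^sup>2 + t\<^sup>2" using sum_squares_bound[of t R] by linarith
      thus ?thesis using R by (simp add: field_simps power2_eq_square)
    qed
    moreover have "0 \<le> (walk k \<omega>)\<^sup>2 / R" using R by simp
    moreover have "(\<bar>walk k \<omega>\<bar> + walk k \<omega>) / 2 = (if 0 \<le> walk k \<omega> then walk k \<omega> else 0)" by auto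
    ultimately show "(\<bar>walk k \<omega>\<bar> + walk k \<omega>) / 2 \<le> R * indicator {\<omega>\<in>space S. 0 \<le> walk k \<omega>} \<omega> + (walk k \<omega>)\<^sup>2 / R"
      using w R by (auto simp: indicator_def)
  qed
  also have "\<dots> = R * \<P>(\<omega> in S. 0 \<le> walk k \<omega>) + (\<integral>\<omega>. (walk k \<omega>)\<^sup>2 \<partial>S) / R"
    using int_w2 by (subst Bochner_Integration.integral_add)
       (simp_all add: P.emeasure_eq_measure)
  also have "\<dots> \<le> R * \<P>(\<omega> in S. 0 \<le> walk k \<omega>) + real k ^ 2 * v / R"
    using w2 R by (simp add: divide_right_mono)
  also have "real k ^ 2 * v / R = m / 4" unfolding R_def using v m k by simp
  finally have "m / 4 / R \<le> \<P>(\<omega> in S. 0 \<le> walk k \<omega>)"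
    using R by (simp add: field_simps)
  also have "m / 4 / R = m\<^sup>2 / (16 * v) / real k ^ 2"
    unfolding R_def using v m k by (simp add: field_simps power2_eq_square)
  finally show ?thesis by (simp add: m_def v_def)
qed

end

text \<open>The one-sided bound of order \<open>1 / k ^ 2\<close> is applied to the walk and to its
  negative; their product enters \<open>measure_window\<close>.\<close>

lemma (in iid_walk) measure_walk_central_ge:
  assumes k: "0 < k" and r: "0 \<le> r" and int: "integrable Q \<xi>" and mean: "(\<integral>x. \<xi> x \<partial>Q) = 0"
    and int2: "integrable Q (\<lambda>x. (\<xi> x)\<^sup>2)" and nz: "0 < (\<integral>x. \<bar>\<xi> x\<bar> \<partial>Q)"
  defines "c \<equiv> (\<integral>x. \<bar>\<xi> x\<bar> \<partial>Q)\<^sup>2 / (16 * (1 + (\<integral>x. (\<xi> x)\<^sup>2 \<partial>Q)))"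
  shows "c\<^sup>2 / real k ^ 4 - 2 * k * \<P>(x in Q. r < \<bar>\<xi> x\<bar>)
    \<le> (k + 1) * \<P>(\<omega> in S. \<bar>walk k \<omega>\<bar> \<le> 2 * r)"
proof -
  interpret N: iid_walk Q "\<lambda>x. - \<xi> x" by unfold_locales auto
  have w: "N.walk k \<omega> = - walk k \<omega>" for \<omega> by (simp add: N.walk_def walk_def sum_negf)
  have "c / real k ^ 2 \<le> \<P>(\<omega> in S. 0 \<le> walk k \<omega>)"
    using measure_walk_nonneg_ge[OF k int mean int2 nz] by (simp add: c_def)
  moreover have "c / real k ^ 2 \<le> \<P>(\<omega> in S. walk k \<omega> \<le> 0)"
    using N.measure_walk_nonneg_ge[OF k] int mean int2 nz by (simp add: c_def w)
  moreover have "0 \<le> c" unfolding c_def by (intro divide_nonneg_nonneg) auto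
  ultimately have "(c / real k ^ 2) * (c / real k ^ 2) \<le>
      \<P>(\<omega> in S. 0 \<le> walk k \<omega>) * \<P>(\<omega> in S. walk k \<omega> \<le> 0)"
    by (intro mult_mono) auto
  moreover have "(c / real k ^ 2) * (c / real k ^ 2) = c\<^sup>2 / real k ^ 4"
    by (simp add: power2_eq_square power4_eq_xxxx)
  ultimately show ?thesis using measure_window[OF k r] by linarith
qed

section \<open>The environment as a branching random walk\<close>

lemma box_size_Cons:
  "box_size \<rho> (j # i) \<omega> = measure (\<rho> [] \<omega>) {j} * box_size (\<lambda>i. \<rho> (j # i)) i \<omega>"
  by (simp add: box_size_def prod.lessThan_Suc_shift del: prod.lessThan_Suc)

lemma box_size_nonneg: "0 \<le> box_size \<rho> i \<omega>"
  by (simp add: box_size_def prod_nonneg)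

text \<open>The environment itself is the sample point, so that the subtree below a child is again
  an argument of the same predicate.\<close>

definition fragmented :: "nat \<Rightarrow> real \<Rightarrow> (nat list \<Rightarrow> nat measure) \<Rightarrow> bool" where
  "fragmented r z e \<longleftrightarrow> (\<exists>i. length i = r \<and> 0 < box_size (\<lambda>i e. e i) i e \<and> z \<le> - ln (box_size (\<lambda>i e. e i) i e))"

lemma fragmented_0: "fragmented 0 z e \<longleftrightarrow> z \<le> 0"
  by (simp add: fragmented_def box_size_Nil)

lemma fragmented_Suc:
  "fragmented (Suc r) z e \<longleftrightarrow>
    (\<exists>j. 0 < measure (e []) {j} \<and> fragmented r (z + ln (measure (e []) {j})) (\<lambda>i. e (j # i)))"
proof -
  have eq: "box_size (\<lambda>i e. e i) (j # i) e = measure (e []) {j} * box_size (\<lambda>i e. e i) i (\<lambda>i. e (j # i))" for i j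
    by (subst box_size_Cons) (simp add: box_size_def)
  have "(0 < a * b \<and> z \<le> - ln (a * b)) \<longleftrightarrow> (0 < a \<and> 0 < b \<and> z + ln a \<le> - ln b)"
    if "0 \<le> a" "0 \<le> b" for a b :: real
    using that by (cases "a = 0"; cases "b = 0") (auto simp: ln_mult)
  hence *: "(0 < box_size (\<lambda>i e. e i) (j # i) e \<and> z \<le> - ln (box_size (\<lambda>i e. e i) (j # i) e)) \<longleftrightarrow>
     (0 < measure (e []) {j} \<and> 0 < box_size (\<lambda>i e. e i) i (\<lambda>i. e (j # i)) \<and>
       z + ln (measure (e []) {j}) \<le> - ln (box_size (\<lambda>i e. e i) i (\<lambda>i. e (j # i))))" for i j
    unfolding eq by (simp add: box_size_nonneg)
  show ?thesis
    unfolding fragmented_def length_Suc_conv using * by blast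
qed

lemma fragmented_mono: "fragmented r z e \<Longrightarrow> z' \<le> z \<Longrightarrow> fragmented r z' e"
  unfolding fragmented_def using order_trans by blast

section \<open>Self-similarity of the environment and the nonlinear recursion\<close>

locale atoms_law = nu: prob_space \<nu> for \<nu> :: "nat measure measure" +
  assumes sets_nu[measurable_cong]: "sets \<nu> = sets mass_space"
begin

definition Env :: "(nat list \<Rightarrow> nat measure) measure" where
  "Env = (\<Pi>\<^sub>M i\<in>UNIV. \<nu>)"

sublocale Env0: product_prob_space "\<lambda>_. \<nu>" "UNIV :: nat list set"
  by unfold_locales

sublocale Env: prob_space Env
  unfolding Env_def by (rule Env0.P.prob_space_axioms)

sublocale seq: sequence_space Env
  by unfold_locales

text \<open>With \<open>z = speed * real r - c - t\<close> this is the \<open>u\<^sub>r(t)\<close>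
  of the overview.\<close>

definition reach :: "nat \<Rightarrow> real \<Rightarrow> real" where
  "reach r z = \<P>(e in Env. fragmented r z e)"

lemma meas_mass[measurable]: "(\<lambda>p. measure p {j}) \<in> borel_measurable \<nu>"
  by measurable

lemma meas_Env_coord[measurable]: "(\<lambda>e. e i) \<in> measurable Env \<nu>"
  unfolding Env_def by simp

lemma meas_fragmented[measurable]: "Measurable.pred Env (fragmented r z)"
  unfolding fragmented_def box_size_def by measurable

lemma space_nu: "p \<in> space \<nu> \<Longrightarrow> prob_space p" "p \<in> space \<nu> \<Longrightarrow> sets p = UNIV"
  using sets_eq_imp_space_eq[OF sets_nu] by (auto simp: space_prob_algebra)

lemma mass_le_1: "p \<in> space \<nu> \<Longrightarrow> measure p {j} \<le> 1"
  using space_nu(1) prob_space.prob_le_1 by blast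

definition graft :: "nat measure \<times> (nat \<Rightarrow> nat list \<Rightarrow> nat measure) \<Rightarrow> nat list \<Rightarrow> nat measure" where
  "graft = (\<lambda>(p, F) i. case i of [] \<Rightarrow> p | j # i' \<Rightarrow> F j i')"

lemma graft_simps[simp]: "graft (p, F) [] = p" "graft (p, F) (j # i) = F j i"
  by (simp_all add: graft_def)

lemma meas_graft: "graft \<in> measurable (\<nu> \<Otimes>\<^sub>M seq.S) Env"
proof (subst (2) Env_def, rule measurable_PiM_single'[where f="\<lambda>i z. graft z i"])
  fix i :: "nat list"
  show "(\<lambda>z. graft z i) \<in> measurable (\<nu> \<Otimes>\<^sub>M seq.S) \<nu>"
  proof (cases i)
    case Nil
    then show ?thesis by (simp add: graft_def case_prod_unfold)
  next
    case (Cons j i')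
    have "(\<lambda>z. snd z j i') \<in> measurable (\<nu> \<Otimes>\<^sub>M seq.S) \<nu>"
      by (rule measurable_compose[OF _ meas_Env_coord]) measurable
    with Cons show ?thesis by (simp add: graft_def case_prod_unfold)
  qed
next
  show "graft \<in> space (\<nu> \<Otimes>\<^sub>M seq.S) \<rightarrow> UNIV \<rightarrow>\<^sub>E space \<nu>"
    by (auto simp: graft_def space_pair_measure space_PiM Env_def PiE_iff split: list.split)
qed

text \<open>By uniqueness of the product measure it suffices to test cylinders, and a finite set
  \<open>J\<close> of words splits into the root and the groups \<open>I j\<close> of words with
  first letter \<open>j\<close>. This is the branching property on which every recursion
  rests.\<close>

lemma distr_graft: "distr (\<nu> \<Otimes>\<^sub>M seq.S) Env graft = Env"
proof -
  have "distr (\<nu> \<Otimes>\<^sub>M seq.S) Env graft = (\<Pi>\<^sub>M i\<in>UNIV. \<nu>)"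
  proof (rule Env0.PiM_eq)
    show "sets (distr (\<nu> \<Otimes>\<^sub>M seq.S) Env graft) = sets (\<Pi>\<^sub>M i\<in>UNIV. \<nu>)" by (simp add: Env_def)
    fix J :: "nat list set" and A
    assume J: "finite J" "J \<subseteq> UNIV" and A: "\<And>i. i \<in> J \<Longrightarrow> A i \<in> sets \<nu>"
    define I where "I j = {i. j # i \<in> J}" for j
    define J' where "J' = hd ` (J - {[]})"
    define X where "X j = {e\<in>space Env. \<forall>i\<in>I j. e i \<in> A (j # i)}" for j
    define A0 where "A0 = (if [] \<in> J then A [] else space \<nu>)"
    have fin: "finite (I j)" for j
      unfolding I_def using finite_vimageI[OF J(1), of "(#) j"] by (simp add: vimage_def inj_def)
    have X: "X j \<in> sets Env" for j
      unfolding X_def using fin A by (intro sets.sets_Collect_finite_All) (auto simp: I_def intro: measurable_sets_Collect[OF meas_Env_coord])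
    have A0: "A0 \<in> sets \<nu>" using A by (simp add: A0_def)
    have emb: "prod_emb UNIV (\<lambda>_. \<nu>) J (\<Pi>\<^sub>E i\<in>J. A i) = {e\<in>space Env. \<forall>i\<in>J. e i \<in> A i}"
      using A[THEN sets.sets_into_space] by (auto simp: prod_emb_def Env_def space_PiM PiE_iff)
    have setsE: "{e\<in>space Env. \<forall>i\<in>J. e i \<in> A i} \<in> sets Env"
      using J A by (intro sets.sets_Collect_finite_All) (auto intro: measurable_sets_Collect[OF meas_Env_coord])
    have Jsplit: "(\<forall>i\<in>J. P i) \<longleftrightarrow> ([] \<in> J \<longrightarrow> P []) \<and> (\<forall>j\<in>J'. \<forall>i\<in>I j. P (j # i))" for P
    proof -
      have "P i" if "([] \<in> J \<longrightarrow> P []) \<and> (\<forall>j\<in>J'. \<forall>i\<in>I j. P (j # i))" "i \<in> J" for i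
        using that by (cases i) (force simp: J'_def I_def)+
      moreover have "P (j # i)" if "\<forall>i\<in>J. P i" "i \<in> I j" for i j
        using that by (simp add: I_def)
      ultimately show ?thesis by meson
    qed
    have pre: "graft -` {e\<in>space Env. \<forall>i\<in>J. e i \<in> A i} \<inter> space (\<nu> \<Otimes>\<^sub>M seq.S)
       = A0 \<times> {F\<in>space seq.S. \<forall>j\<in>J'. F j \<in> X j}"
    proof -
      have "(p, F) \<in> graft -` {e\<in>space Env. \<forall>i\<in>J. e i \<in> A i} \<inter> space (\<nu> \<Otimes>\<^sub>M seq.S)
        \<longleftrightarrow> (p, F) \<in> A0 \<times> {F\<in>space seq.S. \<forall>j\<in>J'. F j \<in> X j}" for p F
      proof (cases "p \<in> space \<nu> \<and> F \<in> space seq.S")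
        case True
        hence z: "(p, F) \<in> space (\<nu> \<Otimes>\<^sub>M seq.S)" by (simp add: space_pair_measure)
        have F: "F j \<in> space Env" for j using True by (auto simp: space_PiM)
        show ?thesis
          using z True F measurable_space[OF meas_graft z]
          by (simp add: Jsplit A0_def X_def)
      next
        case False
        moreover have "A0 \<subseteq> space \<nu>" using sets.sets_into_space[OF A0] .
        ultimately show ?thesis by (auto simp: space_pair_measure)
      qed
      thus ?thesis by (simp only: set_eq_iff split_paired_All) blast
    qed
    have finJ': "finite J'" using J by (simp add: J'_def)
    have "emeasure (distr (\<nu> \<Otimes>\<^sub>M seq.S) Env graft) (prod_emb UNIV (\<lambda>_. \<nu>) J (\<Pi>\<^sub>E i\<in>J. A i))
      = emeasure (\<nu> \<Otimes>\<^sub>M seq.S) (A0 \<times> {F\<in>space seq.S. \<forall>j\<in>J'. F j \<in> X j})"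
      unfolding emb by (subst emeasure_distr[OF meas_graft setsE]) (simp only: pre)
    also have "\<dots> = emeasure \<nu> A0 * emeasure seq.S {F\<in>space seq.S. \<forall>j\<in>J'. F j \<in> X j}"
    proof (rule seq.P.emeasure_pair_measure_Times[OF A0])
      show "{F\<in>space seq.S. \<forall>j\<in>J'. F j \<in> X j} \<in> sets seq.S"
        using X finJ' by (intro sets.sets_Collect_finite_All) (auto intro: measurable_sets_Collect)
    qed
    also have "emeasure seq.S {F\<in>space seq.S. \<forall>j\<in>J'. F j \<in> X j} = (\<Prod>j\<in>J'. emeasure Env (X j))"
      using X finJ' by (intro seq.emeasure_PiM_Collect) auto
    also have "\<dots> = (\<Prod>j\<in>J'. \<Prod>i\<in>I j. emeasure \<nu> (A (j # i)))"
      unfolding X_def Env_def using fin A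
      by (intro prod.cong refl Env0.emeasure_PiM_Collect) (auto simp: I_def)
    also have "\<dots> = (\<Prod>(j, i)\<in>Sigma J' I. emeasure \<nu> (A (j # i)))"
      using finJ' fin by (subst prod.Sigma) auto
    also have "\<dots> = (\<Prod>i\<in>J - {[]}. emeasure \<nu> (A i))"
    proof (rule prod.reindex_bij_witness[where i="\<lambda>i. (hd i, tl i)" and j="\<lambda>(j, i). j # i"])
      fix i assume "i \<in> J - {[]}"
      then show "(hd i, tl i) \<in> Sigma J' I" by (auto simp: J'_def I_def)
    qed (auto simp: I_def)
    also have "emeasure \<nu> A0 * (\<Prod>i\<in>J - {[]}. emeasure \<nu> (A i)) = (\<Prod>i\<in>J. emeasure \<nu> (A i))"
      using J(1) by (auto simp: A0_def nu.emeasure_space_1 prod.remove)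
    finally show "emeasure (distr (\<nu> \<Otimes>\<^sub>M seq.S) Env graft) (prod_emb UNIV (\<lambda>_. \<nu>) J (\<Pi>\<^sub>E i\<in>J. A i))
      = (\<Prod>i\<in>J. emeasure \<nu> (A i))" .
  qed
  thus ?thesis by (simp add: Env_def)
qed

text \<open>The probability of failure given that the root measure is \<open>p\<close>. A child
  already contributes the displacement \<open>- ln\<close> of its mass, so its subtree faces the
  lower target \<open>z + ln\<close> of that mass.\<close>

definition blocked :: "nat \<Rightarrow> real \<Rightarrow> nat measure \<Rightarrow> real" where
  "blocked r z p = \<P>(F in seq.S. \<forall>j. 0 < measure p {j} \<longrightarrow> \<not> fragmented r (z + ln (measure p {j})) (F j))"

lemma meas_blocked_set:
  "{z'\<in>space (\<nu> \<Otimes>\<^sub>M seq.S). \<not> fragmented (Suc r) z (graft z')} \<in> sets (\<nu> \<Otimes>\<^sub>M seq.S)"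
  using measurable_compose[OF meas_graft meas_fragmented[of "Suc r" z]] by simp

lemma reach_Suc: "1 - reach (Suc r) z = (\<integral>p. blocked r z p \<partial>\<nu>)"
  and meas_blocked[measurable]: "blocked r z \<in> borel_measurable \<nu>"
proof -
  interpret PP: pair_prob_space \<nu> seq.S ..
  let ?A = "{z'\<in>space (\<nu> \<Otimes>\<^sub>M seq.S). \<not> fragmented (Suc r) z (graft z')}"
  have slice: "measure seq.S (Pair p -` ?A) = blocked r z p" if "p \<in> space \<nu>" for p
    unfolding blocked_def using that
    by (intro arg_cong[where f="measure seq.S"]) (auto simp: fragmented_Suc space_pair_measure)
  have m: "(\<lambda>p. emeasure seq.S (Pair p -` ?A)) \<in> borel_measurable \<nu>"
    by (rule seq.P.measurable_emeasure_Pair[OF meas_blocked_set])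
  have "(\<lambda>p. enn2real (emeasure seq.S (Pair p -` ?A))) \<in> borel_measurable \<nu>"
    using m by measurable
  hence m2: "(\<lambda>p. measure seq.S (Pair p -` ?A)) \<in> borel_measurable \<nu>"
    by (simp add: measure_def)
  thus mb: "blocked r z \<in> borel_measurable \<nu>"
    by (subst (asm) measurable_cong[OF slice]) auto
  have "1 - reach (Suc r) z = measure Env (space Env - {e\<in>space Env. fragmented (Suc r) z e})"
    unfolding reach_def by (subst Env.prob_compl) auto
  also have "space Env - {e\<in>space Env. fragmented (Suc r) z e} = {e\<in>space Env. \<not> fragmented (Suc r) z e}" by auto
  also have "\<P>(e in Env. \<not> fragmented (Suc r) z e) =
      measure (distr (\<nu> \<Otimes>\<^sub>M seq.S) Env graft) {e\<in>space Env. \<not> fragmented (Suc r) z e}"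
    by (simp add: distr_graft)
  also have "\<dots> = measure (\<nu> \<Otimes>\<^sub>M seq.S) ?A"
    by (subst measure_distr[OF meas_graft])
       (auto intro!: arg_cong[where f="measure (\<nu> \<Otimes>\<^sub>M seq.S)"] dest: measurable_space[OF meas_graft])
  also have "\<dots> = enn2real (\<integral>\<^sup>+p. emeasure seq.S (Pair p -` ?A) \<partial>\<nu>)"
    unfolding measure_def by (subst seq.P.emeasure_pair_measure_alt[OF meas_blocked_set]) simp
  also have "(\<integral>\<^sup>+p. emeasure seq.S (Pair p -` ?A) \<partial>\<nu>) = (\<integral>\<^sup>+p. ennreal (blocked r z p) \<partial>\<nu>)"
    using slice by (intro nn_integral_cong) (simp add: seq.P.emeasure_eq_measure)
  also have "enn2real \<dots> = (\<integral>p. blocked r z p \<partial>\<nu>)"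
    using mb by (subst integral_eq_nn_integral) (auto simp: blocked_def)
  finally show "1 - reach (Suc r) z = (\<integral>p. blocked r z p \<partial>\<nu>)" .
qed

lemma reach_0: "reach 0 z = (if z \<le> 0 then 1 else 0)"
  by (simp add: reach_def fragmented_0 Env.prob_space)

lemma reach_bounds: "0 \<le> reach r z" "reach r z \<le> 1"
  by (simp_all add: reach_def)

lemma reach_antimono: "z \<le> z' \<Longrightarrow> reach r z' \<le> reach r z"
  unfolding reach_def by (rule Env.finite_measure_mono) (auto intro: fragmented_mono)

lemma blocked_bounds: "0 \<le> blocked r z p" "blocked r z p \<le> 1"
  by (simp_all add: blocked_def)

text \<open>The subtrees of the children are independent, so the probability factorises. A limit of
  finite products is used because there may be infinitely many atoms; a massless child contributes
  the factor 1.\<close>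

lemma blocked_tendsto:
  "(\<lambda>n. \<Prod>j\<le>n. if 0 < measure p {j} then 1 - reach r (z + ln (measure p {j})) else 1) \<longlonglongrightarrow> blocked r z p"
proof -
  define A where "A j = {e\<in>space Env. 0 < measure p {j} \<longrightarrow> \<not> fragmented r (z + ln (measure p {j})) e}" for j
  have A: "A j \<in> sets Env" for j unfolding A_def by measurable
  have "measure Env (A j) = (if 0 < measure p {j} then 1 - reach r (z + ln (measure p {j})) else 1)" for j
  proof (cases "0 < measure p {j}")
    case True
    have "A j = space Env - {e\<in>space Env. fragmented r (z + ln (measure p {j})) e}"
      using True by (auto simp: A_def)
    then show ?thesis using True unfolding reach_def by (simp add: Env.prob_compl)
  qed (simp add: A_def Env.prob_space)
  moreover have "Pi UNIV A = {F\<in>space seq.S. \<forall>j. 0 < measure p {j} \<longrightarrow> \<not> fragmented r (z + ln (measure p {j})) (F j)}"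
    by (auto simp: A_def space_PiM PiE_iff)
  ultimately show ?thesis
    using seq.measure_PiM_countable[of A, OF A] by (simp add: blocked_def)
qed

lemma blocked_le:
  "blocked r z p \<le> (\<Prod>j\<le>n. if 0 < measure p {j} then 1 - reach r (z + ln (measure p {j})) else 1)"
proof (rule decseq_ge[OF _ blocked_tendsto])
  show "decseq (\<lambda>n. \<Prod>j\<le>n. if 0 < measure p {j} then 1 - reach r (z + ln (measure p {j})) else 1)"
    by (intro decseq_SucI) (auto intro!: mult_right_le_one_le prod_nonneg simp: reach_bounds)
qed

lemma integrable_blocked: "integrable \<nu> (blocked r z)"
  by (rule nu.integrable_const_bound[where B=1]) (auto simp: blocked_bounds)

end

section \<open>The tilted walk and lower bounds by subsolutions\<close>

text \<open>The inductive step is \<open>(1 - w) * (1 + w + S) \<le> 1 + S\<close>. The bound keeps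
  a gain that is almost linear in the sum while the sum is small, without any second moment.\<close>

lemma prod_one_minus_le_inverse:
  fixes w :: "'i \<Rightarrow> real"
  assumes "finite I" "\<And>i. i \<in> I \<Longrightarrow> 0 \<le> w i" "\<And>i. i \<in> I \<Longrightarrow> w i \<le> 1"
  shows "(\<Prod>i\<in>I. 1 - w i) \<le> 1 / (1 + (\<Sum>i\<in>I. w i))"
  using assms
proof (induction I rule: finite_induct)
  case (insert i I)
  let ?S = "\<Sum>i\<in>I. w i"
  have S: "0 \<le> ?S" and w: "0 \<le> w i" "w i \<le> 1" using insert by (auto intro: sum_nonneg)
  have "(\<Prod>i\<in>insert i I. 1 - w i) \<le> (1 - w i) * (1 / (1 + ?S))"
    using insert w by (simp add: mult_left_mono del: times_divide_eq_right)
  also have "\<dots> \<le> 1 / (1 + (w i + ?S))"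
  proof -
    have "(1 - w i) * (1 + (w i + ?S)) \<le> 1 + ?S"
      using S w by (simp add: algebra_simps)
    thus ?thesis using S w by (simp add: field_simps)
  qed
  finally show ?case using insert by simp
qed simp

lemma one_minus_sum_le_prod:
  fixes w :: "'i \<Rightarrow> real"
  assumes "finite I" "\<And>i. i \<in> I \<Longrightarrow> 0 \<le> w i" "\<And>i. i \<in> I \<Longrightarrow> w i \<le> 1"
  shows "1 - (\<Sum>i\<in>I. w i) \<le> (\<Prod>i\<in>I. 1 - w i)"
  using assms
proof (induction I rule: finite_induct)
  case (insert i I)
  have w: "0 \<le> w i" "w i \<le> 1" using insert by auto
  have "1 - (w i + (\<Sum>i\<in>I. w i)) \<le> (1 - w i) * (1 - (\<Sum>i\<in>I. w i))"
    using w insert by (simp add: algebra_simps sum_nonneg)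
  also have "\<dots> \<le> (1 - w i) * (\<Prod>i\<in>I. 1 - w i)"
    using insert w by (intro mult_left_mono) auto
  finally show ?case using insert by simp
qed simp

section \<open>First moment bound and amplification through branching\<close>

context atoms_law
begin

lemma reach_Suc_nn_integral: "ennreal (reach (Suc r) z) = (\<integral>\<^sup>+p. ennreal (1 - blocked r z p) \<partial>\<nu>)"
proof -
  have "reach (Suc r) z = (\<integral>p. 1 - blocked r z p \<partial>\<nu>)"
    using reach_Suc[of r z] by (simp add: integrable_blocked nu.prob_space)
  thus ?thesis
    by (subst nn_integral_eq_integral) (auto simp: integrable_blocked blocked_bounds)
qed

text \<open>The first moment bound, obtained through the recursion rather than by counting boxes:
  for \<open>\<theta> \<le> 0\<close> the indicator of \<open>z \<le> 0\<close> is at most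
  \<open>exp (\<theta> * z)\<close>, and the union bound over the children multiplies by at most
  \<open>\<kappa>\<close> per generation.\<close>

lemma reach_le:
  assumes L: "laplace \<nu> \<theta> \<le> ennreal \<kappa>" and "\<theta> \<le> 0" "0 \<le> \<kappa>"
  shows "reach r z \<le> exp (\<theta> * z) * \<kappa> ^ r"
proof (induction r arbitrary: z)
  case 0
  have "0 \<le> \<theta> * z" if "z \<le> 0" using that assms(2) by (simp add: mult_nonpos_nonpos)
  thus ?case by (auto simp: reach_0)
next
  case (Suc r)
  define C where "C = exp (\<theta> * z) * \<kappa> ^ r"
  have C: "0 \<le> C" using assms by (simp add: C_def)
  define u where "u p j = (if 0 < measure p {j} then reach r (z + ln (measure p {j})) else 0)" for p :: "nat measure" and j
  have u: "0 \<le> u p j" "u p j \<le> 1" for p j by (auto simp: u_def reach_bounds)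
  have u_le: "u p j \<le> C * measure p {j} powr \<theta>" for p j
    using Suc.IH[of "z + ln (measure p {j})"] assms(3)
    by (cases "0 < measure p {j}") (auto simp: u_def C_def powr_def exp_add[symmetric] algebra_simps)
  have "ennreal (1 - blocked r z p) \<le> (\<Sum>j. ennreal C * ennreal (measure p {j} powr \<theta>))" for p
  proof -
    have "(\<lambda>n. \<Prod>j\<le>n. 1 - u p j) \<longlonglongrightarrow> blocked r z p"
      using blocked_tendsto[of p r z] by (simp add: u_def if_distrib cong: if_cong)
    hence "(\<lambda>n. ennreal (1 - (\<Prod>j\<le>n. 1 - u p j))) \<longlonglongrightarrow> ennreal (1 - blocked r z p)"
      by (intro tendsto_ennrealI tendsto_intros)
    moreover have "ennreal (1 - (\<Prod>j\<le>n. 1 - u p j)) \<le> (\<Sum>j. ennreal C * ennreal (measure p {j} powr \<theta>))" for n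
    proof -
      have "1 - (\<Sum>j\<le>n. u p j) \<le> (\<Prod>j\<le>n. 1 - u p j)"
        using u by (intro one_minus_sum_le_prod) auto
      hence "1 - (\<Prod>j\<le>n. 1 - u p j) \<le> (\<Sum>j\<le>n. C * measure p {j} powr \<theta>)"
        using sum_mono[of "{..n}" "u p" "\<lambda>j. C * measure p {j} powr \<theta>"] u_le by fastforce
      hence "ennreal (1 - (\<Prod>j\<le>n. 1 - u p j)) \<le> (\<Sum>j\<le>n. ennreal (C * measure p {j} powr \<theta>))"
        using C by (subst sum_ennreal) (auto intro!: ennreal_leI)
      also have "\<dots> = (\<Sum>j\<le>n. ennreal C * ennreal (measure p {j} powr \<theta>))"
        using C by (simp add: ennreal_mult)
      also have "\<dots> \<le> (\<Sum>j. ennreal C * ennreal (measure p {j} powr \<theta>))"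
        by (intro sum_le_suminf) auto
      finally show ?thesis .
    qed
    ultimately show ?thesis by (intro LIMSEQ_le_const2) auto
  qed
  hence "ennreal (reach (Suc r) z) \<le> (\<integral>\<^sup>+p. (\<Sum>j. ennreal C * ennreal (measure p {j} powr \<theta>)) \<partial>\<nu>)"
    unfolding reach_Suc_nn_integral by (intro nn_integral_mono) auto
  also have "\<dots> = ennreal C * laplace \<nu> \<theta>"
    unfolding laplace_def by (subst nn_integral_cmult[symmetric]) auto
  also have "\<dots> \<le> ennreal C * ennreal \<kappa>" using L by (intro mult_left_mono) auto
  also have "\<dots> = ennreal (exp (\<theta> * z) * \<kappa> ^ Suc r)"
    using C assms by (simp add: ennreal_mult[symmetric] C_def mult_ac)
  finally show ?case using assms by simp
qed

definition branching :: "nat measure set" where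
  "branching = {p\<in>space \<nu>. \<exists>j j'. j \<noteq> j' \<and> 0 < measure p {j} \<and> 0 < measure p {j'}}"

lemma sets_branching[measurable]: "branching \<in> sets \<nu>"
  unfolding branching_def by measurable

lemma ex_atom: assumes "p \<in> space \<nu>" shows "\<exists>j. 0 < measure p {j}"
proof (rule ccontr)
  interpret p: prob_space p using space_nu assms by blast
  assume "\<not> ?thesis"
  hence z: "measure p {j} = 0" for j by (metis measure_nonneg less_eq_real_def)
  have "emeasure p (\<Union>j. {j}) = (\<Sum>j. emeasure p {j})"
    by (rule suminf_emeasure[symmetric]) (auto simp: space_nu assms disjoint_family_on_def)
  also have "\<dots> = 0" using z by (simp add: p.emeasure_eq_measure)
  finally have "emeasure p UNIV = 0" by simp
  moreover have "space p = UNIV"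
    using sets.top[of p] sets.sets_into_space[of UNIV p] space_nu(2)[OF assms] by auto
  ultimately show False using p.emeasure_space_1 by simp
qed

text \<open>A parent fails only if all its children fail, and as displacements are nonnegative no
  child faces a target above \<open>z\<close>. If \<open>a\<close> bounds the failure of one child,
  a box with two atoms fails with probability at most the square of \<open>a\<close>. For the odds
  of failure this means division by \<open>1 + measure \<nu> branching\<close> in each
  generation.\<close>

lemma boost:
  assumes R: "0 < reach k z"
  shows "1 - reach (m + k) z \<le> (1 / reach k z) / (1 + measure \<nu> branching) ^ m"
proof -
  define \<pi> where "\<pi> = measure \<nu> branching"
  \<comment> \<open>\<open>y m\<close> bounds the odds of failure, so \<open>y m / (1 + y m)\<close>
    bounds its probability; at \<open>m = 0\<close> and target \<open>z\<close> this is
    exact.\<close>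
  define y where "y m = (1 - reach k z) / reach k z / (1 + \<pi>) ^ m" for m
  have \<pi>: "0 \<le> \<pi>" "\<pi> \<le> 1" by (simp_all add: \<pi>_def)
  have y: "0 \<le> y m" for m using R \<pi> by (simp add: y_def reach_bounds)
  \<comment> \<open>Generalised to all \<open>z' \<le> z\<close>, since the children are tested at
    lower targets.\<close>
  have "1 - reach (m + k) z' \<le> y m / (1 + y m)" if "z' \<le> z" for z'
    using that
  proof (induction m arbitrary: z')
    case 0
    have "y 0 / (1 + y 0) = 1 - reach k z" using R by (simp add: y_def field_simps)
    then show ?case using reach_antimono[OF 0] by simp
  next
    case (Suc m)
    define a where "a = y m / (1 + y m)"
    have a: "0 \<le> a" "a \<le> 1" using y[of m] by (auto simp: a_def)
    define q where "q p j = (if 0 < measure p {j} then 1 - reach (m + k) (z' + ln (measure p {j})) else 1)" for p :: "nat measure" and j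
    have q: "0 \<le> q p j" "q p j \<le> 1" for p j by (auto simp: q_def reach_bounds)
    have qa: "q p j \<le> a" if "p \<in> space \<nu>" "0 < measure p {j}" for p j
    proof -
      have "ln (measure p {j}) \<le> 0" using mass_le_1[OF that(1), of j] that(2) by simp
      hence "z' + ln (measure p {j}) \<le> z" using Suc.prems by linarith
      thus ?thesis using Suc.IH[of "z' + ln (measure p {j})"] that(2) by (simp add: q_def a_def)
    qed
    have q1: "(\<Prod>j\<le>n. q p j) \<le> q p i" if "i \<le> n" for p i n
    proof -
      have "(\<Prod>j\<le>n. q p j) = q p i * (\<Prod>j\<in>{..n}-{i}. q p j)" using that by (subst prod.remove[of _ i]) auto
      also have "\<dots> \<le> q p i * 1" using q by (intro mult_left_mono prod_le_1) auto
      finally show ?thesis by simp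
    qed
    have q2: "(\<Prod>j\<le>n. q p j) \<le> q p i * q p i'" if "i \<le> n" "i' \<le> n" "i \<noteq> i'" for p i i' n
    proof -
      have "(\<Prod>j\<le>n. q p j) = q p i * (q p i' * (\<Prod>j\<in>{..n}-{i}-{i'}. q p j))"
        using that by (subst prod.remove[of _ i], simp, simp, subst prod.remove[of _ i'], auto)
      also have "\<dots> \<le> q p i * (q p i' * 1)" using q by (intro mult_left_mono prod_le_1) auto
      finally show ?thesis by simp
    qed
    have b: "blocked (m + k) z' p \<le> (\<Prod>j\<le>n. q p j)" for p n
      using blocked_le[of "m + k" z' p n] by (simp add: q_def cong: if_cong)
    have "blocked (m + k) z' p \<le> a - (a - a\<^sup>2) * indicator branching p" if p: "p \<in> space \<nu>" for p
    proof (cases "p \<in> branching")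
      case True
      then obtain j j' where j: "j \<noteq> j'" "0 < measure p {j}" "0 < measure p {j'}" by (auto simp: branching_def)
      have "blocked (m + k) z' p \<le> q p j * q p j'"
        by (rule order_trans[OF b[of p "max j j'"] q2]) (use j in auto)
      also have "\<dots> \<le> a * a" using qa[OF p] j q a by (intro mult_mono) auto
      finally show ?thesis using True by (simp add: power2_eq_square)
    next
      case False
      obtain j where j: "0 < measure p {j}" using ex_atom[OF p] by auto
      have "blocked (m + k) z' p \<le> q p j" by (rule order_trans[OF b[of p j] q1]) auto
      also have "\<dots> \<le> a" using qa[OF p j] .
      finally show ?thesis using False by simp
    qed
    hence "(\<integral>p. blocked (m + k) z' p \<partial>\<nu>) \<le> (\<integral>p. a - (a - a\<^sup>2) * indicator branching p \<partial>\<nu>)"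
      by (intro integral_mono integrable_blocked Bochner_Integration.integrable_diff integrable_mult_right integrable_real_indicator)
         (auto simp: nu.emeasure_eq_measure)
    also have "\<dots> = a - (a - a\<^sup>2) * \<pi>"
      by (subst Bochner_Integration.integral_diff)
         (auto simp: nu.prob_space \<pi>_def nu.emeasure_eq_measure)
    also have "\<dots> \<le> y (Suc m) / (1 + y (Suc m))"
    proof -
      have ys: "y (Suc m) = y m / (1 + \<pi>)" by (simp add: y_def)
      have "y (Suc m) / (1 + y (Suc m)) = y m / (1 + y m + \<pi>)"
        unfolding ys using \<pi> y[of m] by (simp add: divide_simps)
      moreover have "a - (a - a\<^sup>2) * \<pi> = y m * (1 + y m - \<pi>) / (1 + y m)\<^sup>2"
        unfolding a_def using y[of m] by (simp add: divide_simps power2_eq_square) (simp add: algebra_simps)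
      moreover have "y m * (1 + y m - \<pi>) / (1 + y m)\<^sup>2 \<le> y m / (1 + y m + \<pi>)"
      proof -
        \<comment> \<open>The recursion for the odds reduces to this difference of squares.\<close>
        have "(1 + y m - \<pi>) * (1 + y m + \<pi>) \<le> (1 + y m)\<^sup>2"
          by (simp add: power2_eq_square algebra_simps)
        hence "y m * ((1 + y m - \<pi>) * (1 + y m + \<pi>)) \<le> y m * (1 + y m)\<^sup>2"
          using y[of m] by (intro mult_left_mono)
        thus ?thesis using \<pi> y[of m] by (simp add: frac_le_eq pos_divide_le_eq pos_le_divide_eq mult_ac)
      qed
      ultimately show ?thesis by simp
    qed
    finally show ?case using reach_Suc[of "m + k" z'] by simp
  qed
  from this[of z] have "1 - reach (m + k) z \<le> y m / (1 + y m)" by simp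
  also have "\<dots> \<le> y m" using y[of m] by (simp add: divide_le_eq mult_left_le algebra_simps)
  also have "\<dots> \<le> (1 / reach k z) / (1 + \<pi>) ^ m"
    unfolding y_def using R \<pi> by (intro divide_right_mono) (auto simp: reach_bounds)
  finally show ?thesis by (simp add: \<pi>_def)
qed

end

section \<open>Change of measure and the barrier estimate\<close>

locale tilted = atoms_law +
  fixes \<theta> \<kappa> :: real
  assumes laplace_theta: "laplace \<nu> \<theta> = ennreal \<kappa>" and kappa_pos: "0 < \<kappa>" and theta_neg: "\<theta> < 0"
begin

text \<open>Chosen so that \<open>exp (\<theta> * speed) = 1 / \<kappa>\<close>, which makes
  \<open>exp (- \<theta> * step)\<close> equal to the normalised weight of a child. At the critical
  parameter it is the \<open>v\<close> of the overview.\<close>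

definition speed :: real where "speed = - ln \<kappa> / \<theta>"

lemma exp_speed: "exp (\<theta> * speed) = 1 / \<kappa>"
  using kappa_pos theta_neg by (simp add: speed_def exp_minus field_simps)

text \<open>The law of a root measure with one marked child, chosen with weight mass to the power
  \<open>\<theta>\<close>: one step of the spine. Massless children get weight 0 by the convention
  of \<open>powr\<close>, so the value of \<open>ln 0\<close> in \<open>step\<close> does not
  matter.\<close>

definition Q :: "(nat measure \<times> nat) measure" where
  "Q = density (\<nu> \<Otimes>\<^sub>M count_space UNIV) (\<lambda>(p, j). ennreal (measure p {j} powr \<theta> / \<kappa>))"

definition step :: "nat measure \<times> nat \<Rightarrow> real" where
  "step = (\<lambda>(p, j). - ln (measure p {j}) - speed)"

lemma meas_mass_pair[measurable]: "(\<lambda>(p, j). measure p {j}) \<in> borel_measurable (\<nu> \<Otimes>\<^sub>M count_space UNIV)"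
proof -
  have "(\<lambda>z. measure (fst z) {snd z}) \<in> borel_measurable (\<nu> \<Otimes>\<^sub>M count_space UNIV)"
    by (rule measurable_compose_countable'[where f="\<lambda>j z. measure (fst z) {j}" and g=snd and I=UNIV]) auto
  thus ?thesis by (simp add: case_prod_unfold)
qed

lemma meas_mass_pair'[measurable]: "(\<lambda>z. measure (fst z) {snd z}) \<in> borel_measurable (\<nu> \<Otimes>\<^sub>M count_space UNIV)"
  using meas_mass_pair by (simp add: case_prod_unfold)

lemma sets_Q[measurable_cong]: "sets Q = sets (\<nu> \<Otimes>\<^sub>M count_space UNIV)"
  by (simp add: Q_def)

lemma nn_integral_Q:
  assumes [measurable]: "f \<in> borel_measurable (\<nu> \<Otimes>\<^sub>M count_space UNIV)"
  shows "(\<integral>\<^sup>+z. f z \<partial>Q) = (\<integral>\<^sup>+p. (\<Sum>j. ennreal (measure p {j} powr \<theta> / \<kappa>) * f (p, j)) \<partial>\<nu>)"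
proof -
  interpret C: sigma_finite_measure "count_space (UNIV :: nat set)"
    by (rule sigma_finite_measure_count_space)
  have "(\<integral>\<^sup>+z. f z \<partial>Q) = (\<integral>\<^sup>+z. (case z of (p, j) \<Rightarrow> ennreal (measure p {j} powr \<theta> / \<kappa>)) * f z \<partial>(\<nu> \<Otimes>\<^sub>M count_space UNIV))"
    unfolding Q_def by (rule nn_integral_density) (auto simp: case_prod_unfold)
  also have "\<dots> = (\<integral>\<^sup>+p. \<integral>\<^sup>+j. ennreal (measure p {j} powr \<theta> / \<kappa>) * f (p, j) \<partial>count_space UNIV \<partial>\<nu>)"
    by (subst C.nn_integral_fst[symmetric]) (auto simp: case_prod_unfold)
  finally show ?thesis by (simp add: nn_integral_count_space_nat)
qed

text \<open>The \<open>W\<close> of the overview, and also the density of the first marginal of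
  \<open>Q\<close> with respect to \<open>\<nu>\<close>.\<close>

definition total :: "nat measure \<Rightarrow> ennreal" where
  "total p = (\<Sum>j. ennreal (measure p {j} powr \<theta> / \<kappa>))"

lemma meas_total[measurable]: "total \<in> borel_measurable \<nu>"
  unfolding total_def by measurable

lemma integral_total: "(\<integral>\<^sup>+p. total p \<partial>\<nu>) = 1"
proof -
  have "(\<integral>\<^sup>+p. total p \<partial>\<nu>) = (\<integral>\<^sup>+p. (\<Sum>j. ennreal (1 / \<kappa>) * ennreal (measure p {j} powr \<theta>)) \<partial>\<nu>)"
    unfolding total_def using kappa_pos by (simp add: ennreal_mult[symmetric])
  also have "\<dots> = ennreal (1 / \<kappa>) * laplace \<nu> \<theta>"
    unfolding laplace_def by (subst nn_integral_cmult[symmetric]) auto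
  finally show ?thesis using kappa_pos by (simp add: laplace_theta ennreal_mult[symmetric])
qed

sublocale Q: prob_space Q
proof
  have "emeasure Q (space Q) = (\<integral>\<^sup>+z. 1 \<partial>Q)" by simp
  also have "\<dots> = (\<integral>\<^sup>+p. total p \<partial>\<nu>)" by (subst nn_integral_Q) (auto simp: total_def fun_eq_iff intro!: nn_integral_cong)
  finally show "emeasure Q (space Q) = 1" by (simp add: integral_total)
qed

sublocale rw: iid_walk Q step
proof
  show "step \<in> borel_measurable Q" unfolding step_def by (simp add: case_prod_unfold)
qed

definition tame :: "real \<Rightarrow> (nat measure \<times> nat) set" where
  "tame B = {z\<in>space Q. total (fst z) \<le> ennreal B}"

lemma sets_tame[measurable]: "tame B \<in> sets Q"
  unfolding tame_def by measurable

text \<open>The barrier is tested from time 0 on, so a start above \<open>b\<close> has survival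
  probability 0; this is the case distinction in \<open>survive_Suc\<close>.\<close>

definition survive :: "real \<Rightarrow> real \<Rightarrow> real \<Rightarrow> nat \<Rightarrow> real \<Rightarrow> real" where
  "survive B b c r t = \<P>(\<omega> in rw.S. (\<forall>l\<le>r. t + rw.walk l \<omega> \<le> b) \<and> - c \<le> t + rw.walk r \<omega> \<and> (\<forall>i<r. \<omega> i \<in> tame B))"

lemma survive_bounds: "0 \<le> survive B b c r t" "survive B b c r t \<le> 1"
  by (simp_all add: survive_def)

lemma survive_0: "survive B b c 0 t = (if t \<le> b \<and> - c \<le> t then 1 else 0)"
  by (cases "t \<le> b \<and> - c \<le> t") (auto simp: survive_def rw.walk_def rw.P.prob_space)

text \<open>The Markov property at the first step.\<close>

lemma survive_Suc:
  "ennreal (survive B b c (Suc r) t) = (if t \<le> b then \<integral>\<^sup>+z. indicator (tame B) z * ennreal (survive B b c r (t + step z)) \<partial>Q else 0)"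
proof -
  let ?R = "\<lambda>r t \<omega>. (\<forall>l\<le>r. t + rw.walk l \<omega> \<le> b) \<and> - c \<le> t + rw.walk r \<omega> \<and> (\<forall>i<r. \<omega> i \<in> tame B)"
  have pred: "Measurable.pred rw.S (?R r t)" for r t by measurable
  have "ennreal (survive B b c (Suc r) t) = (\<integral>\<^sup>+\<omega>. indicator {\<omega>\<in>space rw.S. ?R (Suc r) t \<omega>} \<omega> \<partial>rw.S)"
    unfolding survive_def rw.P.emeasure_eq_measure[symmetric]
    by (rule nn_integral_indicator[symmetric]) (use pred in simp)
  also have "\<dots> = (\<integral>\<^sup>+z. \<integral>\<^sup>+\<omega>. indicator {\<omega>\<in>space rw.S. ?R (Suc r) t \<omega>} (case_nat z \<omega>) \<partial>rw.S \<partial>Q)"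
    by (rule rw.nn_integral_iter) (use pred in simp)
  also have "\<dots> = (\<integral>\<^sup>+z. (if t \<le> b then 1 else 0) * (indicator (tame B) z * ennreal (survive B b c r (t + step z))) \<partial>Q)"
  proof (rule nn_integral_cong)
    fix z assume z: "z \<in> space Q"
    have eq: "?R (Suc r) t (case_nat z \<omega>) \<longleftrightarrow> t \<le> b \<and> z \<in> tame B \<and> ?R r (t + step z) \<omega>" for \<omega>
    proof -
      have "(\<forall>l\<le>Suc r. t + rw.walk l (case_nat z \<omega>) \<le> b) \<longleftrightarrow> t \<le> b \<and> (\<forall>l\<le>r. t + step z + rw.walk l \<omega> \<le> b)"
        unfolding less_Suc_eq_le[symmetric] All_less_Suc2 by (simp add: rw.walk_case_nat rw.walk_def[of 0] add.assoc)
      moreover have "(\<forall>i<Suc r. case_nat z \<omega> i \<in> tame B) \<longleftrightarrow> z \<in> tame B \<and> (\<forall>i<r. \<omega> i \<in> tame B)"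
        unfolding All_less_Suc2 by simp
      moreover have "t + rw.walk (Suc r) (case_nat z \<omega>) = t + step z + rw.walk r \<omega>"
        by (simp add: rw.walk_case_nat)
      ultimately show ?thesis by metis
    qed
    have sp: "case_nat z \<omega> \<in> space rw.S" if "\<omega> \<in> space rw.S" for \<omega>
      using that z by (auto simp: space_PiM PiE_iff split: nat.split)
    have "(\<integral>\<^sup>+\<omega>. indicator {\<omega>\<in>space rw.S. ?R (Suc r) t \<omega>} (case_nat z \<omega>) \<partial>rw.S) =
      (\<integral>\<^sup>+\<omega>. ((if t \<le> b then 1 else 0) * indicator (tame B) z) * indicator {\<omega>\<in>space rw.S. ?R r (t + step z) \<omega>} \<omega> \<partial>rw.S)"
      by (intro nn_integral_cong) (simp add: indicator_def eq sp del: all_simps)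
    also have "\<dots> = ((if t \<le> b then 1 else 0) * indicator (tame B) z) * emeasure rw.S {\<omega>\<in>space rw.S. ?R r (t + step z) \<omega>}"
      using pred[of r "t + step z"] by (subst nn_integral_cmult) (simp_all del: all_simps)
    finally show "(\<integral>\<^sup>+\<omega>. indicator {\<omega>\<in>space rw.S. ?R (Suc r) t \<omega>} (case_nat z \<omega>) \<partial>rw.S) =
        (if t \<le> b then 1 else 0) * (indicator (tame B) z * ennreal (survive B b c r (t + step z)))"
      by (simp add: survive_def rw.P.emeasure_eq_measure mult.assoc del: all_simps)
  qed
  finally show ?thesis by simp
qed

lemma meas_survive[measurable]: "survive B b c r \<in> borel_measurable borel"
proof -
  let ?A = "{z\<in>space (borel \<Otimes>\<^sub>M rw.S). (\<forall>l\<le>r. fst z + rw.walk l (snd z) \<le> b) \<and> - c \<le> fst z + rw.walk r (snd z) \<and> (\<forall>i<r. snd z i \<in> tame B)}"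
  have "?A \<in> sets (borel \<Otimes>\<^sub>M rw.S)" by measurable
  from rw.P.measurable_emeasure_Pair[OF this]
  have "(\<lambda>t. enn2real (emeasure rw.S (Pair t -` ?A))) \<in> borel_measurable borel" by measurable
  moreover have "enn2real (emeasure rw.S (Pair t -` ?A)) = survive B b c r t" for t
    unfolding survive_def measure_def
    by (intro arg_cong[where f=enn2real] arg_cong[where f="emeasure rw.S"]) (auto simp: space_pair_measure)
  ultimately show ?thesis by simp
qed

text \<open>Induction on \<open>r\<close>. The coefficient at the position of a child is the
  coefficient at \<open>t\<close> times the tilted weight of the child, so the sum over the children
  becomes an integral against \<open>Q\<close>. The factor \<open>1 + 1 / k\<close> pays for the
  nonlinearity in each generation; \<open>k\<close> stays fixed while \<open>r\<close> runs.\<close>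

lemma subsolution:
  fixes k :: nat
  assumes k: "0 < k" and B: "1 \<le> B"
  shows "exp (- \<theta> * (t - b)) / (real k * B) / (1 + 1 / real k) ^ r * survive B b c r t \<le> reach r (speed * real r - c - t)"
proof (induction r arbitrary: t)
  case 0
  \<comment> \<open>Survival at \<open>r = 0\<close> means \<open>t \<le> b\<close> and
    \<open>- c \<le> t\<close>. The second inequality makes the target nonpositive, so the right
    hand side is 1.\<close>
  have "exp (- \<theta> * (t - b)) / (real k * B) \<le> 1" if "t \<le> b"
  proof -
    have "exp (- \<theta> * (t - b)) \<le> 1" using that theta_neg by (simp add: mult_nonpos_nonpos)
    moreover have "1 * 1 \<le> real k * B" using k B by (intro mult_mono) auto
    ultimately have "exp (- \<theta> * (t - b)) \<le> real k * B" by linarith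
    thus ?thesis using k B by (simp add: divide_le_eq)
  qed
  then show ?case by (auto simp: reach_0 survive_0)
next
  case (Suc r)
  define a where "a r t = exp (- \<theta> * (t - b)) / (real k * B) / (1 + 1 / real k) ^ r" for r t
  define z where "z = speed * real (Suc r) - c - t"
  have a0: "0 \<le> a r t" for r t using B by (simp add: a_def)
  have IH: "a r t * survive B b c r t \<le> reach r (speed * real r - c - t)" for t
    using Suc.IH by (simp add: a_def)
  show ?case
  proof (cases "t \<le> b")
    case False
    hence "ennreal (survive B b c (Suc r) t) = 0" by (simp add: survive_Suc)
    hence "survive B b c (Suc r) t = 0" using survive_bounds[of B b c "Suc r" t] by (simp add: ennreal_eq_0_iff)
    then show ?thesis by (simp add: reach_bounds)
  next
    case True
    \<comment> \<open>The reason for the barrier and for the normalisation by \<open>k * B\<close>: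
      below \<open>b\<close> the coefficient is so small that offspring of total weight at most
      \<open>B\<close> contribute at most \<open>1 / k\<close>.\<close>
    have a_le: "a r t \<le> 1 / (real k * B)"
    proof -
      have "exp (- \<theta> * (t - b)) \<le> 1" using True theta_neg by (simp add: mult_nonpos_nonpos)
      moreover have "1 \<le> (1 + 1 / real k) ^ r" by (rule one_le_power) simp
      ultimately have "exp (- \<theta> * (t - b)) / (1 + 1 / real k) ^ r \<le> 1"
        by (subst divide_le_eq_1_pos) linarith+
      hence "exp (- \<theta> * (t - b)) / (1 + 1 / real k) ^ r / (real k * B) \<le> 1 / (real k * B)"
        using k B by (intro divide_right_mono) auto
      thus ?thesis by (simp add: a_def mult_ac)
    qed
    define g where "g p j = measure p {j} powr \<theta> / \<kappa>" for p :: "nat measure" and j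
    have g0: "0 \<le> g p j" for p j using kappa_pos by (simp add: g_def)
    \<comment> \<open>\<open>w\<close> is what the induction hypothesis guarantees for child
      \<open>j\<close>, written with the coefficient at the parent; \<open>u\<close> is the true
      probability.\<close>
    define w where "w p j = a r t * (g p j * survive B b c r (t + step (p, j)))" for p j
    define u where "u p j = (if 0 < measure p {j} then reach r (z + ln (measure p {j})) else 0)" for p :: "nat measure" and j
    have w0: "0 \<le> w p j" for p j using a0 g0 survive_bounds by (simp add: w_def)
    have wu: "w p j \<le> u p j" for p j
    proof (cases "0 < measure p {j}")
      case True
      have "a r (t + step (p, j)) = a r t * exp (- \<theta> * step (p, j))"
        by (simp add: a_def exp_add[symmetric] algebra_simps)
      also have "exp (- \<theta> * step (p, j)) = g p j"
        using True exp_speed by (simp add: step_def g_def powr_def exp_add[symmetric] exp_diff algebra_simps exp_add)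
      finally have "w p j = a r (t + step (p, j)) * survive B b c r (t + step (p, j))"
        by (simp add: w_def mult_ac)
      also have "\<dots> \<le> reach r (speed * real r - c - (t + step (p, j)))" by (rule IH)
      also have "speed * real r - c - (t + step (p, j)) = z + ln (measure p {j})"
        by (simp add: step_def z_def algebra_simps)
      finally show ?thesis using True by (simp add: u_def)
    next
      case False
      hence "measure p {j} = 0" by (metis measure_nonneg less_eq_real_def)
      then show ?thesis by (simp add: w_def u_def g_def)
    qed
    have u1: "u p j \<le> 1" for p j by (simp add: u_def reach_bounds)
    have aS: "a (Suc r) t = a r t / (1 + 1 / real k)" by (simp add: a_def)
    \<comment> \<open>Pointwise in the root measure; an untamed one contributes 0 on the
      left.\<close>
    have main: "ennreal (a (Suc r) t) * (\<Sum>j. ennreal (g p j) * (indicator (tame B) (p, j) * ennreal (survive B b c r (t + step (p, j)))))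
        \<le> ennreal (1 - blocked r z p)" if p: "p \<in> space \<nu>" for p
    proof (cases "total p \<le> ennreal B")
      case False
      hence "indicator (tame B) (p, j) = (0::ennreal)" for j by (simp add: tame_def)
      then show ?thesis by simp
    next
      case W: True
      \<comment> \<open>The gain \<open>1 - 1 / (1 + ?S)\<close> equals
        \<open>?S / (1 + ?S)\<close>, and \<open>?S \<le> 1 / k\<close> keeps it above
        \<open>?S / (1 + 1 / k)\<close>.\<close>
      have fin: "ennreal (\<Sum>j\<le>n. w p j / (1 + 1 / real k)) \<le> ennreal (1 - blocked r z p)" for n
      proof -
        let ?S = "\<Sum>j\<le>n. w p j"
        have S0: "0 \<le> ?S" using w0 by (intro sum_nonneg) auto
        have "ennreal (\<Sum>j\<le>n. g p j) \<le> total p"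
          unfolding total_def g_def[symmetric]
          by (subst sum_ennreal[symmetric]) (rule g0, rule sum_le_suminf, simp_all)
        hence "ennreal (\<Sum>j\<le>n. g p j) \<le> ennreal B" using W by (rule order_trans)
        hence gB: "(\<Sum>j\<le>n. g p j) \<le> B" using B by simp
        have "?S \<le> (\<Sum>j\<le>n. a r t * g p j)"
          unfolding w_def using a0 g0 survive_bounds by (intro sum_mono mult_left_mono mult_left_le) auto
        also have "\<dots> \<le> 1 / (real k * B) * B"
          unfolding sum_distrib_left[symmetric] using gB a_le a0 g0 k B by (intro mult_mono sum_nonneg) auto
        also have "\<dots> = 1 / real k" using B by simp
        finally have S1: "?S \<le> 1 / real k" .
        have "blocked r z p \<le> (\<Prod>j\<le>n. 1 - u p j)"
          using blocked_le[of r z p n] by (simp add: u_def if_distrib cong: if_cong)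
        also have "\<dots> \<le> (\<Prod>j\<le>n. 1 - w p j)"
          using wu u1 by (intro prod_mono) (auto intro: order_trans)
        also have "\<dots> \<le> 1 / (1 + ?S)"
          using w0 order_trans[OF wu u1] by (intro prod_one_minus_le_inverse) auto
        also have "\<dots> = 1 - ?S / (1 + ?S)" using S0 by (simp add: field_simps)
        also have "\<dots> \<le> 1 - ?S / (1 + 1 / real k)"
          using S0 S1 by (intro diff_left_mono divide_left_mono) (auto intro!: mult_pos_pos add_pos_nonneg)
        finally have "?S / (1 + 1 / real k) \<le> 1 - blocked r z p" by simp
        thus ?thesis by (intro ennreal_leI) (simp add: sum_divide_distrib)
      qed
      have "ennreal (a (Suc r) t) * (\<Sum>j. ennreal (g p j) * (indicator (tame B) (p, j) * ennreal (survive B b c r (t + step (p, j)))))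
        \<le> (\<Sum>j. ennreal (w p j / (1 + 1 / real k)))"
        unfolding ennreal_suminf_cmult[symmetric]
      proof (rule suminf_le)
        fix j
        have "ennreal (a (Suc r) t) * (ennreal (g p j) * (indicator (tame B) (p, j) * ennreal (survive B b c r (t + step (p, j)))))
          \<le> ennreal (a (Suc r) t) * (ennreal (g p j) * (1 * ennreal (survive B b c r (t + step (p, j)))))"
          by (intro mult_mono mult_left_mono) (auto simp: indicator_def)
        also have "\<dots> = ennreal (w p j / (1 + 1 / real k))"
          using a0[of "Suc r" t] g0 survive_bounds by (simp add: ennreal_mult[symmetric] w_def aS)
        finally show "ennreal (a (Suc r) t) * (ennreal (g p j) * (indicator (tame B) (p, j) * ennreal (survive B b c r (t + step (p, j)))))
          \<le> ennreal (w p j / (1 + 1 / real k))" .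
      qed auto
      also have "\<dots> \<le> ennreal (1 - blocked r z p)"
      proof (rule LIMSEQ_le_const2[OF summable_LIMSEQ'], goal_cases)
        case 2
        show ?case using fin w0 by (auto simp: sum_ennreal)
      qed auto
      finally show ?thesis .
    qed
    have measF: "(\<lambda>z. indicator (tame B) z * ennreal (survive B b c r (t + step z))) \<in> borel_measurable (\<nu> \<Otimes>\<^sub>M count_space UNIV)"
    proof -
      have "(\<lambda>z. indicator (tame B) z * ennreal (survive B b c r (t + step z))) \<in> borel_measurable Q" by measurable
      thus ?thesis by (simp cong: measurable_cong_sets add: sets_Q)
    qed
    have "ennreal (a (Suc r) t * survive B b c (Suc r) t) =
       ennreal (a (Suc r) t) * (\<integral>\<^sup>+z. indicator (tame B) z * ennreal (survive B b c r (t + step z)) \<partial>Q)"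
      using True a0 survive_bounds by (simp add: ennreal_mult survive_Suc)
    also have "\<dots> = ennreal (a (Suc r) t) * (\<integral>\<^sup>+p. (\<Sum>j. ennreal (g p j) * (indicator (tame B) (p, j) * ennreal (survive B b c r (t + step (p, j))))) \<partial>\<nu>)"
      unfolding g_def by (rule arg_cong, rule nn_integral_Q[OF measF])
    also have "\<dots> = (\<integral>\<^sup>+p. ennreal (a (Suc r) t) * (\<Sum>j. ennreal (g p j) * (indicator (tame B) (p, j) * ennreal (survive B b c r (t + step (p, j))))) \<partial>\<nu>)"
    proof (rule nn_integral_cmult[symmetric])
      have "(\<lambda>p. indicator (tame B) (p, j) * ennreal (survive B b c r (t + step (p, j)))) \<in> borel_measurable \<nu>" for j
        using measurable_compose[OF measurable_Pair2'[of j "count_space UNIV" "\<nu>"] measF] by simp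
      thus "(\<lambda>p. \<Sum>j. ennreal (g p j) * (indicator (tame B) (p, j) * ennreal (survive B b c r (t + step (p, j))))) \<in> borel_measurable \<nu>"
        unfolding g_def by (intro borel_measurable_suminf_order borel_measurable_times) auto
    qed
    also have "\<dots> \<le> (\<integral>\<^sup>+p. ennreal (1 - blocked r z p) \<partial>\<nu>)"
      by (rule nn_integral_mono) (rule main)
    also have "\<dots> = ennreal (reach (Suc r) z)" by (simp add: reach_Suc_nn_integral)
    finally have "a (Suc r) t * survive B b c (Suc r) t \<le> reach (Suc r) z" by (simp add: reach_bounds)
    thus ?thesis by (simp add: a_def z_def)
  qed
qed

end

section \<open>Analyticity of the Laplace transform\<close>

text \<open>The exponential series is integrated term by term under the domination by
  \<open>exp (e * |X|)\<close>, so the function is a power series near 0. The derivative is needed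
  in a whole neighbourhood, with continuity at 0, because \<open>C_star\<close> is a limit of
  derivatives.\<close>

lemma mgf_has_derivative:
  fixes X :: "'b \<Rightarrow> real"
  assumes [measurable]: "X \<in> borel_measurable Q" and e: "0 < e"
    and int: "integrable Q (\<lambda>x. exp (e * \<bar>X x\<bar>))"
  obtains f' where "\<And>s. \<bar>s\<bar> < e \<Longrightarrow> ((\<lambda>s. \<integral>x. exp (s * X x) \<partial>Q) has_real_derivative f' s) (at s)"
    "isCont f' 0" "f' 0 = (\<integral>x. X x \<partial>Q)"
proof -
  define f where "f s = (\<integral>x. exp (s * X x) \<partial>Q)" for s
  define a where "a n = (\<integral>x. X x ^ n / fact n \<partial>Q)" for n
  have sums: "(\<lambda>n. a n * s ^ n) sums f s" if s: "\<bar>s\<bar> \<le> e" for s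
  proof -
    have exp_sums: "(\<lambda>n. (s * X x) ^ n / fact n) sums exp (s * X x)" for x
      using exp_converges[of "s * X x"] by (simp add: divide_inverse mult.commute)
    have abs_sums: "(\<lambda>n. \<bar>(s * X x) ^ n / fact n\<bar>) sums exp \<bar>s * X x\<bar>" for x
      using exp_converges[of "\<bar>s * X x\<bar>"] by (simp add: divide_inverse mult.commute abs_mult power_abs)
    have exp_le: "exp \<bar>s * X x\<bar> \<le> exp (e * \<bar>X x\<bar>)" for x
      using s by (simp add: abs_mult mult_right_mono)
    have int_abs: "integrable Q (\<lambda>x. exp \<bar>s * X x\<bar>)"
      by (rule Bochner_Integration.integrable_bound[OF int]) (use exp_le in auto)
    have int_n: "integrable Q (\<lambda>x. (s * X x) ^ n / fact n)" for n
    proof (rule Bochner_Integration.integrable_bound[OF int_abs])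
      show "AE x in Q. norm ((s * X x) ^ n / fact n) \<le> norm (exp \<bar>s * X x\<bar>)"
      proof (rule AE_I2)
        fix x
        have "(\<Sum>i\<in>{n}. \<bar>(s * X x) ^ i / fact i\<bar>) \<le> exp \<bar>s * X x\<bar>"
          unfolding sums_unique[OF abs_sums]
          by (rule sum_le_suminf) (use abs_sums[of x] in \<open>auto simp: sums_iff\<close>)
        thus "norm ((s * X x) ^ n / fact n) \<le> norm (exp \<bar>s * X x\<bar>)" by simp
      qed
    qed measurable
    have "(\<lambda>n. \<integral>x. (s * X x) ^ n / fact n \<partial>Q) sums (\<integral>x. (\<Sum>n. (s * X x) ^ n / fact n) \<partial>Q)"
    proof (rule sums_integral)
      show "integrable Q (\<lambda>x. (s * X x) ^ n / fact n)" for n by (rule int_n)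
      show "AE x in Q. summable (\<lambda>n. norm ((s * X x) ^ n / fact n))"
        using abs_sums by (auto simp: sums_iff)
      show "summable (\<lambda>n. \<integral>x. norm ((s * X x) ^ n / fact n) \<partial>Q)"
      proof (rule summableI_nonneg_bounded)
        fix n
        have "(\<Sum>i<n. \<integral>x. norm ((s * X x) ^ i / fact i) \<partial>Q) = (\<integral>x. (\<Sum>i<n. \<bar>(s * X x) ^ i / fact i\<bar>) \<partial>Q)"
          using int_n by (subst Bochner_Integration.integral_sum) (auto simp flip: real_norm_def)
        also have "\<dots> \<le> (\<integral>x. exp \<bar>s * X x\<bar> \<partial>Q)"
        proof (rule integral_mono[OF _ int_abs])
          show "integrable Q (\<lambda>x. \<Sum>i<n. \<bar>(s * X x) ^ i / fact i\<bar>)"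
            using int_n by (intro Bochner_Integration.integrable_sum integrable_abs)
          show "(\<Sum>i<n. \<bar>(s * X x) ^ i / fact i\<bar>) \<le> exp \<bar>s * X x\<bar>" for x
            unfolding sums_unique[OF abs_sums]
            by (rule sum_le_suminf) (use abs_sums[of x] in \<open>auto simp: sums_iff\<close>)
        qed
        finally show "(\<Sum>i<n. \<integral>x. norm ((s * X x) ^ i / fact i) \<partial>Q) \<le> (\<integral>x. exp \<bar>s * X x\<bar> \<partial>Q)" .
      qed simp
    qed
    also have "(\<lambda>x. \<Sum>n. (s * X x) ^ n / fact n) = (\<lambda>x. exp (s * X x))"
      using sums_unique[OF exp_sums] by auto
    also have "(\<lambda>n. \<integral>x. (s * X x) ^ n / fact n \<partial>Q) = (\<lambda>n. a n * s ^ n)"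
      by (rule ext) (simp add: a_def power_mult_distrib mult_ac flip: integral_mult_right_zero)
    finally show ?thesis by (simp add: f_def)
  qed
  define f' where "f' s = (\<Sum>n. diffs a n * s ^ n)" for s
  have summ: "summable (\<lambda>n. a n * s ^ n)" if "\<bar>s\<bar> \<le> e" for s using sums[OF that] by (simp add: sums_iff)
  have D: "(f has_real_derivative f' s) (at s)" if s: "\<bar>s\<bar> < e" for s
  proof (rule has_field_derivative_transform_within_open)
    show "((\<lambda>s. \<Sum>n. a n * s ^ n) has_real_derivative f' s) (at s)"
      unfolding f'_def using termdiffs_strong[OF summ[of e], of s] s e by simp
    show "open {-e<..<e}" "s \<in> {-e<..<e}" using s by auto
    show "(\<Sum>n. a n * s ^ n) = f s" if "s \<in> {-e<..<e}" for s
      using sums[of s] that by (simp add: sums_iff abs_le_iff)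
  qed
  have "summable (\<lambda>n. diffs a n * (e / 2) ^ n)"
    by (rule termdiff_converges[where K=e]) (use e summ in auto)
  hence C: "isCont f' 0" unfolding f'_def by (rule isCont_powser) (use e in auto)
  have "f' 0 = (\<integral>x. X x \<partial>Q)"
    unfolding f'_def by (subst powser_zero) (simp add: diffs_def a_def)
  with D C show ?thesis unfolding f_def by (rule that)
qed

context tilted
begin

lemma space_Q: "space Q = space \<nu> \<times> UNIV"
  by (simp add: Q_def space_pair_measure)

lemma nn_integral_Q_fst:
  assumes [measurable]: "f \<in> borel_measurable \<nu>"
  shows "(\<integral>\<^sup>+z. f (fst z) \<partial>Q) = (\<integral>\<^sup>+p. total p * f p \<partial>\<nu>)"
  by (subst nn_integral_Q) (auto simp: total_def)

text \<open>The density of \<open>Q\<close> is positive at every atom of positive mass. Almost sure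
  facts about the tilted step thus become facts about all atoms, the form in which
  \<open>geometric_law\<close> is phrased.\<close>

lemma AE_Q_D:
  assumes "AE z in Q. P z"
  shows "AE p in \<nu>. \<forall>j. 0 < measure p {j} \<longrightarrow> P (p, j)"
proof -
  interpret C: sigma_finite_measure "count_space (UNIV :: nat set)"
    by (rule sigma_finite_measure_count_space)
  interpret PP: pair_sigma_finite \<nu> "count_space (UNIV :: nat set)" ..
  have "AE z in \<nu> \<Otimes>\<^sub>M count_space UNIV. 0 < (case z of (p, j) \<Rightarrow> ennreal (measure p {j} powr \<theta> / \<kappa>)) \<longrightarrow> P z"
    using assms unfolding Q_def by (subst (asm) AE_density) (auto simp: case_prod_unfold)
  from PP.AE_pair[OF this]
  have "AE p in \<nu>. AE j in count_space UNIV. 0 < ennreal (measure p {j} powr \<theta> / \<kappa>) \<longrightarrow> P (p, j)"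
    by simp
  thus ?thesis
    by eventually_elim (use kappa_pos in \<open>auto simp: AE_count_space\<close>)
qed

definition lmass :: "nat measure \<times> nat \<Rightarrow> real" where
  "lmass z = ln (measure (fst z) {snd z})"

lemma step_eq: "step z = - lmass z - speed"
  by (simp add: step_def lmass_def case_prod_unfold)

lemma meas_lmass[measurable]: "lmass \<in> borel_measurable Q"
  unfolding lmass_def by measurable

lemma lmass_nonpos: "z \<in> space Q \<Longrightarrow> lmass z \<le> 0"
  using mass_le_1[of "fst z" "snd z"] zero_less_measure_iff[of "fst z" "{snd z}"]
  by (cases "measure (fst z) {snd z} = 0") (auto simp: lmass_def space_Q)

text \<open>A further tilt by \<open>s\<close> shifts the exponent, so near \<open>\<theta>\<close>
  the Laplace transform of \<open>\<nu>\<close> is, up to \<open>\<kappa>\<close>, the moment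
  generating function of \<open>lmass\<close> under \<open>Q\<close>.\<close>

lemma nn_integral_exp_lmass:
  "(\<integral>\<^sup>+z. ennreal (exp (s * lmass z)) \<partial>Q) = ennreal (1 / \<kappa>) * laplace \<nu> (\<theta> + s)"
proof -
  have eq: "measure p {j} powr \<theta> / \<kappa> * exp (s * lmass (p, j)) = 1 / \<kappa> * measure p {j} powr (\<theta> + s)" for p j
    by (auto simp: lmass_def powr_def exp_add[symmetric] algebra_simps)
  have eq': "ennreal (measure p {j} powr \<theta> / \<kappa>) * ennreal (exp (s * lmass (p, j))) =
      ennreal (1 / \<kappa>) * ennreal (measure p {j} powr (\<theta> + s))" for p j
  proof -
    have "ennreal (measure p {j} powr \<theta> / \<kappa>) * ennreal (exp (s * lmass (p, j))) =
        ennreal (measure p {j} powr \<theta> / \<kappa> * exp (s * lmass (p, j)))"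
      by (rule ennreal_mult[symmetric]) (use kappa_pos in auto)
    also have "\<dots> = ennreal (1 / \<kappa>) * ennreal (measure p {j} powr (\<theta> + s))"
      unfolding eq by (rule ennreal_mult) (use kappa_pos in auto)
    finally show ?thesis .
  qed
  have "(\<integral>\<^sup>+z. ennreal (exp (s * lmass z)) \<partial>Q) =
      (\<integral>\<^sup>+p. (\<Sum>j. ennreal (measure p {j} powr \<theta> / \<kappa>) * ennreal (exp (s * lmass (p, j)))) \<partial>\<nu>)"
    by (rule nn_integral_Q) (simp add: lmass_def)
  also have "\<dots> = (\<integral>\<^sup>+p. ennreal (1 / \<kappa>) * (\<Sum>j. ennreal (measure p {j} powr (\<theta> + s))) \<partial>\<nu>)"
    by (simp add: eq' ennreal_suminf_cmult)
  also have "\<dots> = ennreal (1 / \<kappa>) * laplace \<nu> (\<theta> + s)"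
    unfolding laplace_def by (rule nn_integral_cmult) measurable
  finally show ?thesis .
qed

lemma laplace_real_eq: "laplace_real \<nu> (\<theta> + s) = \<kappa> * (\<integral>z. exp (s * lmass z) \<partial>Q)"
proof -
  have "(\<integral>z. exp (s * lmass z) \<partial>Q) = enn2real (ennreal (1 / \<kappa>) * laplace \<nu> (\<theta> + s))"
    by (subst integral_eq_nn_integral) (auto simp: nn_integral_exp_lmass)
  thus ?thesis using kappa_pos by (simp add: laplace_real_def enn2real_mult)
qed

text \<open>Masses are at most 1, so \<open>lmass\<close> has one sign and finiteness to the left of
  \<open>\<theta>\<close> controls its absolute value.\<close>

lemma integrable_exp_lmass:
  assumes "laplace \<nu> (\<theta> - e) < \<infinity>"
  shows "integrable Q (\<lambda>z. exp (e * \<bar>lmass z\<bar>))"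
proof -
  have "(\<integral>\<^sup>+z. ennreal (exp (e * \<bar>lmass z\<bar>)) \<partial>Q) = (\<integral>\<^sup>+z. ennreal (exp (- e * lmass z)) \<partial>Q)"
    using lmass_nonpos by (intro nn_integral_cong) (simp add: abs_of_nonpos)
  also have "\<dots> < \<infinity>"
    unfolding nn_integral_exp_lmass using assms by (simp add: ennreal_mult_less_top)
  finally show ?thesis by (simp add: integrable_iff_bounded)
qed

lemma integrable_lmass:
  assumes e: "0 < e" "laplace \<nu> (\<theta> - e) < \<infinity>"
  shows "integrable Q lmass"
proof (rule Bochner_Integration.integrable_bound[OF integrable_mult_right[OF integrable_exp_lmass[OF e(2)], of "1 / e"]])
  have "\<bar>x\<bar> \<le> 1 / e * exp (e * \<bar>x\<bar>)" for x
  proof -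
    have "e * \<bar>x\<bar> \<le> exp (e * \<bar>x\<bar>)" using exp_ge_add_one_self[of "e * \<bar>x\<bar>"] by linarith
    thus ?thesis using e(1) by (simp add: field_simps)
  qed
  thus "AE z in Q. norm (lmass z) \<le> norm (1 / e * exp (e * \<bar>lmass z\<bar>))"
    using e(1) by auto
qed measurable

lemma laplace_deriv:
  assumes e: "0 < e" "laplace \<nu> (\<theta> - e) < \<infinity>"
  shows "deriv (laplace_real \<nu>) \<theta> = \<kappa> * (\<integral>z. lmass z \<partial>Q)" "isCont (deriv (laplace_real \<nu>)) \<theta>"
    "isCont (laplace_real \<nu>) \<theta>"
proof -
  obtain f' where f': "\<And>s. \<bar>s\<bar> < e \<Longrightarrow> ((\<lambda>s. \<integral>x. exp (s * lmass x) \<partial>Q) has_real_derivative f' s) (at s)"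
    and f'0: "isCont f' 0" "f' 0 = (\<integral>x. lmass x \<partial>Q)"
    using mgf_has_derivative[OF meas_lmass e(1) integrable_exp_lmass[OF e(2)]] by metis
  have D: "(laplace_real \<nu> has_real_derivative \<kappa> * f' (t - \<theta>)) (at t)" if "\<bar>t - \<theta>\<bar> < e" for t
  proof -
    have "((\<lambda>t. \<kappa> * (\<integral>x. exp ((t - \<theta>) * lmass x) \<partial>Q)) has_real_derivative \<kappa> * (f' (t - \<theta>) * 1)) (at t)"
      by (intro DERIV_cmult DERIV_chain2[where f="\<lambda>s. \<integral>x. exp (s * lmass x) \<partial>Q"] f'[OF that])
         (auto intro!: derivative_eq_intros)
    moreover have "(\<lambda>t. \<kappa> * (\<integral>x. exp ((t - \<theta>) * lmass x) \<partial>Q)) = laplace_real \<nu>"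
      by (rule ext) (simp add: laplace_real_eq[symmetric])
    ultimately show ?thesis by simp
  qed
  have d: "deriv (laplace_real \<nu>) t = \<kappa> * f' (t - \<theta>)" if "\<bar>t - \<theta>\<bar> < e" for t
    using D[OF that] by (rule DERIV_imp_deriv)
  show "deriv (laplace_real \<nu>) \<theta> = \<kappa> * (\<integral>z. lmass z \<partial>Q)" using d[of \<theta>] e f'0 by simp
  show "isCont (laplace_real \<nu>) \<theta>" using D[of \<theta>] e by (simp add: DERIV_isCont)
  have "isCont (\<lambda>t. \<kappa> * f' (t - \<theta>)) \<theta>"
    by (intro continuous_intros isCont_o2[where f="\<lambda>t. t - \<theta>" and g=f']) (use f'0 in auto)
  moreover have "\<forall>\<^sub>F t in nhds \<theta>. \<kappa> * f' (t - \<theta>) = deriv (laplace_real \<nu>) t"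
    by (rule eventually_nhds_in_open[of "{\<theta>-e<..<\<theta>+e}", THEN eventually_mono])
       (use e d in \<open>auto simp: abs_less_iff\<close>)
  ultimately show "isCont (deriv (laplace_real \<nu>)) \<theta>"
    by (simp add: isCont_cong)
qed

end

text \<open>\<open>mean_step\<close> encodes that \<open>phi\<close> vanishes at
  \<open>\<theta>\<close>, and \<open>e\<close> measures the room to the left of
  \<open>\<theta>\<close>.\<close>

locale critical = tilted +
  fixes e :: real
  assumes e_pos: "0 < e" and laplace_below: "laplace \<nu> (\<theta> - e) < \<infinity>"
    and mean_step: "(\<integral>z. step z \<partial>Q) = 0" and not_geometric: "\<not> geometric_law \<nu>"
begin

lemma integrable_exp_step: "\<bar>s\<bar> \<le> e \<Longrightarrow> integrable Q (\<lambda>z. exp (s * step z))"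
proof (rule Bochner_Integration.integrable_bound)
  assume s: "\<bar>s\<bar> \<le> e"
  show "integrable Q (\<lambda>z. exp (e * \<bar>speed\<bar>) * exp (e * \<bar>lmass z\<bar>))"
    by (intro integrable_mult_right integrable_exp_lmass laplace_below)
  have "s * step z \<le> e * \<bar>speed\<bar> + e * \<bar>lmass z\<bar>" for z
  proof -
    have "s * step z \<le> \<bar>s\<bar> * \<bar>step z\<bar>" by (metis abs_ge_self abs_mult)
    also have "\<dots> \<le> e * (\<bar>speed\<bar> + \<bar>lmass z\<bar>)"
      using s by (intro mult_mono) (auto simp: step_eq)
    finally show ?thesis by (simp add: algebra_simps)
  qed
  thus "AE z in Q. norm (exp (s * step z)) \<le> norm (exp (e * \<bar>speed\<bar>) * exp (e * \<bar>lmass z\<bar>))"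
    by (auto simp: exp_add[symmetric])
qed measurable

lemma integrable_exp_abs_step: "integrable Q (\<lambda>z. exp (e * \<bar>step z\<bar>))"
proof (rule Bochner_Integration.integrable_bound)
  show "integrable Q (\<lambda>z. exp (e * step z) + exp (- e * step z))"
    using e_pos by (intro Bochner_Integration.integrable_add integrable_exp_step) auto
  show "AE z in Q. norm (exp (e * \<bar>step z\<bar>)) \<le> norm (exp (e * step z) + exp (- e * step z))"
  proof (rule AE_I2)
    fix z
    have "norm (exp (e * step z) + exp (- e * step z)) = exp (e * step z) + exp (- e * step z)"
      by (simp add: add_nonneg_nonneg)
    thus "norm (exp (e * \<bar>step z\<bar>)) \<le> norm (exp (e * step z) + exp (- e * step z))"
      by (cases "0 \<le> step z") auto
  qed
qed measurable

lemma integrable_step: "integrable Q step" and integrable_step2: "integrable Q (\<lambda>z. (step z)\<^sup>2)"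
proof -
  have sq: "x\<^sup>2 \<le> 2 / e\<^sup>2 * exp (e * \<bar>x\<bar>)" for x
  proof -
    have "(e * \<bar>x\<bar>)\<^sup>2 / 2 \<le> exp (e * \<bar>x\<bar>)"
      using exp_lower_Taylor_quadratic[of "e * \<bar>x\<bar>"] e_pos by (smt (verit) mult_nonneg_nonneg abs_ge_zero)
    thus ?thesis using e_pos by (simp add: field_simps power_mult_distrib)
  qed
  have "integrable Q (\<lambda>z. - lmass z - speed)"
    using integrable_lmass[OF e_pos laplace_below] by simp
  thus "integrable Q step" by (simp add: step_eq[abs_def])
  show "integrable Q (\<lambda>z. (step z)\<^sup>2)"
    by (rule Bochner_Integration.integrable_bound[OF integrable_mult_right[OF integrable_exp_abs_step, of "2 / e\<^sup>2"]])
       (use sq e_pos in auto)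
qed

text \<open>Excludes three degeneracies: zero speed and absence of branching, where all masses would
  be a zeroth power, and a constant step, where all masses would be
  \<open>exp (- speed)\<close>.\<close>

lemma not_all_atoms_powers: "0 < r \<Longrightarrow> r < 1 \<Longrightarrow>
  \<not> (AE p in \<nu>. \<forall>j. 0 < measure p {j} \<longrightarrow> (\<exists>n::nat. measure p {j} = r ^ n))"
  using not_geometric by (auto simp: geometric_law_def)

lemma speed_pos: "0 < speed"
proof -
  have int: "integrable Q lmass" by (rule integrable_lmass[OF e_pos laplace_below])
  have sp: "speed = (\<integral>z. - lmass z \<partial>Q)"
    using mean_step int by (simp add: step_eq Q.prob_space)
  have ge: "AE z in Q. 0 \<le> - lmass z" using lmass_nonpos by auto
  hence "0 \<le> speed" unfolding sp by (rule integral_nonneg_AE)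
  moreover have "speed \<noteq> 0"
  proof
    assume "speed = 0"
    hence "AE z in Q. - lmass z = 0"
      using integral_nonneg_eq_0_iff_AE[OF _ ge] int by (auto simp: sp)
    from AE_Q_D[OF this] have "AE p in \<nu>. \<forall>j. 0 < measure p {j} \<longrightarrow> (\<exists>n::nat. measure p {j} = (1/2) ^ n)"
      by eventually_elim (auto simp: lmass_def intro!: exI[of _ 0])
    thus False using not_all_atoms_powers[of "1/2"] by simp
  qed
  ultimately show ?thesis by simp
qed

lemma abs_step_pos: "0 < (\<integral>z. \<bar>step z\<bar> \<partial>Q)"
proof -
  have "(\<integral>z. \<bar>step z\<bar> \<partial>Q) \<noteq> 0"
  proof
    assume "(\<integral>z. \<bar>step z\<bar> \<partial>Q) = 0"
    hence "AE z in Q. \<bar>step z\<bar> = 0"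
      using integrable_step by (subst (asm) integral_nonneg_eq_0_iff_AE) auto
    from AE_Q_D[OF this] have "AE p in \<nu>. \<forall>j. 0 < measure p {j} \<longrightarrow> (\<exists>n::nat. measure p {j} = exp (- speed) ^ n)"
    proof eventually_elim
      case (elim p)
      show ?case
      proof (intro allI impI exI[of _ "1::nat"])
        fix j assume "0 < measure p {j}"
        moreover from this elim have "ln (measure p {j}) = - speed" by (auto simp: step_def)
        ultimately show "measure p {j} = exp (- speed) ^ 1" by (metis exp_ln power_one_right)
      qed
    qed
    thus False using not_all_atoms_powers[of "exp (- speed)"] speed_pos by simp
  qed
  moreover have "0 \<le> (\<integral>z. \<bar>step z\<bar> \<partial>Q)" by (rule Bochner_Integration.integral_nonneg) simp
  ultimately show ?thesis by linarith
qed

lemma branching_pos: "0 < measure \<nu> branching"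
proof (rule ccontr)
  assume "\<not> ?thesis"
  hence "measure \<nu> branching = 0" using measure_nonneg[of \<nu> branching] by linarith
  hence "AE p in \<nu>. p \<notin> branching"
    by (intro AE_not_in) (auto simp: null_sets_def nu.emeasure_eq_measure)
  moreover have "AE p in \<nu>. p \<in> space \<nu>" by simp
  ultimately have "AE p in \<nu>. \<forall>j. 0 < measure p {j} \<longrightarrow> (\<exists>n::nat. measure p {j} = (1/2) ^ n)"
  proof eventually_elim
    case (elim p)
    interpret p: prob_space p using space_nu elim by blast
    show ?case
    proof (intro allI impI exI[of _ "0::nat"])
      fix j assume j: "0 < measure p {j}"
      have z: "measure p {i} = 0" if "i \<noteq> j" for i
        using elim j that measure_nonneg[of p "{i}"] unfolding branching_def by (auto simp: less_eq_real_def)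
      have "emeasure p (\<Union>i. {i}) = (\<Sum>i. emeasure p {i})"
        by (rule suminf_emeasure[symmetric]) (auto simp: space_nu elim disjoint_family_on_def)
      also have "\<dots> = (\<Sum>i. if i = j then emeasure p {j} else 0)"
        using z by (intro suminf_cong) (auto simp: p.emeasure_eq_measure)
      also have "\<dots> = emeasure p {j}"
        by (subst suminf_finite[where N="{j}"]) auto
      finally have "emeasure p UNIV = emeasure p {j}" by simp
      moreover have "space p = UNIV"
        using sets.sets_into_space[of UNIV p] space_nu(2)[OF elim(2)] by auto
      ultimately show "measure p {j} = (1/2) ^ 0"
        using p.prob_space by (simp add: measure_def)
    qed
  qed
  thus False using not_all_atoms_powers[of "1/2"] by simp
qed

lemma measure_step_gt:
  "\<P>(z in Q. r < \<bar>step z\<bar>) \<le> (\<integral>z. exp (e * \<bar>step z\<bar>) \<partial>Q) * exp (- e * r)"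
proof -
  have "\<P>(z in Q. r < \<bar>step z\<bar>) = (\<integral>z. indicator {z\<in>space Q. r < \<bar>step z\<bar>} z \<partial>Q)" by simp
  also have "\<dots> \<le> (\<integral>z. exp (e * \<bar>step z\<bar>) * exp (- e * r) \<partial>Q)"
  proof (rule integral_mono)
    show "integrable Q (\<lambda>z. exp (e * \<bar>step z\<bar>) * exp (- e * r))"
      by (intro integrable_mult_left integrable_exp_abs_step)
    show "integrable Q (indicator {z\<in>space Q. r < \<bar>step z\<bar>} :: _ \<Rightarrow> real)"
      by (rule integrable_real_indicator) (auto simp: Q.emeasure_eq_measure)
    fix z
    have "1 \<le> exp (e * \<bar>step z\<bar>) * exp (- e * r)" if "r < \<bar>step z\<bar>"
      using that e_pos by (simp add: exp_add[symmetric])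
    thus "indicator {z\<in>space Q. r < \<bar>step z\<bar>} z \<le> exp (e * \<bar>step z\<bar>) * exp (- e * r)"
      by (auto simp: indicator_def)
  qed
  also have "\<dots> = (\<integral>z. exp (e * \<bar>step z\<bar>) \<partial>Q) * exp (- e * r)" by simp
  finally show ?thesis .
qed

text \<open>The derivative of the left hand side at \<open>s = 0\<close> is \<open>- \<delta>\<close>.\<close>

lemma chernoff_rate:
  assumes "0 < \<delta>" "\<sigma> = 1 \<or> \<sigma> = - 1"
  obtains s where "0 < s" "(\<integral>z. exp (s * (\<sigma> * step z)) \<partial>Q) * exp (- s * \<delta>) < 1" "integrable Q (\<lambda>z. exp (s * (\<sigma> * step z)))"
proof -
  have "integrable Q (\<lambda>z. exp (e * \<bar>\<sigma> * step z\<bar>))" "(\<lambda>z. \<sigma> * step z) \<in> borel_measurable Q"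
    using integrable_exp_abs_step assms(2) by auto
  then obtain f' where f': "\<And>s. \<bar>s\<bar> < e \<Longrightarrow> ((\<lambda>s. \<integral>z. exp (s * (\<sigma> * step z)) \<partial>Q) has_real_derivative f' s) (at s)"
    "f' 0 = (\<integral>z. \<sigma> * step z \<partial>Q)"
    using mgf_has_derivative[of "\<lambda>z. \<sigma> * step z" Q e] e_pos by metis
  have f0: "f' 0 = 0" using f'(2) mean_step by simp
  have "((\<lambda>s. (\<integral>z. exp (s * (\<sigma> * step z)) \<partial>Q) * exp (- s * \<delta>)) has_real_derivative - \<delta>) (at 0)"
    using f'(1)[of 0] e_pos f0 by (auto intro!: derivative_eq_intros simp: Q.prob_space)
  from DERIV_neg_dec_right[OF this] assms(1) obtain d where d: "d > 0"
    "\<And>h. 0 < h \<Longrightarrow> h < d \<Longrightarrow> (\<integral>z. exp (h * (\<sigma> * step z)) \<partial>Q) * exp (- h * \<delta>) < 1"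
    by (auto simp: Q.prob_space)
  define s where "s = min (d / 2) e"
  have "0 < s" "s < d" "s \<le> e" using d e_pos by (auto simp: s_def)
  moreover have "integrable Q (\<lambda>z. exp (s * (\<sigma> * step z)))"
    using integrable_exp_step[of "s * \<sigma>"] assms(2) \<open>0 < s\<close> \<open>s \<le> e\<close> by (auto simp: mult.assoc)
  ultimately show ?thesis using d by (intro that[of s])
qed

text \<open>\<open>chernoff_rate\<close> for both signs; the larger of the two rates serves for both
  tails.\<close>

lemma walk_linear_deviation:
  assumes "0 < \<delta>"
  obtains \<rho> where "0 \<le> \<rho>" "\<rho> < 1"
    "\<And>k. \<P>(\<omega> in rw.S. \<delta> * real k < \<bar>rw.walk k \<omega>\<bar>) \<le> 2 * \<rho> ^ k"
proof -
  have one: "\<exists>\<rho>. 0 \<le> \<rho> \<and> \<rho> < 1 \<and> (\<forall>k. \<P>(\<omega> in rw.S. \<delta> * real k \<le> \<sigma> * rw.walk k \<omega>) \<le> \<rho> ^ k)"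
    if \<sigma>: "\<sigma> = 1 \<or> \<sigma> = - 1" for \<sigma>
  proof -
    interpret N: iid_walk Q "\<lambda>z. \<sigma> * step z" by unfold_locales measurable
    obtain s where s: "0 < s" "(\<integral>z. exp (s * (\<sigma> * step z)) \<partial>Q) * exp (- s * \<delta>) < 1"
      and int: "integrable Q (\<lambda>z. exp (s * (\<sigma> * step z)))"
      by (rule chernoff_rate[OF assms \<sigma>])
    define m where "m = (\<integral>z. exp (s * (\<sigma> * step z)) \<partial>Q)"
    have m: "0 \<le> m" unfolding m_def by (rule Bochner_Integration.integral_nonneg) simp
    have w: "N.walk k \<omega> = \<sigma> * rw.walk k \<omega>" for k \<omega> by (simp add: N.walk_def rw.walk_def sum_distrib_left)
    have "\<P>(\<omega> in rw.S. \<delta> * real k \<le> \<sigma> * rw.walk k \<omega>) \<le> (m * exp (- s * \<delta>)) ^ k" for k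
    proof -
      have "ennreal (\<P>(\<omega> in rw.S. \<delta> * real k \<le> \<sigma> * rw.walk k \<omega>))
        \<le> ennreal (exp (- s * (\<delta> * real k))) * (\<integral>\<^sup>+z. ennreal (exp (s * (\<sigma> * step z))) \<partial>Q) ^ k"
        using N.walk_chernoff[of s "\<delta> * real k" k] s(1) by (simp add: w rw.P.emeasure_eq_measure)
      also have "(\<integral>\<^sup>+z. ennreal (exp (s * (\<sigma> * step z))) \<partial>Q) = ennreal m"
        unfolding m_def using int by (intro nn_integral_eq_integral) auto
      also have "ennreal (exp (- s * (\<delta> * real k))) * ennreal m ^ k = ennreal ((m * exp (- s * \<delta>)) ^ k)"
        using m by (simp add: ennreal_power ennreal_mult[symmetric] power_mult_distrib exp_of_nat_mult[symmetric] mult_ac)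
      finally show ?thesis using m by simp
    qed
    thus ?thesis using s(2) m by (intro exI[of _ "m * exp (- s * \<delta>)"]) (auto simp: m_def)
  qed
  obtain \<rho>1 where r1: "0 \<le> \<rho>1" "\<rho>1 < 1" "\<And>k. \<P>(\<omega> in rw.S. \<delta> * real k \<le> 1 * rw.walk k \<omega>) \<le> \<rho>1 ^ k"
    using one[of 1] by blast
  obtain \<rho>2 where r2: "0 \<le> \<rho>2" "\<rho>2 < 1" "\<And>k. \<P>(\<omega> in rw.S. \<delta> * real k \<le> - 1 * rw.walk k \<omega>) \<le> \<rho>2 ^ k"
    using one[of "- 1"] by blast
  show ?thesis
  proof (rule that[of "max \<rho>1 \<rho>2"])
    fix k
    have "\<P>(\<omega> in rw.S. \<delta> * real k < \<bar>rw.walk k \<omega>\<bar>) \<le>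
      measure rw.S ({\<omega>\<in>space rw.S. \<delta> * real k \<le> 1 * rw.walk k \<omega>} \<union> {\<omega>\<in>space rw.S. \<delta> * real k \<le> - 1 * rw.walk k \<omega>})"
      by (rule rw.P.finite_measure_mono) auto
    also have "\<dots> \<le> \<P>(\<omega> in rw.S. \<delta> * real k \<le> 1 * rw.walk k \<omega>) + \<P>(\<omega> in rw.S. \<delta> * real k \<le> - 1 * rw.walk k \<omega>)"
      by (rule measure_Un_le) auto
    also have "\<dots> \<le> max \<rho>1 \<rho>2 ^ k + max \<rho>1 \<rho>2 ^ k"
      using r1 r2 by (intro add_mono order_trans[OF r1(3)] order_trans[OF r2(3)] power_mono) auto
    finally show "\<P>(\<omega> in rw.S. \<delta> * real k < \<bar>rw.walk k \<omega>\<bar>) \<le> 2 * max \<rho>1 \<rho>2 ^ k" by simp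
  qed (use r1 r2 in auto)
qed

text \<open>\<open>total\<close> has integral 1 under \<open>\<nu>\<close>, so it is finite almost
  surely, and this passes to \<open>Q\<close>, whose first marginal has a density with respect to
  \<open>\<nu>\<close>. The argument gives no rate.\<close>

lemma measure_tame_tendsto: "(\<lambda>n. measure Q (tame (real n))) \<longlonglongrightarrow> 1"
proof -
  have fin: "AE p in \<nu>. total p \<noteq> \<infinity>"
    by (rule nn_integral_PInf_AE) (auto simp: integral_total)
  have "incseq (\<lambda>n. tame (real n))"
    by (auto simp: incseq_def tame_def intro: order_trans ennreal_leI)
  hence "(\<lambda>n. measure Q (tame (real n))) \<longlonglongrightarrow> measure Q (\<Union>n. tame (real n))"
    by (intro Q.finite_Lim_measure_incseq) auto
  moreover have "(\<Union>n. tame (real n)) = {z\<in>space Q. total (fst z) \<noteq> \<infinity>}"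
  proof (intro set_eqI iffI)
    fix z assume z: "z \<in> {z\<in>space Q. total (fst z) \<noteq> \<infinity>}"
    then obtain r where r: "total (fst z) = ennreal r" "0 \<le> r" by (cases "total (fst z)") auto
    obtain n where "r \<le> real n" using real_arch_simple by blast
    thus "z \<in> (\<Union>n. tame (real n))" using z r by (auto simp: tame_def intro!: exI[of _ n] ennreal_leI)
  qed (auto simp: tame_def top_unique)
  moreover have "\<P>(z in Q. total (fst z) \<noteq> \<infinity>) = 1"
  proof -
    have "emeasure Q {z\<in>space Q. total (fst z) = \<infinity>} = (\<integral>\<^sup>+z. indicator {z\<in>space Q. total (fst z) = \<infinity>} z \<partial>Q)"
      by (rule nn_integral_indicator[symmetric]) measurable
    also have "\<dots> = (\<integral>\<^sup>+z. indicator {p\<in>space \<nu>. total p = \<infinity>} (fst z) \<partial>Q)"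
      by (intro nn_integral_cong) (auto simp: indicator_def space_Q)
    also have "\<dots> = (\<integral>\<^sup>+p. total p * indicator {p\<in>space \<nu>. total p = \<infinity>} p \<partial>\<nu>)"
      by (rule nn_integral_Q_fst) measurable
    also have "\<dots> = 0"
      using fin by (subst nn_integral_0_iff_AE) (auto elim!: eventually_mono simp: indicator_def)
    finally have "AE z in Q. z \<notin> {z\<in>space Q. total (fst z) = \<infinity>}"
      by (intro AE_not_in) (auto simp: null_sets_def)
    thus ?thesis by (intro Q.prob_eq_1[THEN iffD2]) auto
  qed
  ultimately show ?thesis by simp
qed

lemma measure_all_tame: "\<P>(\<omega> in rw.S. \<forall>i<k. \<omega> i \<in> tame B) = measure Q (tame B) ^ k"
proof -
  have "emeasure rw.S {\<omega>\<in>space rw.S. \<forall>i\<in>{..<k}. \<omega> i \<in> tame B} = (\<Prod>i\<in>{..<k}. emeasure Q (tame B))"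
    by (rule rw.emeasure_PiM_Collect) auto
  moreover have "{\<omega>\<in>space rw.S. \<forall>i\<in>{..<k}. \<omega> i \<in> tame B} = {\<omega>\<in>space rw.S. \<forall>i<k. \<omega> i \<in> tame B}" by auto
  ultimately show ?thesis by (simp add: rw.P.emeasure_eq_measure Q.emeasure_eq_measure ennreal_power)
qed

text \<open>\<open>measure_rotation\<close> and \<open>subsolution\<close> at \<open>t = 0\<close>,
  with barrier and end level both given by \<open>b\<close>. One factor \<open>k\<close> comes from
  the rotation, \<open>k * B\<close> from the coefficient, and \<open>exp 1\<close> from
  \<open>(1 + 1 / k) ^ k\<close>.\<close>

lemma reach_ge_walk:
  assumes k: "0 < k" and B: "1 \<le> B" and b: "0 \<le> b"
  shows "exp (\<theta> * b) / (exp 1 * real k ^ 2 * B) *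
      \<P>(\<omega> in rw.S. \<bar>rw.walk k \<omega>\<bar> \<le> b \<and> (\<forall>i<k. \<omega> i \<in> tame B))
    \<le> reach k (speed * real k - b)"
proof -
  let ?m = "\<P>(\<omega> in rw.S. \<bar>rw.walk k \<omega>\<bar> \<le> b \<and> (\<forall>i<k. \<omega> i \<in> tame B))"
  have "?m \<le> real k * survive B b b k 0"
    using rw.measure_rotation[OF k b sets_tame[of B]] by (simp add: survive_def)
  hence "?m / real k \<le> survive B b b k 0" using k by (simp add: divide_le_eq mult.commute)
  moreover have "exp (\<theta> * b) / (real k * B) / exp 1 \<le> exp (- \<theta> * (0 - b)) / (real k * B) / (1 + 1 / real k) ^ k"
  proof -
    have "(1 + 1 / real k) ^ k \<le> exp (1 / real k) ^ k"
      using exp_ge_add_one_self[of "1 / real k"] by (intro power_mono) auto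
    also have "\<dots> = exp 1" using k by (simp add: exp_of_nat_mult[symmetric])
    finally have "(1 + 1 / real k) ^ k \<le> exp 1" .
    moreover have "- \<theta> * (0 - b) = \<theta> * b" by simp
    moreover have "0 < (1 + 1 / real k) ^ k" by (intro zero_less_power add_pos_nonneg) auto
    ultimately show ?thesis using B k by (simp only:) (intro divide_left_mono, auto)
  qed
  ultimately have "exp (\<theta> * b) / (real k * B) / exp 1 * (?m / real k) \<le>
     exp (- \<theta> * (0 - b)) / (real k * B) / (1 + 1 / real k) ^ k * survive B b b k 0"
    using B by (intro mult_mono) auto
  also have "\<dots> \<le> reach k (speed * real k - b - 0)" by (rule subsolution[OF k B])
  finally show ?thesis by (simp add: power2_eq_square mult_ac)
qed

end

section \<open>Fast fragmentation at the critical parameter\<close>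

context critical
begin

section \<open>Tail of the offspring weight under the moment condition, and lower bounds for
  \<open>reach\<close>\<close>

definition num_atoms :: "nat measure \<Rightarrow> ennreal" where
  "num_atoms p = (\<Sum>j. if 0 < measure p {j} then 1 else 0)"

lemma meas_num_atoms[measurable]: "num_atoms \<in> borel_measurable \<nu>"
  unfolding num_atoms_def by measurable

lemma num_atoms_eq:
  "num_atoms p = (if finite {j. 0 < measure p {j}} then ennreal (real (card {j. 0 < measure p {j}})) else \<infinity>)"
proof -
  have "num_atoms p = (\<integral>\<^sup>+j. indicator {j. 0 < measure p {j}} j \<partial>count_space UNIV)"
    unfolding num_atoms_def nn_integral_count_space_nat by (intro suminf_cong) (simp add: indicator_def)
  also have "\<dots> = emeasure (count_space UNIV) {j. 0 < measure p {j}}" by simp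
  finally show ?thesis by (simp add: emeasure_count_space ennreal_of_nat_eq_real_of_nat)
qed

text \<open>Summands of size at most \<open>a\<close> are paid for by the number of atoms. A summand
  \<open>w > a\<close> is multiplied by \<open>w / a\<close> to the positive power
  \<open>- e / \<theta>\<close>, which is at least 1 and trades the exponent \<open>\<theta>\<close>
  for \<open>\<theta> - e\<close>.\<close>

lemma total_le:
  assumes a: "0 < a"
  shows "total p \<le> ennreal a * num_atoms p +
    ennreal (a powr (e / \<theta>) * \<kappa> powr (e / \<theta> - 1)) * (\<Sum>j. ennreal (measure p {j} powr (\<theta> - e)))"
proof -
  have pw: "x powr \<theta> / \<kappa> \<le> a + a powr (e / \<theta>) * \<kappa> powr (e / \<theta> - 1) * x powr (\<theta> - e)" if x: "0 < x" for x
  proof (cases "x powr \<theta> / \<kappa> \<le> a")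
    case True
    then show ?thesis by (simp add: add_increasing2)
  next
    case False
    define w where "w = x powr \<theta> / \<kappa>"
    have w: "0 < w" using x kappa_pos by (simp add: w_def)
    have "(w / a) powr (e / \<theta>) \<le> 1"
    proof -
      have "(w / a) powr (e / \<theta>) \<le> (w / a) powr 0"
        using False a e_pos theta_neg by (intro powr_mono) (auto simp: w_def[symmetric] divide_nonneg_neg divide_simps)
      thus ?thesis using w a by simp
    qed
    hence "w powr (e / \<theta>) \<le> a powr (e / \<theta>)" using w a by (simp add: powr_divide divide_le_eq)
    hence "w = w powr (e / \<theta>) * w powr (1 - e / \<theta>)" using w by (simp add: powr_add[symmetric])
    also have "\<dots> \<le> a powr (e / \<theta>) * w powr (1 - e / \<theta>)"
      using \<open>w powr (e / \<theta>) \<le> a powr (e / \<theta>)\<close> by (intro mult_right_mono) auto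
    also have "w powr (1 - e / \<theta>) = x powr (\<theta> - e) * \<kappa> powr (e / \<theta> - 1)"
      unfolding w_def using x kappa_pos theta_neg
      by (simp add: powr_divide powr_powr algebra_simps powr_diff powr_minus_divide)
    finally show ?thesis using a by (simp add: w_def mult_ac)
  qed
  define D where "D = a powr (e / \<theta>) * \<kappa> powr (e / \<theta> - 1)"
  have D: "0 \<le> D" by (simp add: D_def)
  have "total p \<le> (\<Sum>j. ennreal a * (if 0 < measure p {j} then 1 else 0) + ennreal D * ennreal (measure p {j} powr (\<theta> - e)))"
    unfolding total_def
  proof (rule suminf_le)
    fix j
    show "ennreal (measure p {j} powr \<theta> / \<kappa>) \<le> ennreal a * (if 0 < measure p {j} then 1 else 0) + ennreal D * ennreal (measure p {j} powr (\<theta> - e))"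
    proof (cases "0 < measure p {j}")
      case True
      have "ennreal (measure p {j} powr \<theta> / \<kappa>) \<le> ennreal (a + D * measure p {j} powr (\<theta> - e))"
        using pw[OF True] by (intro ennreal_leI) (simp add: D_def)
      also have "\<dots> = ennreal a + ennreal D * ennreal (measure p {j} powr (\<theta> - e))"
        using a D by (subst ennreal_plus) (auto simp: ennreal_mult)
      finally show ?thesis using True by simp
    next
      case False
      hence "measure p {j} = 0" by (metis measure_nonneg less_eq_real_def)
      thus ?thesis by simp
    qed
  qed auto
  also have "\<dots> = ennreal a * num_atoms p + ennreal D * (\<Sum>j. ennreal (measure p {j} powr (\<theta> - e)))"
    unfolding num_atoms_def by (subst suminf_add[symmetric]) auto
  finally show ?thesis by (simp add: D_def)
qed

text \<open>The left side is the integral of \<open>total\<close> over \<open>total > B\<close>.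
  After \<open>total_le\<close>, the number of atoms is split at \<open>R\<close>: up to
  \<open>R\<close> it is at most \<open>R / B * total\<close> on this event, and above
  \<open>R\<close> the moment of order \<open>1 + \<delta>\<close> takes over.\<close>

lemma untamed_le:
  assumes d: "0 < \<delta>" and fin: "atom_moment \<nu> (1 + \<delta>) < \<infinity>" and a: "0 < a" and R: "0 < R" and B: "0 < B"
  shows "measure Q (space Q - tame B) \<le>
    a * (R powr (- \<delta>) * enn2real (atom_moment \<nu> (1 + \<delta>)) + R / B)
    + a powr (e / \<theta>) * \<kappa> powr (e / \<theta> - 1) * enn2real (laplace \<nu> (\<theta> - e))"
proof -
  define D where "D = a powr (e / \<theta>) * \<kappa> powr (e / \<theta> - 1)"
  have D: "0 \<le> D" by (simp add: D_def)
  define mom where "mom p = (if num_atoms p = \<infinity> then \<infinity> else ennreal (enn2real (num_atoms p) powr (1 + \<delta>)))" for p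
  have [measurable]: "mom \<in> borel_measurable \<nu>" unfolding mom_def by measurable
  have mom: "(\<integral>\<^sup>+p. mom p \<partial>\<nu>) = atom_moment \<nu> (1 + \<delta>)"
    unfolding atom_moment_def mom_def num_atoms_eq by (intro nn_integral_cong) simp
  let ?U = "{p\<in>space \<nu>. ennreal B < total p}"
  have num: "num_atoms p * indicator ?U p \<le> ennreal (R powr (- \<delta>)) * mom p + ennreal (R / B) * total p" for p
  proof (cases "p \<in> ?U \<and> num_atoms p \<noteq> \<infinity>")
    case False
    then show ?thesis
      using R by (cases "p \<in> ?U") (auto simp: mom_def ennreal_mult_eq_top_iff top_unique ennreal_eq_0_iff)
  next
    case True
    then obtain n where n: "num_atoms p = ennreal n" "0 \<le> n" by (cases "num_atoms p") auto
    show ?thesis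
    proof (cases "n \<le> R")
      case True
      have "num_atoms p \<le> ennreal (R / B) * ennreal B"
        using True n R B by (simp add: ennreal_mult[symmetric] ennreal_leI)
      also have "\<dots> \<le> ennreal (R / B) * total p"
        using \<open>p \<in> ?U \<and> _\<close> by (intro mult_left_mono) auto
      finally show ?thesis using \<open>p \<in> ?U \<and> _\<close> by (simp add: add_increasing)
    next
      case False
      hence nR: "R < n" by simp
      have "1 \<le> (n / R) powr \<delta>" using nR R d by (intro ge_one_powr_ge_zero) auto
      hence "n * 1 \<le> n * (n / R) powr \<delta>" using n by (intro mult_left_mono) auto
      also have "\<dots> = R powr (- \<delta>) * n powr (1 + \<delta>)"
        using nR R by (simp add: powr_divide powr_add powr_minus_divide)
      finally have "num_atoms p \<le> ennreal (R powr (- \<delta>)) * mom p"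
        using n by (simp add: mom_def ennreal_mult[symmetric] ennreal_leI)
      thus ?thesis using \<open>p \<in> ?U \<and> _\<close> by (simp add: add_increasing2)
    qed
  qed
  have int_num: "(\<integral>\<^sup>+p. num_atoms p * indicator ?U p \<partial>\<nu>) \<le> ennreal (R powr (- \<delta>)) * atom_moment \<nu> (1 + \<delta>) + ennreal (R / B)"
  proof -
    have "(\<integral>\<^sup>+p. num_atoms p * indicator ?U p \<partial>\<nu>) \<le> (\<integral>\<^sup>+p. ennreal (R powr (- \<delta>)) * mom p + ennreal (R / B) * total p \<partial>\<nu>)"
      by (rule nn_integral_mono) (rule num)
    also have "\<dots> = ennreal (R powr (- \<delta>)) * (\<integral>\<^sup>+p. mom p \<partial>\<nu>) + ennreal (R / B) * (\<integral>\<^sup>+p. total p \<partial>\<nu>)"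
      by (simp add: nn_integral_add nn_integral_cmult)
    finally show ?thesis by (simp add: mom integral_total)
  qed
  have "emeasure Q (space Q - tame B) = (\<integral>\<^sup>+z. indicator (space Q - tame B) z \<partial>Q)"
    by (rule nn_integral_indicator[symmetric]) measurable
  also have "\<dots> = (\<integral>\<^sup>+z. indicator ?U (fst z) \<partial>Q)"
    by (intro nn_integral_cong) (auto simp: indicator_def space_Q tame_def)
  also have "\<dots> = (\<integral>\<^sup>+p. total p * indicator ?U p \<partial>\<nu>)"
    by (rule nn_integral_Q_fst) measurable
  also have "\<dots> \<le> (\<integral>\<^sup>+p. ennreal a * (num_atoms p * indicator ?U p) + ennreal D * (\<Sum>j. ennreal (measure p {j} powr (\<theta> - e))) \<partial>\<nu>)"
    using total_le[OF a] by (intro nn_integral_mono) (auto simp: indicator_def D_def)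
  also have "\<dots> = ennreal a * (\<integral>\<^sup>+p. num_atoms p * indicator ?U p \<partial>\<nu>) + ennreal D * laplace \<nu> (\<theta> - e)"
    unfolding laplace_def by (simp add: nn_integral_add nn_integral_cmult)
  also have "\<dots> \<le> ennreal a * (ennreal (R powr (- \<delta>)) * atom_moment \<nu> (1 + \<delta>) + ennreal (R / B)) + ennreal D * laplace \<nu> (\<theta> - e)"
    by (intro add_right_mono mult_left_mono int_num) auto
  also have "\<dots> = ennreal (a * (R powr (- \<delta>) * enn2real (atom_moment \<nu> (1 + \<delta>)) + R / B) + D * enn2real (laplace \<nu> (\<theta> - e)))"
  proof -
    obtain x where x: "atom_moment \<nu> (1 + \<delta>) = ennreal x" "0 \<le> x" using fin by (cases "atom_moment \<nu> (1 + \<delta>)") auto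
    obtain y where y: "laplace \<nu> (\<theta> - e) = ennreal y" "0 \<le> y" using laplace_below by (cases "laplace \<nu> (\<theta> - e)") auto
    show ?thesis using a R B D x y
      by (simp add: ennreal_mult[symmetric] ennreal_plus[symmetric] del: ennreal_plus)
  qed
  finally show ?thesis
    using a R B D unfolding Q.emeasure_eq_measure D_def[symmetric]
    by (subst (asm) ennreal_le_iff) (auto intro!: add_nonneg_nonneg mult_nonneg_nonneg)
qed

lemma untamed_poly:
  assumes d: "0 < \<delta>" and fin: "atom_moment \<nu> (1 + \<delta>) < \<infinity>"
  obtains C \<gamma> where "0 \<le> C" "0 < \<gamma>" "\<And>B. 1 \<le> B \<Longrightarrow> measure Q (space Q - tame B) \<le> C * B powr (- \<gamma>)"
proof -
  \<comment> \<open>\<open>untamed_le\<close> is applied with \<open>a\<close> equal to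
    \<open>B powr \<tau>\<close> and \<open>R\<close> equal to \<open>B powr (1/2)\<close>. Then
    \<open>\<tau> \<le> \<delta> / 4\<close> and \<open>\<tau> \<le> 1 / 4\<close> bring the
    exponents \<open>\<tau> - \<delta> / 2\<close> and \<open>\<tau> - 1/2\<close> down to at most
    \<open>- \<tau>\<close>.\<close>
  define \<tau> where "\<tau> = min \<delta> 1 / 4"
  define \<gamma> where "\<gamma> = min \<tau> (- \<tau> * (e / \<theta>))"
  define C1 where "C1 = enn2real (atom_moment \<nu> (1 + \<delta>))"
  define C2 where "C2 = \<kappa> powr (e / \<theta> - 1) * enn2real (laplace \<nu> (\<theta> - e))"
  have \<tau>: "0 < \<tau>" "\<tau> \<le> \<delta> / 4" "\<tau> \<le> 1 / 4" using d by (auto simp: \<tau>_def)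
  have \<gamma>: "0 < \<gamma>" "\<gamma> \<le> \<tau>" "\<gamma> \<le> - \<tau> * (e / \<theta>)"
    using \<tau> e_pos theta_neg by (auto simp: \<gamma>_def mult_pos_neg divide_pos_neg min_def mult_less_0_iff)
  have C: "0 \<le> C1" "0 \<le> C2" by (auto simp: C1_def C2_def)
  have "measure Q (space Q - tame B) \<le> (C1 + 1 + C2) * B powr (- \<gamma>)" if B: "1 \<le> B" for B
  proof -
    have "measure Q (space Q - tame B) \<le> B powr \<tau> * ((B powr (1/2)) powr (- \<delta>) * C1 + B powr (1/2) / B)
       + (B powr \<tau>) powr (e / \<theta>) * \<kappa> powr (e / \<theta> - 1) * enn2real (laplace \<nu> (\<theta> - e))"
      unfolding C1_def using B by (intro untamed_le[OF d fin]) auto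
    also have "\<dots> = B powr (\<tau> - \<delta> / 2) * C1 + B powr (\<tau> - 1/2) + B powr (\<tau> * (e / \<theta>)) * C2"
    proof -
      have "B powr (1/2) / B = B powr (- (1/2))" using B by (simp add: powr_minus_divide powr_half_sqrt real_div_sqrt field_simps)
      moreover have "B powr \<tau> * (B powr (1/2)) powr (- \<delta>) = B powr (\<tau> - \<delta> / 2)"
        by (simp add: powr_powr powr_add[symmetric])
      moreover have "B powr \<tau> * B powr (- (1/2)) = B powr (\<tau> - 1/2)" by (simp add: powr_add[symmetric])
      ultimately show ?thesis by (simp add: C2_def powr_powr distrib_left mult.assoc[symmetric])
    qed
    also have "\<dots> \<le> B powr (- \<gamma>) * C1 + B powr (- \<gamma>) + B powr (- \<gamma>) * C2"
      using B \<tau> \<gamma> C by (intro add_mono mult_right_mono powr_mono) auto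
    finally show ?thesis by (simp add: algebra_simps)
  qed
  with \<gamma> C show ?thesis by (intro that[of "C1 + 1 + C2" \<gamma>]) auto
qed

lemma measure_walk_tame_ge:
  "\<P>(\<omega> in rw.S. \<bar>rw.walk k \<omega>\<bar> \<le> b) - (1 - measure Q (tame B) ^ k)
    \<le> \<P>(\<omega> in rw.S. \<bar>rw.walk k \<omega>\<bar> \<le> b \<and> (\<forall>i<k. \<omega> i \<in> tame B))"
proof -
  let ?W = "{\<omega>\<in>space rw.S. \<bar>rw.walk k \<omega>\<bar> \<le> b}" and ?T = "{\<omega>\<in>space rw.S. \<forall>i<k. \<omega> i \<in> tame B}"
  have T: "?T \<in> sets rw.S" by measurable
  have "measure rw.S ?W \<le> measure rw.S ({\<omega>\<in>space rw.S. \<bar>rw.walk k \<omega>\<bar> \<le> b \<and> (\<forall>i<k. \<omega> i \<in> tame B)} \<union> (space rw.S - ?T))"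
    by (rule rw.P.finite_measure_mono) auto
  also have "\<dots> \<le> \<P>(\<omega> in rw.S. \<bar>rw.walk k \<omega>\<bar> \<le> b \<and> (\<forall>i<k. \<omega> i \<in> tame B)) + measure rw.S (space rw.S - ?T)"
    by (rule measure_Un_le) auto
  also have "measure rw.S (space rw.S - ?T) = 1 - measure Q (tame B) ^ k"
    using T by (simp add: rw.P.prob_compl measure_all_tame)
  finally show ?thesis by simp
qed

text \<open>The barrier \<open>\<delta> * k\<close> costs
  \<open>exp (\<theta> * \<delta> * k)\<close>, while the truncation and the polynomial factors cost
  at most \<open>exp (- \<delta> * k)\<close> each; together this is the rate
  \<open>(2 - \<theta>) * \<delta>\<close>.\<close>

lemma reach_linear:
  assumes \<delta>: "0 < \<delta>"
  shows "\<forall>\<^sub>F k in sequentially. exp (- (2 - \<theta>) * \<delta> * real k) \<le> reach k ((speed - \<delta>) * real k)"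
proof -
  obtain \<rho> where \<rho>: "0 \<le> \<rho>" "\<rho> < 1"
    "\<And>k. \<P>(\<omega> in rw.S. \<delta> * real k < \<bar>rw.walk k \<omega>\<bar>) \<le> 2 * \<rho> ^ k"
    by (rule walk_linear_deviation[OF \<delta>]) (rule that)
  \<comment> \<open>A constant truncation level \<open>n\<close> is enough here: all
    \<open>k\<close> steps are tame with probability \<open>q ^ k\<close>, which decays more slowly
    than both the deviation bound \<open>\<rho> ^ k\<close> and
    \<open>exp (- \<delta> * k)\<close>.\<close>
  have "max \<rho> (exp (- \<delta>)) < 1" using \<rho> \<delta> by simp
  from order_tendstoD(1)[OF measure_tame_tendsto this]
  have "\<forall>\<^sub>F n in sequentially. 1 \<le> n \<and> max \<rho> (exp (- \<delta>)) < measure Q (tame (real n))"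
    by (intro eventually_conj eventually_ge_at_top)
  then obtain n where n: "1 \<le> n" "max \<rho> (exp (- \<delta>)) < measure Q (tame (real n))"
    by (auto simp: eventually_sequentially)
  define q where "q = measure Q (tame (real n))"
  have q: "\<rho> < q" "exp (- \<delta>) < q" "0 < q" using n \<rho> by (auto simp: q_def intro: le_less_trans)
  have "(\<lambda>k. (\<rho> / q) ^ k) \<longlonglongrightarrow> 0" using q \<rho> by (intro LIMSEQ_realpow_zero) auto
  hence ev1: "\<forall>\<^sub>F k in sequentially. (\<rho> / q) ^ k < 1 / 4" by (rule order_tendstoD) simp
  have ev2: "\<forall>\<^sub>F k in sequentially. 2 * exp 1 * real k ^ 2 * real n \<le> exp (\<delta> * real k)"
    using \<delta> by real_asymp
  show ?thesis using ev1 ev2 eventually_gt_at_top[of 0]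
  proof eventually_elim
    case (elim k)
    let ?W = "{\<omega>\<in>space rw.S. \<bar>rw.walk k \<omega>\<bar> \<le> \<delta> * real k}"
    have "measure rw.S ?W = 1 - \<P>(\<omega> in rw.S. \<delta> * real k < \<bar>rw.walk k \<omega>\<bar>)"
    proof -
      have "?W = space rw.S - {\<omega>\<in>space rw.S. \<delta> * real k < \<bar>rw.walk k \<omega>\<bar>}" by auto
      thus ?thesis by (simp only:) (rule rw.P.prob_compl, measurable)
    qed
    hence "1 - 2 * \<rho> ^ k \<le> measure rw.S ?W" using \<rho>(3)[of k] by linarith
    hence "q ^ k - 2 * \<rho> ^ k \<le> \<P>(\<omega> in rw.S. \<bar>rw.walk k \<omega>\<bar> \<le> \<delta> * real k \<and> (\<forall>i<k. \<omega> i \<in> tame (real n)))"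
      using measure_walk_tame_ge[of k "\<delta> * real k" "real n"] by (simp add: q_def)
    moreover have "4 * \<rho> ^ k \<le> q ^ k" using elim(1) q by (simp add: power_divide divide_less_eq)
    moreover have "exp (- \<delta> * real k) \<le> q ^ k"
      using power_mono[of "exp (- \<delta>)" q k] q by (simp add: exp_of_nat_mult[symmetric] mult_ac)
    ultimately have m: "exp (- \<delta> * real k) / 2 \<le> \<P>(\<omega> in rw.S. \<bar>rw.walk k \<omega>\<bar> \<le> \<delta> * real k \<and> (\<forall>i<k. \<omega> i \<in> tame (real n)))"
      by linarith
    have "exp (- (2 - \<theta>) * \<delta> * real k) = exp (\<theta> * (\<delta> * real k)) * exp (- \<delta> * real k) * exp (- \<delta> * real k)"
      by (simp add: exp_add[symmetric] algebra_simps)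
    also have "\<dots> \<le> exp (\<theta> * (\<delta> * real k)) * (1 / (2 * exp 1 * real k ^ 2 * real n)) * exp (- \<delta> * real k)"
    proof (intro mult_right_mono mult_left_mono)
      have "1 / exp (\<delta> * real k) \<le> 1 / (2 * exp 1 * real k ^ 2 * real n)"
        using elim n by (intro divide_left_mono) auto
      thus "exp (- \<delta> * real k) \<le> 1 / (2 * exp 1 * real k ^ 2 * real n)" by (simp add: exp_minus inverse_eq_divide)
    qed auto
    also have "\<dots> = exp (\<theta> * (\<delta> * real k)) / (exp 1 * real k ^ 2 * real n) * (exp (- \<delta> * real k) / 2)"
      by simp
    also have "\<dots> \<le> exp (\<theta> * (\<delta> * real k)) / (exp 1 * real k ^ 2 * real n) *
       \<P>(\<omega> in rw.S. \<bar>rw.walk k \<omega>\<bar> \<le> \<delta> * real k \<and> (\<forall>i<k. \<omega> i \<in> tame (real n)))"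
      using m by (intro mult_left_mono) auto
    also have "\<dots> \<le> reach k (speed * real k - \<delta> * real k)"
      using elim n \<delta> by (intro reach_ge_walk) auto
    finally show ?case by (simp add: algebra_simps)
  qed
qed

lemma reach_poly:
  assumes d: "0 < \<delta>" and fin: "atom_moment \<nu> (1 + \<delta>) < \<infinity>"
  obtains A a where "0 \<le> A" "0 \<le> a"
    "\<forall>\<^sub>F k in sequentially. real k powr (- a) \<le> reach k (speed * real k - A * ln (real k))"
proof -
  obtain C \<gamma> where C: "0 \<le> C" "0 < \<gamma>" "\<And>B. 1 \<le> B \<Longrightarrow> measure Q (space Q - tame B) \<le> C * B powr (- \<gamma>)"
    by (rule untamed_poly[OF d fin]) (rule that)
  define c where "c = (\<integral>z. \<bar>step z\<bar> \<partial>Q)\<^sup>2 / (16 * (1 + (\<integral>z. (step z)\<^sup>2 \<partial>Q)))"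
  define M where "M = (\<integral>z. exp (e * \<bar>step z\<bar>) \<partial>Q)"
  \<comment> \<open>Makes a step untamed with probability at most \<open>C / k ^ 8\<close>, hence
    one of \<open>k\<close> steps with probability at most \<open>C / k ^ 7\<close>. Steps beyond
    \<open>6 / e * ln k\<close> have probability at most \<open>M / k ^ 6\<close>. Both errors are
    negligible against the central estimate of order \<open>1 / k ^ 5\<close>, so
    \<open>1 / k ^ 6\<close> remains.\<close>
  define D where "D = 8 / \<gamma>"
  \<comment> \<open>Collects the exponents: \<open>12 * \<theta> / e\<close> from the barrier,
    \<open>D\<close> from \<open>B\<close>, and 9 as 2 for \<open>k ^ 2\<close>, 6 for the walk and
    1 for the factor \<open>exp 1 \<le> k\<close>.\<close>
  define a where "a = 9 + D - 12 * \<theta> / e"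
  define A where "A = 12 / e"
  have c: "0 < c" unfolding c_def
    by (intro divide_pos_pos mult_pos_pos add_pos_nonneg Bochner_Integration.integral_nonneg zero_less_power abs_step_pos) auto
  have D: "0 < D" using C by (simp add: D_def)
  have ev1: "\<forall>\<^sub>F k in sequentially. 1 / real k ^ 6 \<le> (c\<^sup>2 / real k ^ 4 - 2 * M / real k ^ 5) / (real k + 1) - C / real k ^ 7"
    using c by real_asymp
  show ?thesis
  proof (rule that[of A a])
    show "\<forall>\<^sub>F k in sequentially. real k powr (- a) \<le> reach k (speed * real k - A * ln (real k))"
      using ev1 eventually_ge_at_top[of 3]
    proof eventually_elim
      case (elim k)
      have k: "0 < k" "1 \<le> real k" using elim(2) by auto
      define r where "r = 6 / e * ln (real k)"
      define B where "B = real k powr D"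
      have B: "1 \<le> B" unfolding B_def using k D by (intro ge_one_powr_ge_zero) auto
      have r: "0 \<le> r" using k e_pos by (simp add: r_def)
      let ?W = "\<P>(\<omega> in rw.S. \<bar>rw.walk k \<omega>\<bar> \<le> 2 * r)"
      have "c\<^sup>2 / real k ^ 4 - 2 * real k * \<P>(z in Q. r < \<bar>step z\<bar>) \<le> (real k + 1) * ?W"
        unfolding c_def by (rule rw.measure_walk_central_ge[OF k(1) r integrable_step mean_step integrable_step2 abs_step_pos])
      moreover have "2 * real k * \<P>(z in Q. r < \<bar>step z\<bar>) \<le> 2 * M / real k ^ 5"
      proof -
        have "\<P>(z in Q. r < \<bar>step z\<bar>) \<le> M * exp (- e * r)"
          unfolding M_def by (rule measure_step_gt)
        also have "exp (- e * r) = 1 / real k ^ 6"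
        proof -
          have "exp (6 * ln (real k)) = real k ^ 6"
            using k exp_of_nat_mult[of 6 "ln (real k)"] by simp
          moreover have "- e * r = - (6 * ln (real k))" using e_pos by (simp add: r_def)
          ultimately show ?thesis by (simp only: exp_minus inverse_eq_divide)
        qed
        finally have "2 * real k * \<P>(z in Q. r < \<bar>step z\<bar>) \<le> 2 * real k * (M * (1 / real k ^ 6))"
          by (intro mult_left_mono) auto
        also have "\<dots> = 2 * M / real k ^ 5" using k by (simp add: field_simps power_numeral_reduce)
        finally show ?thesis .
      qed
      ultimately have "c\<^sup>2 / real k ^ 4 - 2 * M / real k ^ 5 \<le> (real k + 1) * ?W" by linarith
      hence w: "(c\<^sup>2 / real k ^ 4 - 2 * M / real k ^ 5) / (real k + 1) \<le> ?W"
        using k by (simp add: divide_le_eq mult.commute)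
      have t: "1 - measure Q (tame B) ^ k \<le> C / real k ^ 7"
      proof -
        have x: "measure Q (space Q - tame B) = 1 - measure Q (tame B)" by (rule Q.prob_compl) measurable
        have "1 + real k * (measure Q (tame B) - 1) \<le> (1 + (measure Q (tame B) - 1)) ^ k"
          by (rule Bernoulli_inequality) (simp add: measure_nonneg)
        hence "1 - measure Q (tame B) ^ k \<le> real k * measure Q (space Q - tame B)"
          unfolding x by (simp add: algebra_simps)
        also have "\<dots> \<le> real k * (C * B powr (- \<gamma>))" using C(3)[OF B] by (intro mult_left_mono) auto
        also have "B powr (- \<gamma>) = 1 / real k ^ 8"
        proof -
          have "D * - \<gamma> = - 8" using C by (simp add: D_def)
          hence "B powr (- \<gamma>) = real k powr (- 8)" unfolding B_def by (simp only: powr_powr)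
          also have "\<dots> = 1 / real k ^ 8" using k by (simp add: powr_minus_divide)
          finally show ?thesis .
        qed
        also have "real k * (C * (1 / real k ^ 8)) = C / real k ^ 7"
          using k by (simp add: field_simps power_numeral_reduce)
        finally show ?thesis .
      qed
      have m: "1 / real k ^ 6 \<le> \<P>(\<omega> in rw.S. \<bar>rw.walk k \<omega>\<bar> \<le> 2 * r \<and> (\<forall>i<k. \<omega> i \<in> tame B))"
        using elim(1) w t measure_walk_tame_ge[of k "2 * r" B] by linarith
      have "real k powr (- a) = real k powr (12 * \<theta> / e) * real k powr (- D) * real k powr (- 2) * real k powr (- 6) * real k powr (- 1)"
      proof -
        have "- a = 12 * \<theta> / e + - D + - 2 + - 6 + - 1" by (simp add: a_def)
        thus ?thesis by (simp only: powr_add)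
      qed
      also have "\<dots> \<le> real k powr (12 * \<theta> / e) * real k powr (- D) * real k powr (- 2) * real k powr (- 6) * (1 / exp 1)"
      proof (rule mult_left_mono)
        have "exp 1 \<le> real k" using elim(2) exp_le by linarith
        thus "real k powr (- 1) \<le> 1 / exp 1" using k by (simp add: powr_minus_divide frac_le)
      qed auto
      also have "\<dots> = exp (\<theta> * (2 * r)) / (exp 1 * real k ^ 2 * B) * (1 / real k ^ 6)"
      proof -
        have "real k powr (12 * \<theta> / e) = exp (\<theta> * (2 * r))" using k by (simp add: powr_def r_def mult_ac)
        moreover have "real k powr (- D) = 1 / B" by (simp add: B_def powr_minus_divide)
        moreover have "real k powr (- 2) = 1 / real k ^ 2" "real k powr (- 6) = 1 / real k ^ 6"
          using k by (simp_all add: powr_minus_divide)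
        ultimately show ?thesis by simp
      qed
      also have "\<dots> \<le> exp (\<theta> * (2 * r)) / (exp 1 * real k ^ 2 * B) *
          \<P>(\<omega> in rw.S. \<bar>rw.walk k \<omega>\<bar> \<le> 2 * r \<and> (\<forall>i<k. \<omega> i \<in> tame B))"
        using m B by (intro mult_left_mono) auto
      also have "\<dots> \<le> reach k (speed * real k - 2 * r)"
        using k B r by (intro reach_ge_walk) auto
      finally show ?case by (simp add: r_def A_def)
    qed
    show "0 \<le> A" using e_pos by (simp add: A_def)
    have "12 * \<theta> / e \<le> 0" using e_pos theta_neg by (intro divide_nonpos_pos) auto
    thus "0 \<le> a" using D by (simp add: a_def)
  qed
qed

lemma boosted_le:
  assumes "0 < p" "p \<le> reach k z" "m + k = K"
  shows "1 - reach K z \<le> (1 / p) * exp (- real m * ln (1 + measure \<nu> branching))"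
proof -
  have R: "0 < reach k z" using assms by linarith
  have "1 - reach K z \<le> (1 / reach k z) / (1 + measure \<nu> branching) ^ m"
    using boost[OF R, of m] assms(3) by simp
  also have "\<dots> \<le> (1 / p) / (1 + measure \<nu> branching) ^ m"
    using assms by (intro divide_right_mono divide_left_mono) (auto simp: add_nonneg_nonneg)
  also have "\<dots> = (1 / p) * exp (- real m * ln (1 + measure \<nu> branching))"
    using branching_pos by (simp add: exp_minus exp_of_nat_mult field_simps)
  finally show ?thesis .
qed

text \<open>About \<open>\<mu> * K\<close> generations are spent on branching, which gains an
  exponential factor, and the remaining ones on a single trial at rate
  \<open>speed - \<delta>\<close>, whose cost is exponential at a smaller rate.\<close>

lemma summable_reach_linear:
  assumes \<epsilon>: "0 < \<epsilon>"
  shows "summable (\<lambda>K. 1 - reach K ((speed - \<epsilon>) * real K))"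
proof -
  define l where "l = ln (1 + measure \<nu> branching)"
  have l: "0 < l" using branching_pos by (simp add: l_def)
  \<comment> \<open>The generations given up cost at most half of the slack
    \<open>\<epsilon>\<close>; \<open>\<mu> \<le> 1 / 2\<close> keeps \<open>k\<close> at least
    \<open>K / 2\<close>.\<close>
  define \<mu> where "\<mu> = min (\<epsilon> / (2 * speed)) (1 / 2)"
  have \<mu>: "0 < \<mu>" "\<mu> \<le> 1 / 2" "\<mu> * speed \<le> \<epsilon> / 2"
    using \<epsilon> speed_pos by (auto simp: \<mu>_def min_def field_simps)
  \<comment> \<open>Keeps the cost \<open>(2 - \<theta>) * \<delta>\<close> of a trial below half of
    the gain \<open>\<mu> * l\<close>, and its loss of speed within the other half of
    \<open>\<epsilon>\<close>.\<close>
  define \<delta> where "\<delta> = min (\<epsilon> / 2) (\<mu> * l / (2 * (2 - \<theta>)))"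
  have "0 < \<mu> * l / (2 * (2 - \<theta>))" using \<mu> l theta_neg by (intro divide_pos_pos mult_pos_pos) auto
  hence \<delta>: "0 < \<delta>" "\<delta> \<le> \<epsilon> / 2"
    unfolding \<delta>_def using \<epsilon> by (simp, intro min.cobounded1)
  have \<delta>2: "(2 - \<theta>) * \<delta> \<le> \<mu> * l / 2"
  proof -
    have "(2 - \<theta>) * \<delta> \<le> (2 - \<theta>) * (\<mu> * l / (2 * (2 - \<theta>)))"
      using theta_neg by (intro mult_left_mono) (auto simp: \<delta>_def)
    also have "\<dots> = \<mu> * l / 2" using theta_neg by (simp add: divide_simps)
    finally show ?thesis .
  qed
  obtain N where N: "\<And>k. N \<le> k \<Longrightarrow> exp (- (2 - \<theta>) * \<delta> * real k) \<le> reach k ((speed - \<delta>) * real k)"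
    using reach_linear[OF \<delta>(1)] by (auto simp: eventually_sequentially)
  have bound: "norm (1 - reach K ((speed - \<epsilon>) * real K)) \<le> exp l * exp (- (\<mu> * l / 2)) ^ K" if K: "2 * N \<le> K" for K
  proof -
    define m where "m = nat \<lfloor>\<mu> * real K\<rfloor>"
    have m: "real m \<le> \<mu> * real K" "\<mu> * real K - 1 \<le> real m" using \<mu> by (auto simp: m_def)
    have "\<mu> * real K \<le> 1 / 2 * real K" using \<mu> by (intro mult_right_mono) auto
    hence mK: "2 * m \<le> K" using m by linarith
    define k where "k = K - m"
    have k: "m + k = K" "N \<le> k" "k \<le> K" using mK K by (auto simp: k_def)
    have z: "(speed - \<epsilon>) * real K \<le> (speed - \<delta>) * real k"
    proof -
      have "speed * real m \<le> speed * (\<mu> * real K)" using m speed_pos by (intro mult_left_mono) auto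
      also have "\<dots> \<le> \<epsilon> / 2 * real K" using mult_right_mono[OF \<mu>(3), of "real K"] by (simp add: mult_ac)
      finally have 1: "speed * real m \<le> \<epsilon> / 2 * real K" .
      have "\<delta> * real k \<le> \<epsilon> / 2 * real K" using \<delta> k by (intro mult_mono) auto
      moreover have "real K = real m + real k" using k(1) by linarith
      ultimately show ?thesis using 1 by (simp add: algebra_simps)
    qed
    have "exp (- ((2 - \<theta>) * \<delta> * real k)) \<le> reach k ((speed - \<delta>) * real k)"
      using N[OF k(2)] by (simp only: mult_minus_left)
    also have "\<dots> \<le> reach k ((speed - \<epsilon>) * real K)"
      by (rule reach_antimono[OF z])
    finally have "exp (- ((2 - \<theta>) * \<delta> * real k)) \<le> reach k ((speed - \<epsilon>) * real K)" .
    from boosted_le[OF _ this k(1)]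
    have "1 - reach K ((speed - \<epsilon>) * real K) \<le> 1 / exp (- ((2 - \<theta>) * \<delta> * real k)) * exp (- real m * l)"
      by (simp add: l_def)
    also have "1 / exp (- ((2 - \<theta>) * \<delta> * real k)) = exp ((2 - \<theta>) * \<delta> * real k)"
      by (simp only: exp_minus divide_inverse inverse_inverse_eq mult_1)
    also have "exp ((2 - \<theta>) * \<delta> * real k) * exp (- real m * l) = exp ((2 - \<theta>) * \<delta> * real k - real m * l)"
      by (simp add: exp_diff exp_minus divide_inverse)
    also have "\<dots> \<le> exp (l + - (\<mu> * l / 2) * real K)"
    proof -
      have "(2 - \<theta>) * \<delta> * real k \<le> \<mu> * l / 2 * real K"
        using \<delta>2 k \<mu> l by (intro mult_mono) auto
      moreover have "(\<mu> * real K - 1) * l \<le> real m * l" using m l by (intro mult_right_mono) auto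
      ultimately show ?thesis by (simp add: algebra_simps)
    qed
    also have "\<dots> = exp l * exp (- (\<mu> * l / 2)) ^ K"
      by (simp only: exp_add exp_of_nat_mult[symmetric] mult.commute[of _ "real K"])
    finally show ?thesis by (simp add: reach_bounds)
  qed
  have "summable (\<lambda>K. exp l * exp (- (\<mu> * l / 2)) ^ K)"
    using \<mu> l by (intro summable_mult summable_geometric) auto
  thus ?thesis
    by (rule summable_comparison_test'[where N="2 * N"]) (use bound in auto)
qed

lemma summable_reach_log:
  assumes d: "0 < \<delta>" and fin: "atom_moment \<nu> (1 + \<delta>) < \<infinity>"
  obtains A where "0 \<le> A" "summable (\<lambda>K. 1 - reach K (speed * real K - A * ln (real K)))"
proof -
  obtain A a where A: "0 \<le> A" "0 \<le> a"
    "\<forall>\<^sub>F k in sequentially. real k powr (- a) \<le> reach k (speed * real k - A * ln (real k))"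
    by (rule reach_poly[OF d fin])
  then obtain N where N: "\<And>k. N \<le> k \<Longrightarrow> real k powr (- a) \<le> reach k (speed * real k - A * ln (real k))"
    by (auto simp: eventually_sequentially)
  define l where "l = ln (1 + measure \<nu> branching)"
  have l: "0 < l" using branching_pos by (simp add: l_def)
  \<comment> \<open>With \<open>D * ln K\<close> generations of branching the failure probability is
    at most \<open>K powr a * K powr (- a - 2)\<close>, that is \<open>K powr (- 2)\<close>.\<close>
  define D where "D = (a + 2) / l"
  have D: "0 < D" using l A by (simp add: D_def)
  \<comment> \<open>Absorbs the displacement \<open>speed * m\<close> that is given up, with
    \<open>m \<le> (D + 1) * ln K\<close> once \<open>ln K \<ge> 1\<close>.\<close>
  define A' where "A' = speed * (D + 1) + A"
  have "\<forall>\<^sub>F K in sequentially. D * ln (real K) + 1 \<le> real K / 2" using D by real_asymp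
  hence ev: "\<forall>\<^sub>F K in sequentially. norm (1 - reach K (speed * real K - A' * ln (real K))) \<le> real K powr (- 2)"
    using eventually_ge_at_top[of "2 * N + 3"]
  proof eventually_elim
    case (elim K)
    have "exp 1 \<le> real K" using elim(2) exp_le by linarith
    hence lnK: "1 \<le> ln (real K)" using elim(2) by (subst ln_ge_iff) auto
    define m where "m = nat \<lceil>D * ln (real K)\<rceil>"
    have m: "D * ln (real K) \<le> real m" "real m \<le> D * ln (real K) + 1"
      using D lnK by (auto simp: m_def intro: less_imp_le of_nat_ceiling)
    hence "2 * m \<le> K" using elim(1) by linarith
    define k where "k = K - m"
    have k: "m + k = K" "N \<le> k" "k \<le> K" "0 < k" using \<open>2 * m \<le> K\<close> elim(2) by (auto simp: k_def)
    have "ln (real k) \<le> ln (real K)" using k by simp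
    hence "speed * real K - A' * ln (real K) \<le> speed * real k - A * ln (real k)"
    proof -
      assume lnk: "ln (real k) \<le> ln (real K)"
      have "speed * real m \<le> speed * ((D + 1) * ln (real K))"
        using m lnK speed_pos by (intro mult_left_mono) (auto simp: algebra_simps)
      moreover have "A * ln (real k) \<le> A * ln (real K)" using lnk A by (intro mult_left_mono)
      moreover have "real K = real m + real k" using k(1) by linarith
      ultimately show ?thesis by (simp add: A'_def algebra_simps)
    qed
    hence "real k powr (- a) \<le> reach k (speed * real K - A' * ln (real K))"
      by (rule order_trans[OF N[OF k(2)] reach_antimono])
    moreover have "real K powr (- a) \<le> real k powr (- a)"
      using k A by (intro powr_mono2') auto
    ultimately have "real K powr (- a) \<le> reach k (speed * real K - A' * ln (real K))" by linarith
    from boosted_le[OF _ this k(1)]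
    have "1 - reach K (speed * real K - A' * ln (real K)) \<le> real K powr a * exp (- real m * l)"
      using k by (simp add: l_def powr_minus_divide)
    also have "\<dots> \<le> real K powr a * exp (- (D * ln (real K)) * l)"
      using m l by (intro mult_left_mono) auto
    also have "\<dots> = real K powr (- 2)"
    proof -
      have "D * ln (real K) * l = (a + 2) * ln (real K)" using l by (simp add: D_def)
      thus ?thesis using k by (simp add: powr_def exp_add[symmetric] algebra_simps)
    qed
    finally show ?case by (simp add: reach_bounds)
  qed
  have "summable (\<lambda>K. real K powr (- 2))" by (simp add: summable_real_powr_iff)
  hence "summable (\<lambda>K. 1 - reach K (speed * real K - A' * ln (real K)))"
    by (rule summable_comparison_test_ev[OF ev])
  moreover have "0 \<le> A'" using A D speed_pos by (simp add: A'_def)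
  ultimately show ?thesis by (intro that)
qed

end

section \<open>Balls in boxes\<close>

context nested_occupancy
begin

abbreviation "EnvF \<equiv> env_algebra M \<rho>"

definition in_box :: "nat \<Rightarrow> nat list \<Rightarrow> 'a set" where
  "in_box b i = {\<omega>\<in>space M. ball_box Y b (length i) \<omega> = i}"

lemma meas_rho[measurable]: "\<rho> i \<in> measurable M mass_space"
  using env_indep by (auto simp: indep_vars_def)

lemma meas_env: "(\<lambda>\<omega> i. \<rho> i \<omega>) \<in> measurable M (\<Pi>\<^sub>M i\<in>UNIV. mass_space)"
  by (rule measurable_PiM_single') (auto intro: measurable_space[OF meas_rho])

lemma subalgebra_env: "subalgebra M EnvF"
  unfolding subalgebra_def env_algebra_def
  using sets_image_in_sets[OF refl meas_env] by simp

sublocale env: finite_measure_subalgebra M EnvF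
  by unfold_locales (rule subalgebra_env)

lemma meas_rho_env[measurable]: "\<rho> i \<in> measurable EnvF mass_space"
proof -
  have "(\<lambda>\<omega> i. \<rho> i \<omega>) \<in> measurable EnvF (\<Pi>\<^sub>M i\<in>UNIV. mass_space)"
    unfolding env_algebra_def
    by (rule measurable_vimage_algebra1) (use measurable_space[OF meas_env] in auto)
  from measurable_compose[OF this measurable_component_singleton[of i]] show ?thesis by simp
qed

lemma space_env: "space EnvF = space M"
  by (simp add: env_algebra_def)

lemma meas_box_size_env[measurable]: "box_size \<rho> i \<in> borel_measurable EnvF"
  unfolding box_size_def by measurable

lemma meas_box_size[measurable]: "box_size \<rho> i \<in> borel_measurable M"
  unfolding box_size_def by measurable

lemma env_sets: "A \<in> sets EnvF \<Longrightarrow> A \<in> sets M"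
  using subalgebra_env by (auto simp: subalgebra_def)

lemma prob_space_rho: "\<omega> \<in> space M \<Longrightarrow> prob_space (\<rho> i \<omega>)" "\<omega> \<in> space M \<Longrightarrow> sets (\<rho> i \<omega>) = UNIV"
  using measurable_space[OF meas_rho, of \<omega> i] by (auto simp: space_prob_algebra)

lemma box_size_le_1: "\<omega> \<in> space M \<Longrightarrow> box_size \<rho> i \<omega> \<le> 1"
  unfolding box_size_def
  using prob_space_rho(1) by (intro prod_le_1) (auto simp: prob_space.prob_le_1)

lemma meas_Y[measurable]: "Y b \<in> measurable M (\<Pi>\<^sub>M k\<in>UNIV. count_space UNIV)"
  using balls_indep by (auto simp: cond_indep_vars_def)

text \<open>Writing \<open>in_box\<close> as the preimage of a cylinder under \<open>Y b\<close>
  brings it into the form that \<open>cond_indep_vars\<close> requires.\<close>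

definition path_set :: "nat list \<Rightarrow> (nat \<Rightarrow> nat) set" where
  "path_set i = {y. \<forall>k<length i. y k = i ! k}"

lemma sets_path_set[measurable]: "path_set i \<in> sets (\<Pi>\<^sub>M k\<in>UNIV. count_space UNIV)"
proof -
  have "path_set i = {y\<in>space (\<Pi>\<^sub>M k\<in>UNIV. count_space UNIV). \<forall>k<length i. y k = i ! k}"
    by (simp add: path_set_def space_PiM)
  thus ?thesis by simp
qed

lemma in_box_eq: "in_box b i = {\<omega>\<in>space M. Y b \<omega> \<in> path_set i}"
proof -
  have "map f [0..<length i] = i \<longleftrightarrow> (\<forall>k<length i. f k = i ! k)" for f
    by (subst list_eq_iff_nth_eq) simp
  thus ?thesis by (simp add: in_box_def ball_box_def path_set_def)
qed

lemma sets_in_box[measurable]: "in_box b i \<in> sets M"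
  unfolding in_box_eq by measurable

lemma cond_exp_in_box:
  "AE \<omega> in M. real_cond_exp M EnvF (indicator (in_box b i)) \<omega> = box_size \<rho> i \<omega>"
proof (induction i rule: rev_induct)
  case Nil
  have "in_box b [] = space M" by (simp add: in_box_def ball_box_def)
  moreover have "AE \<omega> in M. real_cond_exp M EnvF (indicator (space M)) \<omega> = indicator (space M) \<omega>"
  proof (rule env.real_cond_exp_F_meas)
    show "integrable M (indicator (space M) :: _ \<Rightarrow> real)"
      by (rule integrable_real_indicator) (auto simp: emeasure_eq_measure)
    show "indicator (space M) \<in> borel_measurable EnvF"
      using space_env by (metis borel_measurable_indicator sets.top)
  qed
  ultimately show ?case using AE_space by (auto simp: box_size_Nil elim: eventually_elim2)
next
  case (snoc j i)
  show ?case using snoc ball_step[of b i j]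
    by eventually_elim (simp add: in_box_def box_size_snoc)
qed

text \<open>Conditional independence integrated over an environment event. All later estimates on
  the balls use their conditional law in this form.\<close>

lemma integral_in_boxes:
  assumes J: "finite J" and E: "E \<in> sets EnvF"
  shows "(\<integral>\<omega>. indicator E \<omega> * (\<Prod>b\<in>J. indicator (in_box b i) \<omega>) \<partial>M) =
    (\<integral>\<omega>. indicator E \<omega> * box_size \<rho> i \<omega> ^ card J \<partial>M)"
proof -
  let ?A = "{\<omega>\<in>space M. \<forall>b\<in>J. Y b \<omega> \<in> path_set i}"
  have A: "?A \<in> sets M" using J by measurable
  have Em: "E \<in> sets M" using env_sets[OF E] .
  have "AE \<omega> in M. real_cond_exp M EnvF (indicator ?A) \<omega> = (\<Prod>b\<in>J. real_cond_exp M EnvF (indicator (in_box b i)) \<omega>)"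
    using balls_indep J unfolding cond_indep_vars_def in_box_eq by simp
  moreover have "AE \<omega> in M. \<forall>b\<in>J. real_cond_exp M EnvF (indicator (in_box b i)) \<omega> = box_size \<rho> i \<omega>"
    using J cond_exp_in_box by (intro AE_finite_allI)
  ultimately have ae: "AE \<omega> in M. real_cond_exp M EnvF (indicator ?A) \<omega> = box_size \<rho> i \<omega> ^ card J"
    by eventually_elim (simp cong: prod.cong)
  have "(\<integral>\<omega>. indicator E \<omega> * (\<Prod>b\<in>J. indicator (in_box b i) \<omega>) \<partial>M) = (\<integral>\<omega>. indicator E \<omega> * (indicator ?A \<omega> :: real) \<partial>M)"
  proof (rule Bochner_Integration.integral_cong[OF refl])
    fix \<omega> assume w: "\<omega> \<in> space M"
    have "(\<Prod>b\<in>J. indicator (in_box b i) \<omega>) = (indicator ?A \<omega> :: real)"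
    proof (cases "\<omega> \<in> ?A")
      case True
      then show ?thesis by (simp add: in_box_eq)
    next
      case False
      then obtain b where b: "b \<in> J" "\<omega> \<notin> in_box b i" using w by (auto simp: in_box_eq)
      have "(\<Prod>b\<in>J. indicator (in_box b i) \<omega>) = (0 :: real)"
        by (rule prod_zero[OF J]) (use b in \<open>auto intro!: bexI[of _ b]\<close>)
      then show ?thesis using False by simp
    qed
    thus "indicator E \<omega> * (\<Prod>b\<in>J. indicator (in_box b i) \<omega>) = indicator E \<omega> * (indicator ?A \<omega> :: real)" by simp
  qed
  also have "\<dots> = (\<integral>\<omega>. indicator E \<omega> * real_cond_exp M EnvF (indicator ?A) \<omega> \<partial>M)"
  proof (rule env.real_cond_exp_intg(2)[symmetric])
    have "integrable M (\<lambda>\<omega>. indicator (E \<inter> ?A) \<omega> :: real)"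
      using A Em by (intro integrable_real_indicator) (auto simp: emeasure_eq_measure)
    thus "integrable M (\<lambda>\<omega>. indicator E \<omega> * indicator ?A \<omega> :: real)" by (simp only: indicator_inter_arith)
  qed (use A E in auto)
  also have "\<dots> = (\<integral>\<omega>. indicator E \<omega> * box_size \<rho> i \<omega> ^ card J \<partial>M)"
    using ae Em A by (intro integral_cong_AE) auto
  finally show ?thesis .
qed

lemma power_ball_count:
  assumes "\<omega> \<in> space M"
  shows "z ^ ball_count Y n i \<omega> = (\<Prod>b<n. (z - 1) * indicator (in_box b i) \<omega> + (1::real))"
proof -
  have "(\<Prod>b<n. (z - 1) * indicator (in_box b i) \<omega> + (1::real)) = (\<Prod>b<n. if ball_box Y b (length i) \<omega> = i then z else 1)"
    using assms by (intro prod.cong) (auto simp: in_box_def)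
  also have "\<dots> = (\<Prod>b\<in>{b\<in>{..<n}. ball_box Y b (length i) \<omega> = i}. z)"
    by (rule prod.inter_filter[symmetric]) simp
  finally show ?thesis by (simp add: ball_count_def)
qed

lemma integrable_bdd:
  fixes f :: "'a \<Rightarrow> real"
  assumes "f \<in> borel_measurable M" "\<And>\<omega>. \<omega> \<in> space M \<Longrightarrow> \<bar>f \<omega>\<bar> \<le> B"
  shows "integrable M f"
  using assms by (intro integrable_const_bound[where B=B]) auto

text \<open>Given the environment, the count is binomial with parameters \<open>n\<close> and the
  box size, and this is its generating function. Expanding over sets of balls avoids constructing
  conditional distributions.\<close>

lemma integral_power_ball_count:
  assumes E: "E \<in> sets EnvF"
  shows "(\<integral>\<omega>. indicator E \<omega> * z ^ ball_count Y n i \<omega> \<partial>M) =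
    (\<integral>\<omega>. indicator E \<omega> * (1 + (z - 1) * box_size \<rho> i \<omega>) ^ n \<partial>M)"
proof -
  have Em[measurable]: "E \<in> sets M" using env_sets[OF E] .
  have "(\<integral>\<omega>. indicator E \<omega> * z ^ ball_count Y n i \<omega> \<partial>M) =
     (\<integral>\<omega>. (\<Sum>X\<in>Pow {..<n}. (z - 1) ^ card X * (indicator E \<omega> * (\<Prod>b\<in>X. indicator (in_box b i) \<omega>))) \<partial>M)"
  proof (rule Bochner_Integration.integral_cong[OF refl])
    fix \<omega> assume w: "\<omega> \<in> space M"
    show "indicator E \<omega> * z ^ ball_count Y n i \<omega> =
      (\<Sum>X\<in>Pow {..<n}. (z - 1) ^ card X * (indicator E \<omega> * (\<Prod>b\<in>X. indicator (in_box b i) \<omega>)))"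
      unfolding power_ball_count[OF w] prod_add[OF finite_lessThan]
      by (simp add: prod.distrib sum_distrib_left mult_ac)
  qed
  also have "\<dots> = (\<Sum>X\<in>Pow {..<n}. (\<integral>\<omega>. (z - 1) ^ card X * (indicator E \<omega> * (\<Prod>b\<in>X. indicator (in_box b i) \<omega>)) \<partial>M))"
  proof (rule Bochner_Integration.integral_sum)
    fix X assume "X \<in> Pow {..<n}"
    show "integrable M (\<lambda>\<omega>. (z - 1) ^ card X * (indicator E \<omega> * (\<Prod>b\<in>X. indicator (in_box b i) \<omega>)))"
    proof (intro integrable_mult_right integrable_bdd[where B=1])
      have "(\<Prod>b\<in>X. indicator (in_box b i) \<omega> :: real) \<le> 1" "0 \<le> (\<Prod>b\<in>X. indicator (in_box b i) \<omega> :: real)" for \<omega>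
        by (auto intro!: prod_le_1 prod_nonneg simp: indicator_def)
      thus "\<bar>indicator E \<omega> * (\<Prod>b\<in>X. indicator (in_box b i) \<omega>) :: real\<bar> \<le> 1" for \<omega>
        by (auto simp: indicator_def abs_of_nonneg)
    qed measurable
  qed
  also have "\<dots> = (\<Sum>X\<in>Pow {..<n}. (\<integral>\<omega>. (z - 1) ^ card X * (indicator E \<omega> * box_size \<rho> i \<omega> ^ card X) \<partial>M))"
  proof (rule sum.cong[OF refl])
    fix X assume "X \<in> Pow {..<n}"
    hence "finite X" by (auto intro: finite_subset)
    thus "(\<integral>\<omega>. (z - 1) ^ card X * (indicator E \<omega> * (\<Prod>b\<in>X. indicator (in_box b i) \<omega>)) \<partial>M) =
      (\<integral>\<omega>. (z - 1) ^ card X * (indicator E \<omega> * box_size \<rho> i \<omega> ^ card X) \<partial>M)"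
      using integral_in_boxes[OF _ E] by simp
  qed
  also have "\<dots> = (\<integral>\<omega>. (\<Sum>X\<in>Pow {..<n}. (z - 1) ^ card X * (indicator E \<omega> * box_size \<rho> i \<omega> ^ card X)) \<partial>M)"
  proof (rule Bochner_Integration.integral_sum[symmetric])
    fix X :: "nat set"
    show "integrable M (\<lambda>\<omega>. (z - 1) ^ card X * (indicator E \<omega> * box_size \<rho> i \<omega> ^ card X))"
      by (intro integrable_mult_right integrable_bdd[where B=1])
         (auto simp: indicator_def abs_of_nonneg box_size_nonneg box_size_le_1 power_le_one)
  qed
  also have "\<dots> = (\<integral>\<omega>. indicator E \<omega> * (1 + (z - 1) * box_size \<rho> i \<omega>) ^ n \<partial>M)"
  proof (rule Bochner_Integration.integral_cong[OF refl])
    fix \<omega>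
    have "(1 + (z - 1) * box_size \<rho> i \<omega>) ^ n = (\<Prod>b<n. (z - 1) * box_size \<rho> i \<omega> + 1)" by (simp add: add.commute)
    also have "\<dots> = (\<Sum>X\<in>Pow {..<n}. (\<Prod>b\<in>X. (z - 1) * box_size \<rho> i \<omega>) * (\<Prod>b\<in>{..<n}-X. 1))"
      by (rule prod_add) simp
    finally show "(\<Sum>X\<in>Pow {..<n}. (z - 1) ^ card X * (indicator E \<omega> * box_size \<rho> i \<omega> ^ card X)) =
      indicator E \<omega> * (1 + (z - 1) * box_size \<rho> i \<omega>) ^ n"
      by (simp add: sum_distrib_left power_mult_distrib mult_ac)
  qed
  finally show ?thesis .
qed

lemma meas_ball_count[measurable]: "(\<lambda>\<omega>. ball_count Y n i \<omega>) \<in> measurable M (count_space UNIV)"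
proof -
  have "(\<lambda>\<omega>. \<Sum>b<n. if \<omega> \<in> in_box b i then 1 else 0 :: nat) \<in> measurable M (count_space UNIV)" by measurable
  moreover have "(\<Sum>b<n. if \<omega> \<in> in_box b i then 1 else 0 :: nat) = ball_count Y n i \<omega>" if "\<omega> \<in> space M" for \<omega>
  proof -
    have "{b. b < n \<and> ball_box Y b (length i) \<omega> = i} = {..<n} \<inter> {b. \<omega> \<in> in_box b i}"
      using that by (auto simp: in_box_def)
    thus ?thesis by (simp add: ball_count_def sum.If_cases)
  qed
  ultimately show ?thesis by (subst (asm) measurable_cong) auto
qed

lemma sets_ball_count:
  assumes "E \<in> sets M"
  shows "{\<omega>\<in>E. P (ball_count Y n i \<omega>)} \<in> sets M"
proof -
  have "Measurable.pred M (\<lambda>\<omega>. P (ball_count Y n i \<omega>))"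
    by (rule measurable_compose[OF meas_ball_count]) simp
  hence "E \<inter> {\<omega>\<in>space M. P (ball_count Y n i \<omega>)} \<in> sets M"
    using assms by (simp add: pred_def)
  moreover have "E \<inter> {\<omega>\<in>space M. P (ball_count Y n i \<omega>)} = {\<omega>\<in>E. P (ball_count Y n i \<omega>)}"
    using sets.sets_into_space[OF assms] by auto
  ultimately show ?thesis by simp
qed

text \<open>Markov's inequality for a power of \<open>z\<close>, followed by
  \<open>1 + x \<le> exp x\<close>. One form serves both tails: \<open>z = 2\<close> for many balls
  and \<open>z = 1/2\<close> for few.\<close>

lemma ball_count_chernoff:
  assumes E: "E \<in> sets EnvF" and z: "0 < z" "z \<le> 2"
    and B: "\<And>\<omega>. \<omega> \<in> E \<Longrightarrow> R \<omega> \<Longrightarrow> C \<le> z ^ ball_count Y n i \<omega>" and C: "0 < C"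
    and p: "\<And>\<omega>. \<omega> \<in> E \<Longrightarrow> (z - 1) * box_size \<rho> i \<omega> \<le> x" and R: "{\<omega>\<in>E. R \<omega>} \<in> sets M"
  shows "measure M {\<omega>\<in>E. R \<omega>} \<le> exp (real n * x) / C * measure M E"
proof -
  have Em[measurable]: "E \<in> sets M" using env_sets[OF E] .
  have pos: "0 \<le> 1 + (z - 1) * box_size \<rho> i \<omega>" "1 + (z - 1) * box_size \<rho> i \<omega> \<le> 2" if "\<omega> \<in> space M" for \<omega>
  proof -
    have eq: "1 + (z - 1) * box_size \<rho> i \<omega> = (1 - box_size \<rho> i \<omega>) + z * box_size \<rho> i \<omega>"
      by (simp add: algebra_simps)
    have b: "0 \<le> box_size \<rho> i \<omega>" "box_size \<rho> i \<omega> \<le> 1"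
      using box_size_le_1[OF that] box_size_nonneg by auto
    have "0 \<le> z * box_size \<rho> i \<omega>" "z * box_size \<rho> i \<omega> \<le> 2 * box_size \<rho> i \<omega>"
      using z b by (auto intro: mult_right_mono)
    thus "0 \<le> 1 + (z - 1) * box_size \<rho> i \<omega>" "1 + (z - 1) * box_size \<rho> i \<omega> \<le> 2"
      unfolding eq using b by linarith+
  qed
  have cnt: "z ^ ball_count Y n i \<omega> \<le> 2 ^ n" for \<omega>
  proof -
    have "ball_count Y n i \<omega> \<le> card {..<n}" unfolding ball_count_def by (rule card_mono) auto
    have "z ^ ball_count Y n i \<omega> \<le> 2 ^ ball_count Y n i \<omega>" using z by (intro power_mono) auto
    also have "\<dots> \<le> 2 ^ n" using \<open>_ \<le> card {..<n}\<close> by (intro power_increasing) auto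
    finally show ?thesis .
  qed
  have "C * measure M {\<omega>\<in>E. R \<omega>} = (\<integral>\<omega>. C * indicator {\<omega>\<in>E. R \<omega>} \<omega> \<partial>M)"
    using R by (simp add: Int_absorb1 sets.sets_into_space)
  also have "\<dots> \<le> (\<integral>\<omega>. indicator E \<omega> * z ^ ball_count Y n i \<omega> \<partial>M)"
  proof (rule integral_mono)
    show "integrable M (\<lambda>\<omega>. C * indicator {\<omega>\<in>E. R \<omega>} \<omega>)"
      using R by (intro integrable_mult_right integrable_real_indicator) (auto simp: emeasure_eq_measure)
    show "integrable M (\<lambda>\<omega>. indicator E \<omega> * z ^ ball_count Y n i \<omega>)"
    proof (rule integrable_bdd[where B="2 ^ n"])
      show "(\<lambda>\<omega>. indicator E \<omega> * z ^ ball_count Y n i \<omega>) \<in> borel_measurable M" by measurable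
      show "\<bar>indicator E \<omega> * z ^ ball_count Y n i \<omega>\<bar> \<le> 2 ^ n" for \<omega>
        using cnt[of \<omega>] z by (cases "\<omega> \<in> E") auto
    qed
    show "C * indicator {\<omega>\<in>E. R \<omega>} \<omega> \<le> indicator E \<omega> * z ^ ball_count Y n i \<omega>" for \<omega>
      using B z by (auto simp: indicator_def)
  qed
  also have "\<dots> = (\<integral>\<omega>. indicator E \<omega> * (1 + (z - 1) * box_size \<rho> i \<omega>) ^ n \<partial>M)"
    by (rule integral_power_ball_count[OF E])
  also have "\<dots> \<le> (\<integral>\<omega>. exp (real n * x) * indicator E \<omega> \<partial>M)"
  proof (rule integral_mono)
    show "integrable M (\<lambda>\<omega>. indicator E \<omega> * (1 + (z - 1) * box_size \<rho> i \<omega>) ^ n)"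
    proof (rule integrable_bdd[where B="2 ^ n"])
      show "(\<lambda>\<omega>. indicator E \<omega> * (1 + (z - 1) * box_size \<rho> i \<omega>) ^ n) \<in> borel_measurable M" by measurable
      show "\<bar>indicator E \<omega> * (1 + (z - 1) * box_size \<rho> i \<omega>) ^ n\<bar> \<le> 2 ^ n" if "\<omega> \<in> space M" for \<omega>
        using pos[OF that] power_mono[of "1 + (z - 1) * box_size \<rho> i \<omega>" 2 n] zero_le_power[of "1 + (z - 1) * box_size \<rho> i \<omega>" n]
        by (cases "\<omega> \<in> E") auto
    qed
    show "integrable M (\<lambda>\<omega>. exp (real n * x) * indicator E \<omega>)"
      by (intro integrable_mult_right integrable_real_indicator) (auto simp: emeasure_eq_measure)
    fix \<omega> assume w: "\<omega> \<in> space M"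
    have "(1 + (z - 1) * box_size \<rho> i \<omega>) ^ n \<le> exp (real n * x)" if "\<omega> \<in> E"
    proof -
      have "1 + (z - 1) * box_size \<rho> i \<omega> \<le> exp x"
        using p[OF that] exp_ge_add_one_self[of x] by linarith
      hence "(1 + (z - 1) * box_size \<rho> i \<omega>) ^ n \<le> exp x ^ n" using pos[OF w] by (intro power_mono)
      thus ?thesis by (simp add: exp_of_nat_mult)
    qed
    thus "indicator E \<omega> * (1 + (z - 1) * box_size \<rho> i \<omega>) ^ n \<le> exp (real n * x) * indicator E \<omega>"
      by (auto simp: indicator_def)
  qed
  also have "\<dots> = exp (real n * x) * measure M E" by (simp add: Int_absorb1 sets.sets_into_space)
  finally show ?thesis using C by (simp add: field_simps)
qed

lemma many_balls_in_small_box: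
  assumes E: "E \<in> sets EnvF" and p: "\<And>\<omega>. \<omega> \<in> E \<Longrightarrow> real n * box_size \<rho> i \<omega> \<le> y / 2" and n: "0 < n" and y: "0 \<le> y"
  shows "measure M {\<omega>\<in>E. y \<le> real (ball_count Y n i \<omega>)} \<le> exp (- y / 8) * measure M E"
proof -
  have Em[measurable]: "E \<in> sets M" using env_sets[OF E] .
  have "measure M {\<omega>\<in>E. y \<le> real (ball_count Y n i \<omega>)} \<le> exp (real n * (y / (2 * n))) / 2 powr y * measure M E"
  proof (rule ball_count_chernoff[OF E, where z=2 and i=i and n=n])
    fix \<omega> assume w: "\<omega> \<in> E"
    show "(2 - 1) * box_size \<rho> i \<omega> \<le> y / (2 * n)" using p[OF w] n by (simp add: field_simps)
    assume "y \<le> real (ball_count Y n i \<omega>)"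
    hence "2 powr y \<le> 2 powr real (ball_count Y n i \<omega>)" by (intro powr_mono) auto
    thus "2 powr y \<le> 2 ^ ball_count Y n i \<omega>" by (simp add: powr_realpow)
  qed (use sets_ball_count[OF Em] in auto)
  also have "exp (real n * (y / (2 * n))) / 2 powr y = exp (y / 2 - y * ln 2)"
    using n by (simp add: powr_def exp_diff)
  \<comment> \<open>\<open>ln 2\<close> is at least \<open>2/3\<close>, which exceeds
    \<open>5/8\<close>, and \<open>1/2 - 5/8 = - 1/8\<close>.\<close>
  also have "\<dots> \<le> exp (- y / 8)"
  proof -
    have "y * (5 / 8) \<le> y * ln 2" using y ln2_ge_two_thirds by (intro mult_left_mono) auto
    thus ?thesis by simp
  qed
  finally show ?thesis by (simp add: mult_right_mono)
qed

lemma few_balls_in_large_box: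
  assumes E: "E \<in> sets EnvF" and p: "\<And>\<omega>. \<omega> \<in> E \<Longrightarrow> 4 * y \<le> real n * box_size \<rho> i \<omega>" and n: "0 < n" and y: "0 \<le> y"
  shows "measure M {\<omega>\<in>E. real (ball_count Y n i \<omega>) < y} \<le> exp (- y) * measure M E"
proof -
  have Em[measurable]: "E \<in> sets M" using env_sets[OF E] .
  have "measure M {\<omega>\<in>E. real (ball_count Y n i \<omega>) < y} \<le> exp (real n * (- 2 * y / n)) / 2 powr (- y) * measure M E"
  proof (rule ball_count_chernoff[OF E, where z="1/2" and i=i and n=n])
    fix \<omega> assume w: "\<omega> \<in> E"
    show "(1 / 2 - 1) * box_size \<rho> i \<omega> \<le> - 2 * y / n" using p[OF w] n by (simp add: field_simps)
    assume "real (ball_count Y n i \<omega>) < y"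
    hence "2 powr (- y) \<le> 2 powr (- real (ball_count Y n i \<omega>))" by (intro powr_mono) auto
    thus "2 powr (- y) \<le> (1 / 2) ^ ball_count Y n i \<omega>" by (simp add: powr_minus powr_realpow power_one_over inverse_eq_divide)
  qed (use sets_ball_count[OF Em] in auto)
  also have "exp (real n * (- 2 * y / n)) / 2 powr (- y) = exp (- 2 * y + y * ln 2)"
    using n by (simp add: powr_def exp_diff[symmetric])
  also have "\<dots> \<le> exp (- y)"
  proof -
    have "y * ln 2 \<le> y * 1" using y ln_2_less_1 by (intro mult_left_mono) auto
    thus ?thesis by simp
  qed
  finally show ?thesis by (simp add: mult_right_mono)
qed

end

section \<open>Almost sure control of boxes and counts by Borel-Cantelli\<close>

lemma (in prob_space) AE_eventually_not:
  assumes A: "\<And>n. A n \<in> sets M" and le: "\<And>n. n \<ge> N \<Longrightarrow> measure M (A n) \<le> f n" and f: "summable f"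
  shows "AE \<omega> in M. \<forall>\<^sub>F n in sequentially. \<omega> \<notin> A n"
proof -
  have "summable (\<lambda>n. measure M (A n))"
    by (rule summable_comparison_test'[OF f, of N]) (use le in auto)
  from borel_cantelli_AE1[OF A _ this]
  have "AE \<omega> in M. \<forall>\<^sub>F n in sequentially. \<omega> \<in> space M - A n" by (simp add: emeasure_eq_measure less_top[symmetric])
  thus ?thesis by eventually_elim (auto elim: eventually_mono)
qed

context nested_occupancy
begin

lemma atoms_law_nu: "atoms_law \<nu>"
  using law by (auto simp: atoms_law_def atoms_law_axioms_def space_prob_algebra)

sublocale law: atoms_law \<nu>
  by (rule atoms_law_nu)

lemma box_size_family: "box_size (\<lambda>i e. e i) i (\<lambda>i. \<rho> i \<omega>) = box_size \<rho> i \<omega>"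
  by (simp add: box_size_def)

text \<open>Links the model to the canonical environment, so that estimates for \<open>reach\<close>
  become estimates for the boxes.\<close>

lemma distr_env: "distr M law.Env (\<lambda>\<omega> i. \<rho> i \<omega>) = law.Env"
proof -
  have "distr M (\<Pi>\<^sub>M i\<in>UNIV. mass_space) (\<lambda>\<omega>. \<lambda>i\<in>UNIV. \<rho> i \<omega>) = (\<Pi>\<^sub>M i\<in>UNIV. distr M mass_space (\<rho> i))"
    using env_indep by (subst (asm) indep_vars_iff_distr_eq_PiM') auto
  hence "distr M (\<Pi>\<^sub>M i\<in>UNIV. mass_space) (\<lambda>\<omega> i. \<rho> i \<omega>) = law.Env"
    by (simp add: env_distr law.Env_def restrict_def)
  moreover have "sets (\<Pi>\<^sub>M i\<in>(UNIV::nat list set). mass_space) = sets law.Env"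
    unfolding law.Env_def by (intro sets_PiM_cong) (auto simp: law.sets_nu)
  then have "distr M (\<Pi>\<^sub>M i\<in>UNIV. mass_space) (\<lambda>\<omega> i. \<rho> i \<omega>) = distr M law.Env (\<lambda>\<omega> i. \<rho> i \<omega>)"
    by (intro distr_cong) simp_all
  ultimately show ?thesis by simp
qed

lemma meas_Env: "(\<lambda>\<omega> i. \<rho> i \<omega>) \<in> measurable M law.Env"
proof -
  have "sets (\<Pi>\<^sub>M i\<in>(UNIV::nat list set). mass_space) = sets law.Env"
    unfolding law.Env_def by (intro sets_PiM_cong) (auto simp: law.sets_nu)
  thus ?thesis using meas_env by (simp cong: measurable_cong_sets)
qed

lemma sets_fragmented: "{\<omega>\<in>space M. fragmented r z (\<lambda>i. \<rho> i \<omega>)} \<in> sets M"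
  using measurable_compose[OF meas_Env law.meas_fragmented[of r z]] by (simp add: pred_def)

lemma measure_fragmented: "\<P>(\<omega> in M. fragmented r z (\<lambda>i. \<rho> i \<omega>)) = law.reach r z"
proof -
  have "law.reach r z = measure (distr M law.Env (\<lambda>\<omega> i. \<rho> i \<omega>)) {e\<in>space law.Env. fragmented r z e}"
    by (simp add: law.reach_def distr_env)
  also have "\<dots> = \<P>(\<omega> in M. fragmented r z (\<lambda>i. \<rho> i \<omega>))"
    using measurable_space[OF meas_Env]
    by (subst measure_distr[OF meas_Env]) (auto intro!: arg_cong[where f="measure M"])
  finally show ?thesis ..
qed

lemma AE_eventually_small_box:
  assumes "summable (\<lambda>k. 1 - law.reach k (z k))"
  shows "AE \<omega> in M. \<forall>\<^sub>F k in sequentially. \<exists>i. length i = k \<and> 0 < box_size \<rho> i \<omega> \<and> z k \<le> - ln (box_size \<rho> i \<omega>)"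
proof -
  let ?A = "\<lambda>k. space M - {\<omega>\<in>space M. fragmented k (z k) (\<lambda>i. \<rho> i \<omega>)}"
  have "AE \<omega> in M. \<forall>\<^sub>F k in sequentially. \<omega> \<notin> ?A k"
    by (rule AE_eventually_not[OF _ _ assms, where N=0])
       (use sets_fragmented in \<open>auto simp: prob_compl measure_fragmented\<close>)
  thus ?thesis using AE_space
    by eventually_elim (auto simp: fragmented_def box_size_family elim: eventually_mono)
qed

lemma AE_eventually_no_small_box:
  assumes "summable (\<lambda>k. law.reach k (z k))"
  shows "AE \<omega> in M. \<forall>\<^sub>F k in sequentially. \<forall>i. length i = k \<longrightarrow> 0 < box_size \<rho> i \<omega> \<longrightarrow> - ln (box_size \<rho> i \<omega>) < z k"
proof -
  let ?A = "\<lambda>k. {\<omega>\<in>space M. fragmented k (z k) (\<lambda>i. \<rho> i \<omega>)}"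
  have "AE \<omega> in M. \<forall>\<^sub>F k in sequentially. \<omega> \<notin> ?A k"
    by (rule AE_eventually_not[OF _ _ assms, where N=0])
       (use sets_fragmented in \<open>auto simp: measure_fragmented\<close>)
  thus ?thesis using AE_space
    by eventually_elim (auto simp: fragmented_def box_size_family not_le elim!: eventually_mono)
qed

lemma sets_box_size: "{\<omega>\<in>space M. P (box_size \<rho> i \<omega>)} \<in> sets EnvF" if "Measurable.pred borel P"
  using measurable_compose[OF meas_box_size_env that, of i] space_env by (simp add: pred_def)

text \<open>The expected number of boxes of size at least \<open>q\<close> is at most \<open>1 / q\<close>, because the
  expected sizes of the boxes of a generation are the probabilities that ball \<open>0\<close> hits them.\<close>

lemma measure_large_box_few_balls:
  assumes n: "0 < n" and y: "0 < y"
  shows "\<P>(\<omega> in M. \<exists>i. length i = k \<and> 4 * y / n \<le> box_size \<rho> i \<omega> \<and> real (ball_count Y n i \<omega>) < y)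
     \<le> exp (- y) * n / (4 * y)"
proof -
  define q where "q = 4 * y / n"
  have q: "0 < q" using n y by (simp add: q_def)
  define E where "E j = {\<omega>\<in>space M. length (list_decode j) = k \<and> q \<le> box_size \<rho> (list_decode j) \<omega>}" for j
  \<comment> \<open>The event that ball 0 sits in the \<open>j\<close>-th word, if that word has
    length \<open>k\<close>. These events are disjoint, whereas the \<open>E j\<close> may
    overlap.\<close>
  define H where "H j = (if length (list_decode j) = k then in_box 0 (list_decode j) else {})" for j
  have E: "E j \<in> sets EnvF" for j unfolding E_def by (rule sets_box_size) simp
  have H: "H j \<in> sets M" for j by (simp add: H_def)
  have disj: "disjoint_family H"
    by (auto simp: disjoint_family_on_def H_def in_box_def split: if_splits dest: injD[OF inj_list_decode])
  have mE: "measure M (E j) \<le> 1 / q * measure M (H j)" for j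
  proof (cases "length (list_decode j) = k")
    case True
    have "measure M (E j) = (\<integral>\<omega>. indicator (E j) \<omega> \<partial>M)"
      using env_sets[OF E[of j]] by (simp add: Int_absorb1 sets.sets_into_space)
    also have "\<dots> \<le> (\<integral>\<omega>. 1 / q * (indicator (space M) \<omega> * box_size \<rho> (list_decode j) \<omega> ^ card {0::nat}) \<partial>M)"
    proof (rule integral_mono)
      show "integrable M (indicator (E j) :: _ \<Rightarrow> real)"
        using env_sets[OF E[of j]] by (intro integrable_real_indicator) (auto simp: emeasure_eq_measure)
      show "integrable M (\<lambda>\<omega>. 1 / q * (indicator (space M) \<omega> * box_size \<rho> (list_decode j) \<omega> ^ card {0::nat}))"
        by (intro integrable_mult_right integrable_bdd[where B=1]) (auto simp: box_size_le_1 box_size_nonneg abs_of_nonneg)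
      show "indicator (E j) \<omega> \<le> 1 / q * (indicator (space M) \<omega> * box_size \<rho> (list_decode j) \<omega> ^ card {0::nat})" if "\<omega> \<in> space M" for \<omega>
        using that q box_size_nonneg[of \<rho> "list_decode j" \<omega>] by (auto simp: indicator_def E_def)
    qed
    also have "\<dots> = 1 / q * (\<integral>\<omega>. indicator (space M) \<omega> * (\<Prod>b\<in>{0::nat}. indicator (in_box b (list_decode j)) \<omega>) \<partial>M)"
      using integral_in_boxes[of "{0::nat}" "space M" "list_decode j"] sets.top[of EnvF] by (simp add: space_env)
    also have "(\<integral>\<omega>. indicator (space M) \<omega> * (\<Prod>b\<in>{0::nat}. indicator (in_box b (list_decode j)) \<omega>) \<partial>M) = (\<integral>\<omega>. indicator (H j) \<omega> \<partial>M)"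
      using True by (intro Bochner_Integration.integral_cong) (auto simp: H_def)
    also have "\<dots> = measure M (H j)" using H[of j] by (simp add: Int_absorb1 sets.sets_into_space)
    finally show ?thesis .
  qed (simp add: E_def H_def)
  have sumH: "summable (\<lambda>j. measure M (H j))" "(\<Sum>j. measure M (H j)) \<le> 1"
  proof -
    have "(\<lambda>j. measure M (H j)) sums measure M (\<Union>j. H j)"
      using H disj by (intro finite_measure_UNION) auto
    thus "summable (\<lambda>j. measure M (H j))" "(\<Sum>j. measure M (H j)) \<le> 1" by (auto simp: sums_iff)
  qed
  let ?B = "\<lambda>j. {\<omega>\<in>E j. real (ball_count Y n (list_decode j) \<omega>) < y}"
  have B: "?B j \<in> sets M" for j by (rule sets_ball_count[OF env_sets[OF E]])
  have mB: "measure M (?B j) \<le> exp (- y) / q * measure M (H j)" for j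
  proof -
    have "measure M (?B j) \<le> exp (- y) * measure M (E j)"
      by (rule few_balls_in_large_box[OF E]) (use n y in \<open>auto simp: E_def q_def field_simps\<close>)
    also have "\<dots> \<le> exp (- y) * (1 / q * measure M (H j))" by (intro mult_left_mono mE) auto
    finally show ?thesis by simp
  qed
  have sumB: "summable (\<lambda>j. measure M (?B j))"
    by (rule summable_comparison_test'[OF summable_mult[OF sumH(1), of "exp (- y) / q"], where N=0]) (use mB in auto)
  have "{\<omega>\<in>space M. \<exists>i. length i = k \<and> 4 * y / n \<le> box_size \<rho> i \<omega> \<and> real (ball_count Y n i \<omega>) < y} = (\<Union>j. ?B j)"
  proof (intro set_eqI iffI)
    fix \<omega> assume "\<omega> \<in> {\<omega>\<in>space M. \<exists>i. length i = k \<and> 4 * y / n \<le> box_size \<rho> i \<omega> \<and> real (ball_count Y n i \<omega>) < y}"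
    then obtain i where i: "\<omega> \<in> space M" "length i = k" "q \<le> box_size \<rho> i \<omega>" "real (ball_count Y n i \<omega>) < y"
      by (auto simp: q_def)
    thus "\<omega> \<in> (\<Union>j. ?B j)" by (auto simp: E_def intro!: exI[of _ "list_encode i"])
  qed (auto simp: E_def q_def)
  also have "measure M (\<Union>j. ?B j) \<le> (\<Sum>j. measure M (?B j))"
    using B sumB by (intro finite_measure_subadditive_countably) auto
  also have "\<dots> \<le> (\<Sum>j. exp (- y) / q * measure M (H j))"
    by (intro suminf_le mB sumB summable_mult sumH)
  also have "\<dots> \<le> exp (- y) / q * 1"
    using sumH q by (subst suminf_mult) (auto intro!: divide_right_mono mult_left_mono)
  also have "\<dots> = exp (- y) * n / (4 * y)" by (simp add: q_def)
  finally show ?thesis .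
qed

text \<open>One small box suffices, so \<open>disjointed\<close> assigns to each environment the
  first one in the enumeration of words. The choice depends on the environment alone and the events
  are disjoint, so no union bound over boxes is paid.\<close>

lemma measure_small_box_many_balls:
  assumes n: "0 < n" and y: "0 < y"
  shows "\<P>(\<omega> in M. (\<exists>i. length i = k \<and> 0 < box_size \<rho> i \<omega> \<and> box_size \<rho> i \<omega> \<le> y / (2 * n)) \<and>
      (\<forall>i. length i = k \<longrightarrow> 0 < box_size \<rho> i \<omega> \<longrightarrow> y \<le> real (ball_count Y n i \<omega>))) \<le> exp (- y / 8)"
proof -
  define A where "A j = {\<omega>\<in>space M. length (list_decode j) = k \<and> 0 < box_size \<rho> (list_decode j) \<omega> \<and> box_size \<rho> (list_decode j) \<omega> \<le> y / (2 * n)}" for j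
  define E where "E = disjointed A"
  have A: "A j \<in> sets EnvF" for j unfolding A_def by (rule sets_box_size) simp
  have E: "E j \<in> sets EnvF" for j
    using sets.range_disjointed_sets[of A EnvF] A by (auto simp: E_def)
  have EA: "E j \<subseteq> A j" for j unfolding E_def by (rule disjointed_subset)
  have Em: "E j \<in> sets M" for j using env_sets[OF E] .
  let ?B = "\<lambda>j. {\<omega>\<in>E j. y \<le> real (ball_count Y n (list_decode j) \<omega>)}"
  have B: "?B j \<in> sets M" for j by (rule sets_ball_count[OF Em])
  have mB: "measure M (?B j) \<le> exp (- y / 8) * measure M (E j)" for j
  proof (rule many_balls_in_small_box[OF E _ n])
    fix \<omega> assume "\<omega> \<in> E j"
    hence "box_size \<rho> (list_decode j) \<omega> \<le> y / (2 * n)" using EA by (auto simp: A_def)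
    thus "real n * box_size \<rho> (list_decode j) \<omega> \<le> y / 2" using n by (simp add: field_simps)
  qed (use y in simp)
  have sumE: "summable (\<lambda>j. measure M (E j))" "(\<Sum>j. measure M (E j)) \<le> 1"
  proof -
    have "(\<lambda>j. measure M (E j)) sums measure M (\<Union>j. E j)"
      using Em disjoint_family_disjointed[of A] by (intro finite_measure_UNION) (auto simp: E_def)
    thus "summable (\<lambda>j. measure M (E j))" "(\<Sum>j. measure M (E j)) \<le> 1" by (auto simp: sums_iff)
  qed
  have sumB: "summable (\<lambda>j. measure M (?B j))"
    by (rule summable_comparison_test'[OF summable_mult[OF sumE(1), of "exp (- y / 8)"], where N=0]) (use mB in auto)
  have "{\<omega>\<in>space M. (\<exists>i. length i = k \<and> 0 < box_size \<rho> i \<omega> \<and> box_size \<rho> i \<omega> \<le> y / (2 * n)) \<and>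
      (\<forall>i. length i = k \<longrightarrow> 0 < box_size \<rho> i \<omega> \<longrightarrow> y \<le> real (ball_count Y n i \<omega>))} \<subseteq> (\<Union>j. ?B j)"
  proof safe
    fix \<omega> i assume w: "\<omega> \<in> space M" "k = length i" "0 < box_size \<rho> i \<omega>" "box_size \<rho> i \<omega> \<le> y / (2 * n)"
      and all: "\<forall>i'. length i' = length i \<longrightarrow> 0 < box_size \<rho> i' \<omega> \<longrightarrow> y \<le> real (ball_count Y n i' \<omega>)"
    have "\<omega> \<in> A (list_encode i)" using w by (simp add: A_def)
    hence "\<omega> \<in> (\<Union>j. E j)" unfolding E_def UN_disjointed_eq by blast
    then obtain j where j: "\<omega> \<in> E j" by blast
    hence "\<omega> \<in> A j" using EA by blast
    hence "y \<le> real (ball_count Y n (list_decode j) \<omega>)" using all w(2) by (auto simp: A_def)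
    thus "\<omega> \<in> (\<Union>j. ?B j)" using j by blast
  qed
  hence "\<P>(\<omega> in M. (\<exists>i. length i = k \<and> 0 < box_size \<rho> i \<omega> \<and> box_size \<rho> i \<omega> \<le> y / (2 * n)) \<and>
      (\<forall>i. length i = k \<longrightarrow> 0 < box_size \<rho> i \<omega> \<longrightarrow> y \<le> real (ball_count Y n i \<omega>))) \<le> measure M (\<Union>j. ?B j)"
    using B by (intro finite_measure_mono) auto
  also have "\<dots> \<le> (\<Sum>j. measure M (?B j))"
    using B sumB by (intro finite_measure_subadditive_countably) auto
  also have "\<dots> \<le> (\<Sum>j. exp (- y / 8) * measure M (E j))"
    by (intro suminf_le mB sumB summable_mult sumE)
  also have "\<dots> \<le> exp (- y / 8) * 1"
    using sumE by (subst suminf_mult) (auto intro!: mult_left_mono)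
  finally show ?thesis by simp
qed

lemma ball_count_take: "ball_count Y n i \<omega> \<le> ball_count Y n (take l i) \<omega>"
  unfolding ball_count_def
proof (rule card_mono)
  show "{b. b < n \<and> ball_box Y b (length i) \<omega> = i} \<subseteq> {b. b < n \<and> ball_box Y b (length (take l i)) \<omega> = take l i}"
  proof safe
    fix b assume "ball_box Y b (length i) \<omega> = i"
    hence "take l i = take l (map (Y b \<omega>) [0..<length i])" by (simp add: ball_box_def)
    also have "\<dots> = map (Y b \<omega>) [0..<length (take l i)]" by (cases "l \<le> length i") (simp_all add: take_map)
    finally show "ball_box Y b (length (take l i)) \<omega> = take l i" by (simp add: ball_box_def)
  qed
qed simp

lemma ex_descendant:
  assumes w: "\<omega> \<in> space M" and i: "0 < box_size \<rho> i \<omega>" and k: "length i \<le> k"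
  shows "\<exists>i'. length i' = k \<and> take (length i) i' = i \<and> 0 < box_size \<rho> i' \<omega>"
  using k
proof (induction k rule: dec_induct)
  case base
  then show ?case using i by auto
next
  case (step m)
  then obtain i' where i': "length i' = m" "take (length i) i' = i" "0 < box_size \<rho> i' \<omega>" by auto
  have "\<rho> i' \<omega> \<in> space \<nu>"
    using measurable_space[OF meas_rho w, of i'] sets_eq_imp_space_eq[OF law.sets_nu] by simp
  from law.ex_atom[OF this] obtain j where "0 < measure (\<rho> i' \<omega>) {j}" by auto
  with i' step.hyps show ?case by (intro exI[of _ "i' @ [j]"]) (auto simp: box_size_snoc)
qed

text \<open>A box holds at least the balls of each of its descendants, and a box of positive size
  has a descendant of positive size in every later generation. Hence generation \<open>k\<close>
  alone controls all earlier ones.\<close>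

lemma saturation_gt:
  assumes w: "\<omega> \<in> space M" and all: "\<And>i. length i = k \<Longrightarrow> 0 < box_size \<rho> i \<omega> \<Longrightarrow> y \<le> real (ball_count Y n i \<omega>)"
  shows "enat k < saturation_level \<rho> Y n y \<omega>"
proof -
  have "enat (Suc k) \<le> saturation_level \<rho> Y n y \<omega>"
    unfolding saturation_level_def
  proof (rule Inf_greatest, safe)
    fix i assume i: "0 < box_size \<rho> i \<omega>" "real (ball_count Y n i \<omega>) < y"
    show "enat (Suc k) \<le> enat (length i)"
    proof (rule ccontr)
      assume "\<not> ?thesis"
      hence "length i \<le> k" by simp
      from ex_descendant[OF w i(1) this] obtain i' where i': "length i' = k" "take (length i) i' = i" "0 < box_size \<rho> i' \<omega>" by auto
      have "y \<le> real (ball_count Y n i' \<omega>)" using all i' by blast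
      also have "\<dots> \<le> real (ball_count Y n i \<omega>)" using ball_count_take[of n i' \<omega> "length i"] i'(2) by simp
      finally show False using i(2) by simp
    qed
  qed
  thus ?thesis by (metis Suc_ile_eq)
qed

text \<open>A box this large expects at least four times the threshold of balls. The factor
  \<open>exp (- n powr \<alpha>)\<close> beats the polynomial number of such boxes and is
  summable.\<close>

lemma AE_saturation_gt:
  fixes k :: "nat \<Rightarrow> nat"
  assumes \<alpha>: "0 < \<alpha>"
    and "AE \<omega> in M. \<forall>\<^sub>F n in sequentially. \<forall>i. length i = k n \<longrightarrow> 0 < box_size \<rho> i \<omega> \<longrightarrow> 4 * real n powr \<alpha> / real n \<le> box_size \<rho> i \<omega>"
  shows "AE \<omega> in M. \<forall>\<^sub>F n in sequentially. enat (k n) < saturation_level \<rho> Y n (real n powr \<alpha>) \<omega>"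
proof -
  let ?A = "\<lambda>n. {\<omega>\<in>space M. \<exists>i. length i = k n \<and> 4 * real n powr \<alpha> / real n \<le> box_size \<rho> i \<omega> \<and> real (ball_count Y n i \<omega>) < real n powr \<alpha>}"
  have "AE \<omega> in M. \<forall>\<^sub>F n in sequentially. \<omega> \<notin> ?A n"
  proof (rule AE_eventually_not[where N=1])
    show "?A n \<in> sets M" for n
    proof -
      have "?A n = (\<Union>i. {\<omega>\<in>space M. length i = k n \<and> 4 * real n powr \<alpha> / real n \<le> box_size \<rho> i \<omega>} \<inter> {\<omega>\<in>space M. real (ball_count Y n i \<omega>) < real n powr \<alpha>})"
        by auto
      also have "\<dots> \<in> sets M"
        by (intro sets.countable_UN'' countableI_type sets.Int sets_ball_count[OF sets.top] env_sets sets_box_size) simp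
      finally show ?thesis .
    qed
    show "measure M (?A n) \<le> exp (- (real n powr \<alpha>)) * n / (4 * real n powr \<alpha>)" if "1 \<le> n" for n
      by (rule measure_large_box_few_balls) (use that in auto)
    show "summable (\<lambda>n. exp (- (real n powr \<alpha>)) * n / (4 * real n powr \<alpha>))"
    proof (rule summable_comparison_test_bigo)
      show "summable (\<lambda>n. norm (real n powr (- 2)))" by (simp add: summable_real_powr_iff)
      show "(\<lambda>n. exp (- (real n powr \<alpha>)) * n / (4 * real n powr \<alpha>)) \<in> O(\<lambda>n. real n powr (- 2))"
        using \<alpha> by real_asymp
    qed
  qed
  with assms(2) show ?thesis using AE_space
  proof eventually_elim
    case (elim \<omega>)
    from elim(1,2) show ?case
      by eventually_elim (rule saturation_gt[OF elim(3)], use elim(3) in force)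
  qed
qed

text \<open>A box this small expects at most half of the threshold, and that it still holds that
  many balls has summable probability.\<close>

lemma AE_saturation_le:
  fixes k :: "nat \<Rightarrow> nat"
  assumes \<alpha>: "0 < \<alpha>"
    and "AE \<omega> in M. \<forall>\<^sub>F n in sequentially. \<exists>i. length i = k n \<and> 0 < box_size \<rho> i \<omega> \<and> box_size \<rho> i \<omega> \<le> real n powr \<alpha> / (2 * real n)"
  shows "AE \<omega> in M. \<forall>\<^sub>F n in sequentially. saturation_level \<rho> Y n (real n powr \<alpha>) \<omega> \<le> enat (k n)"
proof -
  let ?A = "\<lambda>n. {\<omega>\<in>space M. (\<exists>i. length i = k n \<and> 0 < box_size \<rho> i \<omega> \<and> box_size \<rho> i \<omega> \<le> real n powr \<alpha> / (2 * real n)) \<and>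
      (\<forall>i. length i = k n \<longrightarrow> 0 < box_size \<rho> i \<omega> \<longrightarrow> real n powr \<alpha> \<le> real (ball_count Y n i \<omega>))}"
  have "AE \<omega> in M. \<forall>\<^sub>F n in sequentially. \<omega> \<notin> ?A n"
  proof (rule AE_eventually_not[where N=1])
    show "?A n \<in> sets M" for n
    proof -
      have "?A n = (\<Union>i. {\<omega>\<in>space M. length i = k n \<and> 0 < box_size \<rho> i \<omega> \<and> box_size \<rho> i \<omega> \<le> real n powr \<alpha> / (2 * real n)}) -
         (\<Union>i. {\<omega>\<in>space M. length i = k n \<and> 0 < box_size \<rho> i \<omega>} \<inter> {\<omega>\<in>space M. \<not> real n powr \<alpha> \<le> real (ball_count Y n i \<omega>)})"
        by auto
      also have "\<dots> \<in> sets M"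
        by (intro sets.Diff sets.countable_UN'' countableI_type sets.Int sets_ball_count[OF sets.top] env_sets sets_box_size) simp_all
      finally show ?thesis .
    qed
    show "measure M (?A n) \<le> exp (- (real n powr \<alpha>) / 8)" if "1 \<le> n" for n
      by (rule measure_small_box_many_balls) (use that in auto)
    show "summable (\<lambda>n. exp (- (real n powr \<alpha>) / 8))"
    proof (rule summable_comparison_test_bigo)
      show "summable (\<lambda>n. norm (real n powr (- 2)))" by (simp add: summable_real_powr_iff)
      show "(\<lambda>n. exp (- (real n powr \<alpha>) / 8)) \<in> O(\<lambda>n. real n powr (- 2))"
        using \<alpha> by real_asymp
    qed
  qed
  with assms(2) show ?thesis using AE_space
  proof eventually_elim
    case (elim \<omega>)
    from elim(1,2) show ?case
    proof eventually_elim
      case (elim n)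
      then obtain i where "length i = k n" "0 < box_size \<rho> i \<omega>" "real (ball_count Y n i \<omega>) < real n powr \<alpha>"
        using \<open>\<omega> \<in> space M\<close> by force
      thus ?case unfolding saturation_level_def by (intro Inf_lower) auto
    qed
  qed
qed

end

section \<open>The saturation level\<close>

context atoms_law
begin

lemma laplace_antimono:
  assumes "\<theta>' \<le> \<theta>"
  shows "laplace \<nu> \<theta> \<le> laplace \<nu> \<theta>'"
  unfolding laplace_def
proof (rule nn_integral_mono, rule suminf_le)
  fix p j assume p: "p \<in> space \<nu>"
  show "ennreal (measure p {j} powr \<theta>) \<le> ennreal (measure p {j} powr \<theta>')"
    using assms mass_le_1[OF p, of j] by (intro ennreal_leI powr_mono') auto
qed auto

lemma laplace_ge_1:
  assumes "\<theta> \<le> 0"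
  shows "1 \<le> laplace \<nu> \<theta>"
proof -
  have "1 = (\<integral>\<^sup>+p. 1 \<partial>\<nu>)" by (simp add: nu.emeasure_space_1)
  also have "\<dots> \<le> laplace \<nu> \<theta>"
    unfolding laplace_def
  proof (rule nn_integral_mono)
    fix p assume p: "p \<in> space \<nu>"
    obtain j where j: "0 < measure p {j}" using ex_atom[OF p] by auto
    have "measure p {j} powr 0 \<le> measure p {j} powr \<theta>"
      using assms mass_le_1[OF p, of j] by (intro powr_mono') auto
    hence "1 \<le> ennreal (measure p {j} powr \<theta>)" using j by simp
    also have "\<dots> = (\<Sum>i\<in>{j}. ennreal (measure p {i} powr \<theta>))" by simp
    also have "\<dots> \<le> (\<Sum>i. ennreal (measure p {i} powr \<theta>))" by (rule sum_le_suminf) auto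
    finally show "1 \<le> (\<Sum>i. ennreal (measure p {i} powr \<theta>))" .
  qed
  finally show ?thesis .
qed

end

locale critical_occupancy = nested_occupancy M \<nu> \<rho> Y + crit: critical \<nu> \<theta> \<kappa> e
  for M :: "'a measure" and \<nu> \<rho> Y \<theta> \<kappa> e +
  fixes \<alpha> :: real
  assumes \<alpha>: "0 < \<alpha>" "\<alpha> < 1"
begin

text \<open>In \<open>reach_le\<close> the factor \<open>exp (\<theta> * speed)\<close> cancels
  \<open>\<kappa>\<close>, and the logarithmic term leaves \<open>k powr (- 2)\<close>, which is
  summable. The correction \<open>- 2 / \<theta> * ln k\<close> is nonnegative because
  \<open>\<theta> < 0\<close>.\<close>

lemma AE_box_size_gt:
  "AE \<omega> in M. \<forall>\<^sub>F k in sequentially. \<forall>i. length i = k \<longrightarrow> 0 < box_size \<rho> i \<omega> \<longrightarrow>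
     - ln (box_size \<rho> i \<omega>) < crit.speed * real k - 2 / \<theta> * ln (real k)"
proof (rule AE_eventually_no_small_box)
  have le: "norm (law.reach k (crit.speed * real k - 2 / \<theta> * ln (real k))) \<le> real k powr (- 2)" if k: "1 \<le> k" for k
  proof -
    have "law.reach k (crit.speed * real k - 2 / \<theta> * ln (real k)) \<le>
      exp (\<theta> * (crit.speed * real k - 2 / \<theta> * ln (real k))) * \<kappa> ^ k"
      by (rule law.reach_le) (use crit.laplace_theta crit.theta_neg crit.kappa_pos in auto)
    also have "\<theta> * (crit.speed * real k - 2 / \<theta> * ln (real k)) = real k * (\<theta> * crit.speed) + - 2 * ln (real k)"
      using crit.theta_neg by (simp add: algebra_simps)
    also have "exp \<dots> = exp (\<theta> * crit.speed) ^ k * real k powr (- 2)"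
    proof -
      have "real k powr (- 2) = exp (- 2 * ln (real k))" using k by (simp add: powr_def)
      thus ?thesis by (simp only: exp_add exp_of_nat_mult)
    qed
    also have "\<dots> * \<kappa> ^ k = real k powr (- 2)"
      unfolding crit.exp_speed using crit.kappa_pos by (simp add: power_divide)
    finally show ?thesis by (simp add: law.reach_bounds)
  qed
  show "summable (\<lambda>k. law.reach k (crit.speed * real k - 2 / \<theta> * ln (real k)))"
    by (rule summable_comparison_test'[where N=1 and g="\<lambda>k. real k powr (- 2)"])
       (use le in \<open>auto simp: summable_real_powr_iff\<close>)
qed

abbreviation level :: "nat \<Rightarrow> 'a \<Rightarrow> enat" where
  "level n \<omega> \<equiv> saturation_level \<rho> Y n (real n powr \<alpha>) \<omega>"

definition slope :: real where
  "slope = (1 - \<alpha>) / crit.speed"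

lemma slope_pos: "0 < slope"
  using \<alpha> crit.speed_pos by (simp add: slope_def)

lemma level_lower_bound:
  obtains K where "0 \<le> K" "AE \<omega> in M. \<forall>\<^sub>F n in sequentially.
    ereal (slope * ln (real n) - K * ln (ln (real n))) \<le> ereal_of_enat (level n \<omega>)"
proof -
  define c where "c = - 2 / \<theta>"
  \<comment> \<open>\<open>c\<close> pays for the logarithmic correction of the box sizes, and the
    additional 1 absorbs \<open>ln 4\<close> and \<open>c * ln slope\<close>.\<close>
  define K where "K = (c + 1) / crit.speed"
  define x where "x n = slope * ln (real n) - K * ln (ln (real n))" for n :: nat
  define k where "k n = nat \<lfloor>x n\<rfloor>" for n
  have c: "0 < c" using crit.theta_neg by (simp add: c_def divide_neg_neg)
  have K: "0 < K" using c crit.speed_pos by (simp add: K_def)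
  have D: "0 < slope" by (rule slope_pos)
  have x: "filterlim x at_top sequentially" unfolding x_def using D by real_asymp
  have kx: "filterlim k sequentially sequentially"
    unfolding k_def
    by (rule filterlim_compose[OF filterlim_nat_sequentially filterlim_compose[OF filterlim_floor_sequentially x]])
  have ev1: "\<forall>\<^sub>F n in sequentially. 1 \<le> x n" using x by (simp add: filterlim_at_top)
  have ev2: "\<forall>\<^sub>F n in sequentially. c * ln (slope * ln (real n)) + ln 4 \<le> (c + 1) * ln (ln (real n))"
    using c D by real_asymp
  have "AE \<omega> in M. \<forall>\<^sub>F n in sequentially. enat (k n) < level n \<omega>"
  proof (rule AE_saturation_gt[OF \<alpha>(1)])
    show "AE \<omega> in M. \<forall>\<^sub>F n in sequentially. \<forall>i. length i = k n \<longrightarrow> 0 < box_size \<rho> i \<omega> \<longrightarrow> 4 * real n powr \<alpha> / real n \<le> box_size \<rho> i \<omega>"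
      using AE_box_size_gt
    proof eventually_elim
      case (elim \<omega>)
      from eventually_compose_filterlim[OF elim kx] ev1 ev2 eventually_ge_at_top[of 3]
      show ?case
      proof eventually_elim
        case (elim n)
        have n: "0 < real n" using elim(4) by simp
        have "exp 1 \<le> real n" using elim(4) exp_le by linarith
        hence lnn: "1 \<le> ln (real n)" using elim(4) by (subst ln_ge_iff) auto
        have kn: "real (k n) \<le> x n" "1 \<le> real (k n)"
          using elim(2) by (simp_all add: k_def)
        have xn: "x n \<le> slope * ln (real n)" using K lnn by (simp add: x_def)
        have "crit.speed * real (k n) \<le> crit.speed * x n"
          using kn crit.speed_pos by (intro mult_left_mono) auto
        also have "crit.speed * x n = (1 - \<alpha>) * ln (real n) - (c + 1) * ln (ln (real n))"
          using crit.speed_pos by (simp add: x_def K_def slope_def field_simps)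
        finally have 1: "crit.speed * real (k n) \<le> (1 - \<alpha>) * ln (real n) - (c + 1) * ln (ln (real n))" .
        have "ln (real (k n)) \<le> ln (slope * ln (real n))" using kn xn by (subst ln_le_cancel_iff) auto
        hence 2: "c * ln (real (k n)) \<le> c * ln (slope * ln (real n))" using c by (intro mult_left_mono) auto
        show ?case
        proof (intro allI impI)
          fix i assume i: "length i = k n" "0 < box_size \<rho> i \<omega>"
          have "- ln (box_size \<rho> i \<omega>) < crit.speed * real (k n) + c * ln (real (k n))"
            using elim(1) i by (simp add: c_def)
          hence "ln 4 - (1 - \<alpha>) * ln (real n) \<le> ln (box_size \<rho> i \<omega>)"
            using 1 2 elim(3) by linarith
          hence "exp (ln 4 - (1 - \<alpha>) * ln (real n)) \<le> exp (ln (box_size \<rho> i \<omega>))" by simp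
          also have "exp (ln 4 - (1 - \<alpha>) * ln (real n)) = 4 * real n powr \<alpha> / real n"
            using n by (simp add: powr_def exp_diff algebra_simps exp_add)
          finally show "4 * real n powr \<alpha> / real n \<le> box_size \<rho> i \<omega>" using i by simp
        qed
      qed
    qed
  qed
  hence "AE \<omega> in M. \<forall>\<^sub>F n in sequentially. ereal (x n) \<le> ereal_of_enat (level n \<omega>)"
  proof eventually_elim
    case (elim \<omega>)
    from elim ev1 show ?case
    proof eventually_elim
      case (elim n)
      have "x n \<le> real (Suc (k n))" using elim(2) unfolding k_def by linarith
      hence "ereal (x n) \<le> ereal_of_enat (enat (Suc (k n)))" by simp
      also have "enat (Suc (k n)) \<le> level n \<omega>" using elim(1) by (simp add: Suc_ile_eq)
      hence "ereal_of_enat (enat (Suc (k n))) \<le> ereal_of_enat (level n \<omega>)" by (simp only: ereal_of_enat_le_iff)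
      finally show ?case .
    qed
  qed
  thus ?thesis using K by (intro that[of K]) (auto simp: x_def)
qed

text \<open>By the summability, generation \<open>k\<close> eventually has a box of displacement at
  least \<open>z k\<close>. The last hypothesis makes this box smaller than
  \<open>n powr \<alpha> / (2 * n)\<close> at generation \<open>x n\<close> rounded up; the rounding
  is the \<open>+ 1\<close>.\<close>

lemma level_le:
  fixes x :: "nat \<Rightarrow> real"
  assumes sm: "summable (\<lambda>k. 1 - law.reach k (z k))"
    and x: "filterlim x at_top sequentially"
    and z: "\<forall>\<^sub>F n in sequentially. ln 2 + (1 - \<alpha>) * ln (real n) \<le> z (nat \<lceil>x n\<rceil>)"
  shows "AE \<omega> in M. \<forall>\<^sub>F n in sequentially. ereal_of_enat (level n \<omega>) \<le> ereal (x n + 1)"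
proof -
  define k where "k n = nat \<lceil>x n\<rceil>" for n
  have kx: "filterlim k sequentially sequentially"
  proof (rule filterlim_at_top_mono)
    show "filterlim (\<lambda>n. nat \<lfloor>x n\<rfloor>) sequentially sequentially"
      by (rule filterlim_compose[OF filterlim_nat_sequentially filterlim_compose[OF filterlim_floor_sequentially x]])
    show "\<forall>\<^sub>F n in sequentially. nat \<lfloor>x n\<rfloor> \<le> k n"
      unfolding k_def by (intro always_eventually allI nat_mono floor_le_ceiling)
  qed
  have ev1: "\<forall>\<^sub>F n in sequentially. 1 \<le> x n" using x by (simp add: filterlim_at_top)
  have "AE \<omega> in M. \<forall>\<^sub>F n in sequentially. level n \<omega> \<le> enat (k n)"
  proof (rule AE_saturation_le[OF \<alpha>(1)])
    show "AE \<omega> in M. \<forall>\<^sub>F n in sequentially. \<exists>i. length i = k n \<and> 0 < box_size \<rho> i \<omega> \<and> box_size \<rho> i \<omega> \<le> real n powr \<alpha> / (2 * real n)"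
      using AE_eventually_small_box[OF sm]
    proof eventually_elim
      case (elim \<omega>)
      from eventually_compose_filterlim[OF elim kx] z eventually_gt_at_top[of 0]
      show ?case
      proof eventually_elim
        case (elim n)
        from elim(1) obtain i where i: "length i = k n" "0 < box_size \<rho> i \<omega>" "z (k n) \<le> - ln (box_size \<rho> i \<omega>)" by blast
        have "ln (box_size \<rho> i \<omega>) \<le> - (ln 2 + (1 - \<alpha>) * ln (real n))"
          using elim(2) i(3) by (simp add: k_def)
        hence "exp (ln (box_size \<rho> i \<omega>)) \<le> exp (- (ln 2 + (1 - \<alpha>) * ln (real n)))" by simp
        also have "\<dots> = real n powr \<alpha> / (2 * real n)"
        proof -
          have "- (ln 2 + (1 - \<alpha>) * ln (real n)) = \<alpha> * ln (real n) - (ln 2 + ln (real n))"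
            by (simp add: algebra_simps)
          thus ?thesis using elim(3) by (simp only: exp_diff exp_add) (simp add: powr_def)
        qed
        finally show ?case using i by auto
      qed
    qed
  qed
  thus ?thesis
  proof eventually_elim
    case (elim \<omega>)
    from elim ev1 show ?case
    proof eventually_elim
      case (elim n)
      from elim(1) have "ereal_of_enat (level n \<omega>) \<le> ereal_of_enat (enat (k n))" by (simp only: ereal_of_enat_le_iff)
      also have "real (k n) \<le> x n + 1" using elim(2) unfolding k_def by linarith
      hence "ereal_of_enat (enat (k n)) \<le> ereal (x n + 1)" by simp
      finally show ?case .
    qed
  qed
qed

lemma level_upper_linear:
  assumes c: "slope < c"
  shows "AE \<omega> in M. \<forall>\<^sub>F n in sequentially. ereal_of_enat (level n \<omega>) \<le> ereal (c * ln (real n) + 1)"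
proof -
  have c0: "0 < c" using c slope_pos by linarith
  have sc: "1 - \<alpha> < crit.speed * c" using c crit.speed_pos by (simp add: slope_def divide_less_eq mult.commute)
  \<comment> \<open>Puts \<open>(speed - \<epsilon>) * c\<close> halfway between
    \<open>1 - \<alpha>\<close> and \<open>speed * c\<close>.\<close>
  define \<epsilon> where "\<epsilon> = (crit.speed * c - (1 - \<alpha>)) / (2 * c)"
  have \<epsilon>: "0 < \<epsilon>" using sc c0 by (simp add: \<epsilon>_def)
  have "\<epsilon> * c = (crit.speed * c - (1 - \<alpha>)) / 2" using c0 by (simp add: \<epsilon>_def)
  hence "(crit.speed - \<epsilon>) * c = (crit.speed * c + (1 - \<alpha>)) / 2"
    by (simp add: left_diff_distrib)
  hence gap: "1 - \<alpha> < (crit.speed - \<epsilon>) * c" using sc by simp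
  have sp: "0 < crit.speed - \<epsilon>" using gap c0 \<alpha> by (metis diff_gt_0_iff_gt less_trans zero_less_mult_pos2)
  show ?thesis
  proof (rule level_le[OF crit.summable_reach_linear[OF \<epsilon>]])
    show "filterlim (\<lambda>n. c * ln (real n)) at_top sequentially" using c0 by real_asymp
    have "\<forall>\<^sub>F n in sequentially. ln 2 + (1 - \<alpha>) * ln (real n) \<le> ((crit.speed - \<epsilon>) * c) * ln (real n)"
      using gap by real_asymp
    thus "\<forall>\<^sub>F n in sequentially. ln 2 + (1 - \<alpha>) * ln (real n) \<le> (crit.speed - \<epsilon>) * real (nat \<lceil>c * ln (real n)\<rceil>)"
    proof eventually_elim
      case (elim n)
      have "(crit.speed - \<epsilon>) * (c * ln (real n)) \<le> (crit.speed - \<epsilon>) * real (nat \<lceil>c * ln (real n)\<rceil>)"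
        using sp by (intro mult_left_mono real_nat_ceiling_ge) auto
      with elim show ?case by (simp add: mult.assoc)
    qed
  qed
qed

lemma level_upper_log:
  assumes "0 < \<delta>" "atom_moment \<nu> (1 + \<delta>) < \<infinity>"
  obtains K where "0 \<le> K" "AE \<omega> in M. \<forall>\<^sub>F n in sequentially.
    ereal_of_enat (level n \<omega>) \<le> ereal (slope * ln (real n) + K * ln (ln (real n)))"
proof -
  obtain A where A: "0 \<le> A" and sm: "summable (\<lambda>k. 1 - law.reach k (crit.speed * real k - A * ln (real k)))"
    by (rule crit.summable_reach_log[OF assms])
  define K where "K = (A + 1) / crit.speed"
  define x where "x n = slope * ln (real n) + K * ln (ln (real n))" for n :: nat
  have K: "0 < K" using A crit.speed_pos by (simp add: K_def)
  have D: "0 < slope" by (rule slope_pos)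
  have x: "filterlim x at_top sequentially" unfolding x_def using D K by real_asymp
  have "AE \<omega> in M. \<forall>\<^sub>F n in sequentially. ereal_of_enat (level n \<omega>) \<le> ereal (x n + 1)"
  proof (rule level_le[OF sm x])
    have "\<forall>\<^sub>F n in sequentially. A * ln (slope * ln (real n) + K * ln (ln (real n)) + 1) + ln 2 \<le> (A + 1) * ln (ln (real n))"
      using A D K by real_asymp
    moreover have "\<forall>\<^sub>F n in sequentially. 1 \<le> x n" using x by (simp add: filterlim_at_top)
    ultimately show "\<forall>\<^sub>F n in sequentially. ln 2 + (1 - \<alpha>) * ln (real n) \<le>
      crit.speed * real (nat \<lceil>x n\<rceil>) - A * ln (real (nat \<lceil>x n\<rceil>))"
    proof eventually_elim
      case (elim n)
      define m where "m = nat \<lceil>x n\<rceil>"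
      have m: "x n \<le> real m" "real m \<le> x n + 1" using elim(2) unfolding m_def by linarith+
      have "crit.speed * x n \<le> crit.speed * real m" using m crit.speed_pos by (intro mult_left_mono) auto
      moreover have "crit.speed * x n = (1 - \<alpha>) * ln (real n) + (A + 1) * ln (ln (real n))"
        using crit.speed_pos by (simp add: x_def K_def slope_def field_simps)
      moreover have "A * ln (real m) \<le> A * ln (x n + 1)"
        using A m elim(2) by (intro mult_left_mono) (auto simp: ln_le_cancel_iff)
      moreover have "A * ln (x n + 1) + ln 2 \<le> (A + 1) * ln (ln (real n))" using elim(1) by (simp add: x_def)
      ultimately show ?case unfolding m_def[symmetric] by linarith
    qed
  qed
  \<comment> \<open>Lets one more \<open>ln (ln n)\<close> absorb the rounding term.\<close>
  moreover have "\<forall>\<^sub>F n in sequentially. (1::real) \<le> ln (ln (real n))" by real_asymp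
  ultimately have "AE \<omega> in M. \<forall>\<^sub>F n in sequentially.
    ereal_of_enat (level n \<omega>) \<le> ereal (slope * ln (real n) + (K + 1) * ln (ln (real n)))"
  proof (elim AE_mp, intro AE_I2 impI)
    fix \<omega> assume "\<forall>\<^sub>F n in sequentially. (1::real) \<le> ln (ln (real n))"
      "\<forall>\<^sub>F n in sequentially. ereal_of_enat (level n \<omega>) \<le> ereal (x n + 1)"
    thus "\<forall>\<^sub>F n in sequentially. ereal_of_enat (level n \<omega>) \<le> ereal (slope * ln (real n) + (K + 1) * ln (ln (real n)))"
    proof eventually_elim
      case (elim n)
      have "x n + 1 \<le> slope * ln (real n) + (K + 1) * ln (ln (real n))" using elim(1) by (simp add: x_def algebra_simps)
      with elim(2) show ?case by (meson ereal_less_eq(3) order_trans)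
    qed
  qed
  thus ?thesis using K by (intro that[of "K + 1"]) auto
qed

lemma level_asymp_equiv:
  "AE \<omega> in M. (\<forall>\<^sub>F n in sequentially. level n \<omega> < \<infinity>) \<and>
    (\<lambda>n. real (the_enat (level n \<omega>))) \<sim>[sequentially] (\<lambda>n. slope * ln (real n))"
proof -
  obtain K where lower: "AE \<omega> in M. \<forall>\<^sub>F n in sequentially.
    ereal (slope * ln (real n) - K * ln (ln (real n))) \<le> ereal_of_enat (level n \<omega>)"
    by (rule level_lower_bound) (rule that)
  \<comment> \<open>Countably many slopes decreasing to \<open>slope\<close> keep the exceptional
    set null.\<close>
  have upper: "AE \<omega> in M. \<forall>j::nat. \<forall>\<^sub>F n in sequentially.
    ereal_of_enat (level n \<omega>) \<le> ereal (slope * (1 + 1 / (real j + 1)) * ln (real n) + 1)"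
    unfolding AE_all_countable
  proof (intro allI level_upper_linear)
    fix j :: nat
    have "slope * 1 < slope * (1 + 1 / (real j + 1))" by (rule mult_strict_left_mono[OF _ slope_pos]) simp
    thus "slope < slope * (1 + 1 / (real j + 1))" by (simp only: mult_1_right)
  qed
  from lower upper show ?thesis
  proof eventually_elim
    case (elim \<omega>)
    define g where "g n = real (the_enat (level n \<omega>))" for n
    \<comment> \<open>\<open>the_enat\<close> is meaningful only for finite levels, so finiteness is
      first read off from an upper bound.\<close>
    have fin: "level n \<omega> = enat (the_enat (level n \<omega>))" if "ereal_of_enat (level n \<omega>) \<le> ereal r" for n r
      using that by (cases "level n \<omega>") auto
    have low: "\<forall>\<^sub>F n in sequentially. slope * ln (real n) - K * ln (ln (real n)) \<le> g n"
      using elim(1) spec[OF elim(2), of 0]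
    proof eventually_elim
      case (elim n)
      show ?case using elim(1) by (subst (asm) fin[OF elim(2)]) (simp add: g_def)
    qed
    have up: "\<forall>\<^sub>F n in sequentially. g n \<le> slope * (1 + 1 / (real j + 1)) * ln (real n) + 1" for j
      using spec[OF elim(2), of j]
    proof eventually_elim
      case (elim n)
      show ?case using elim by (subst (asm) fin[OF elim]) (simp add: g_def)
    qed
    have lnpos: "\<forall>\<^sub>F n in sequentially. 0 < slope * ln (real n)"
      using slope_pos by real_asymp
    have "(\<lambda>n. g n / (slope * ln (real n))) \<longlonglongrightarrow> 1"
    proof (rule order_tendstoI)
      fix a :: real assume a: "a < 1"
      have "\<forall>\<^sub>F n in sequentially. a * (slope * ln (real n)) < slope * ln (real n) - K * ln (ln (real n))"
      proof -
        define c where "c = slope * (1 - a)"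
        have "0 < c" using a slope_pos unfolding c_def by (intro mult_pos_pos) auto
        hence "\<forall>\<^sub>F n in sequentially. K * ln (ln (real n)) < c * ln (real n)" by real_asymp
        moreover have "c * x = slope * x - a * (slope * x)" for x
          unfolding c_def by (simp only: left_diff_distrib right_diff_distrib mult_1_right mult.assoc mult.left_commute)
        ultimately show ?thesis by (auto elim!: eventually_mono)
      qed
      with low lnpos show "\<forall>\<^sub>F n in sequentially. a < g n / (slope * ln (real n))"
        by eventually_elim (simp add: pos_less_divide_eq)
    next
      fix a :: real assume a: "1 < a"
      obtain j :: nat where j: "1 / (real j + 1) < (a - 1) / 2"
      proof -
        obtain j :: nat where "2 / (a - 1) < real j" using reals_Archimedean2 by blast
        hence "1 / (real j + 1) < (a - 1) / 2" using a by (simp add: field_simps)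
        thus ?thesis by (rule that)
      qed
      have "\<forall>\<^sub>F n in sequentially. 1 < slope * ((a - 1) / 2) * ln (real n)"
      proof -
        have "filterlim (\<lambda>n. slope * ((a - 1) / 2) * ln (real n)) at_top sequentially"
          using slope_pos a by real_asymp
        thus ?thesis unfolding filterlim_at_top_dense by (rule spec)
      qed
      with up[of j] lnpos show "\<forall>\<^sub>F n in sequentially. g n / (slope * ln (real n)) < a"
      proof eventually_elim
        case (elim n)
        have "slope * ln (real n) * (1 / (real j + 1)) \<le> slope * ln (real n) * ((a - 1) / 2)"
          using elim(2) j by (intro mult_left_mono) auto
        moreover have eqs: "slope * (1 + t) * y = slope * y + slope * y * t" "slope * u * y = slope * y * u"
            "y' + 2 * (y' * ((a - 1) / 2)) = y' * a" for t y u y' :: real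
          by (simp_all add: field_simps)
        ultimately have "g n < slope * ln (real n) * a"
          using elim(1,3) eqs(1)[of "1 / (real j + 1)" "ln (real n)"] eqs(2)[of "(a - 1) / 2" "ln (real n)"]
            eqs(3)[of "slope * ln (real n)"] by linarith
        thus ?case using elim(2) by (simp add: pos_divide_less_eq mult.commute)
      qed
    qed
    hence "g \<sim>[sequentially] (\<lambda>n. slope * ln (real n))"
      by (rule asymp_equivI')
    moreover have "\<forall>\<^sub>F n in sequentially. level n \<omega> < \<infinity>"
      using spec[OF elim(2), of 0]
    proof eventually_elim
      case (elim n)
      show ?case by (subst fin[OF elim]) simp
    qed
    ultimately show ?case by (simp add: g_def[abs_def])
  qed
qed

end

theorem proposition2:
  fixes M :: "'a measure" and \<nu> :: "nat measure measure"
    and \<rho> :: "nat list \<Rightarrow> 'a \<Rightarrow> nat measure" and Y :: "nat \<Rightarrow> 'a \<Rightarrow> nat \<Rightarrow> nat"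
    and \<alpha> :: real
  assumes model: "nested_occupancy M \<nu> \<rho> Y"
    and not_geometric: "\<not> geometric_law \<nu>"
    and theta_star_bounds: "-\<infinity> < theta_star \<nu>" "theta_star \<nu> < 0"
    and theta_star_zero:
      "theta_low \<nu> < theta_star \<nu>" "phi \<nu> (real_of_ereal (theta_star \<nu>)) = 0"
    and alpha: "0 < \<alpha>" "\<alpha> < 1"
  shows
    "(AE \<omega> in M.
        (\<forall>\<^sub>F n in sequentially. saturation_level \<rho> Y n (real n powr \<alpha>) \<omega> < \<infinity>) \<and>
        (\<lambda>n. real (the_enat (saturation_level \<rho> Y n (real n powr \<alpha>) \<omega>)))
          \<sim>[sequentially] (\<lambda>n. (1 - \<alpha>) * C_star \<nu> * ln (real n)))
     \<and> (AE \<omega> in M. \<exists>K::real. \<forall>\<^sub>F n in sequentially.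
          ereal ((1 - \<alpha>) * C_star \<nu> * ln (real n) - K * ln (ln (real n)))
            \<le> ereal_of_enat (saturation_level \<rho> Y n (real n powr \<alpha>) \<omega>))
     \<and> ((\<exists>\<delta>>0. laplace \<nu> (- \<delta>) < \<infinity> \<and> atom_moment \<nu> (1 + \<delta>) < \<infinity>) \<longrightarrow>
         (AE \<omega> in M. \<exists>K::real. \<forall>\<^sub>F n in sequentially.
            \<bar>ereal_of_enat (saturation_level \<rho> Y n (real n powr \<alpha>) \<omega>)
               - ereal ((1 - \<alpha>) * C_star \<nu> * ln (real n))\<bar>
              \<le> ereal (K * ln (ln (real n)))))"
proof -
  define \<theta> where "\<theta> = real_of_ereal (theta_star \<nu>)"
  have \<theta>: "theta_star \<nu> = ereal \<theta>" "\<theta> < 0"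
    using theta_star_bounds unfolding \<theta>_def by (cases "theta_star \<nu>"; simp)+
  \<comment> \<open>A point of finiteness strictly below the critical parameter; the distance to it
    becomes \<open>e\<close>.\<close>
  obtain \<theta>1 where \<theta>1: "laplace \<nu> \<theta>1 < \<infinity>" "\<theta>1 < \<theta>"
    using theta_star_zero(1) unfolding \<theta>(1) theta_low_def Inf_less_iff by auto
  interpret occ: nested_occupancy M \<nu> \<rho> Y by (rule model)
  define \<kappa> where "\<kappa> = laplace_real \<nu> \<theta>"
  have fin: "laplace \<nu> \<theta> < \<infinity>"
    using occ.law.laplace_antimono[of \<theta>1 \<theta>] \<theta>1 by (auto intro: le_less_trans)
  hence \<kappa>: "laplace \<nu> \<theta> = ennreal \<kappa>"
    by (simp add: \<kappa>_def laplace_real_def less_top)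
  have \<kappa>_pos: "0 < \<kappa>"
    using occ.law.laplace_ge_1[of \<theta>] \<theta>(2) unfolding \<kappa> by (cases "\<kappa> \<le> 0") (auto simp: ennreal_neg)
  interpret til: tilted \<nu> \<theta> \<kappa>
    by (unfold_locales) (use \<kappa> \<kappa>_pos \<theta> in auto)
  define e where "e = \<theta> - \<theta>1"
  have e: "0 < e" "laplace \<nu> (\<theta> - e) < \<infinity>" using \<theta>1 by (auto simp: e_def)
  note deriv = til.laplace_deriv[OF e]
  \<comment> \<open>That \<open>phi\<close> vanishes says that \<open>ln \<kappa>\<close> is
    \<open>\<theta>\<close> times the tilted mean of \<open>lmass\<close>; hence this mean is
    \<open>- speed\<close> and the step is centred.\<close>
  have lm: "(\<integral>z. til.lmass z \<partial>til.Q) = - til.speed"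
  proof -
    have "ln \<kappa> - \<theta> * (\<kappa> * (\<integral>z. til.lmass z \<partial>til.Q)) / \<kappa> = 0"
      using theta_star_zero(2) unfolding \<theta>_def[symmetric] phi_def deriv(1) \<kappa>_def[symmetric] .
    hence "ln \<kappa> = \<theta> * (\<integral>z. til.lmass z \<partial>til.Q)" using \<kappa>_pos by simp
    thus ?thesis using \<theta>(2) by (simp add: til.speed_def)
  qed
  have int_lmass: "integrable til.Q til.lmass" by (rule til.integrable_lmass[OF e])
  interpret crit: critical \<nu> \<theta> \<kappa> e
    by unfold_locales (use e not_geometric int_lmass lm in \<open>auto simp: til.step_eq til.Q.prob_space\<close>)
  interpret co: critical_occupancy M \<nu> \<rho> Y \<theta> \<kappa> e \<alpha>
    by unfold_locales (use alpha in auto)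
  \<comment> \<open>The transform and its derivative are continuous at \<open>\<theta>\<close> with
    values \<open>\<kappa>\<close> and \<open>- \<kappa> * speed\<close>, so the limit from the
    right is the quotient there.\<close>
  have C: "C_star \<nu> = 1 / til.speed"
    unfolding C_star_def \<theta>_def[symmetric]
  proof (rule tendsto_Lim)
    have L: "(laplace_real \<nu> \<longlongrightarrow> \<kappa>) (at_right \<theta>)"
      using deriv(3) unfolding isCont_def \<kappa>_def by (rule tendsto_within_subset) simp
    have L': "(deriv (laplace_real \<nu>) \<longlongrightarrow> - \<kappa> * til.speed) (at_right \<theta>)"
      using deriv(2) unfolding isCont_def deriv(1) lm by (auto intro: tendsto_within_subset)
    have "((\<lambda>t. - laplace_real \<nu> t / deriv (laplace_real \<nu>) t) \<longlongrightarrow> - \<kappa> / (- \<kappa> * til.speed)) (at_right \<theta>)"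
      using L L' \<kappa>_pos crit.speed_pos by (intro tendsto_intros) auto
    thus "((\<lambda>t. - laplace_real \<nu> t / deriv (laplace_real \<nu>) t) \<longlongrightarrow> 1 / til.speed) (at_right \<theta>)"
      using \<kappa>_pos by simp
  qed simp
  have slope: "(1 - \<alpha>) * C_star \<nu> = co.slope" by (simp add: C co.slope_def)
  obtain K where lower: "AE \<omega> in M. \<forall>\<^sub>F n in sequentially.
    ereal (co.slope * ln (real n) - K * ln (ln (real n))) \<le> ereal_of_enat (co.level n \<omega>)"
    by (rule co.level_lower_bound) (rule that)
  show ?thesis
    unfolding slope
  proof (intro conjI impI)
    show "AE \<omega> in M. (\<forall>\<^sub>F n in sequentially. co.level n \<omega> < \<infinity>) \<and>
      (\<lambda>n. real (the_enat (co.level n \<omega>))) \<sim>[sequentially] (\<lambda>n. co.slope * ln (real n))"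
      by (rule co.level_asymp_equiv)
    show "AE \<omega> in M. \<exists>K::real. \<forall>\<^sub>F n in sequentially.
      ereal (co.slope * ln (real n) - K * ln (ln (real n))) \<le> ereal_of_enat (co.level n \<omega>)"
      using lower by eventually_elim (rule exI)
    assume "\<exists>\<delta>>0. laplace \<nu> (- \<delta>) < \<infinity> \<and> atom_moment \<nu> (1 + \<delta>) < \<infinity>"
    then obtain \<delta> where \<delta>: "0 < \<delta>" "atom_moment \<nu> (1 + \<delta>) < \<infinity>" by blast
    obtain K' where upper: "AE \<omega> in M. \<forall>\<^sub>F n in sequentially.
      ereal_of_enat (co.level n \<omega>) \<le> ereal (co.slope * ln (real n) + K' * ln (ln (real n)))"
      by (rule co.level_upper_log[OF \<delta>]) (rule that)
    have ll: "\<forall>\<^sub>F n in sequentially. (1::real) \<le> ln (ln (real n))" by real_asymp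
    from lower upper show "AE \<omega> in M. \<exists>K::real. \<forall>\<^sub>F n in sequentially.
      \<bar>ereal_of_enat (co.level n \<omega>) - ereal (co.slope * ln (real n))\<bar> \<le> ereal (K * ln (ln (real n)))"
    proof eventually_elim
      case (elim \<omega>)
      show ?case
      proof (rule exI[of _ "max K K'"])
        from elim ll show "\<forall>\<^sub>F n in sequentially.
          \<bar>ereal_of_enat (co.level n \<omega>) - ereal (co.slope * ln (real n))\<bar> \<le> ereal (max K K' * ln (ln (real n)))"
        proof eventually_elim
          case (elim n)
          obtain m where m: "co.level n \<omega> = enat m" using elim(2) by (cases "co.level n \<omega>") auto
          have "K * ln (ln (real n)) \<le> max K K' * ln (ln (real n))" "K' * ln (ln (real n)) \<le> max K K' * ln (ln (real n))"
            using elim(3) by (auto intro: mult_right_mono)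
          thus ?case using elim(1,2) unfolding m by (simp add: abs_le_iff)
        qed
      qed
    qed
  qed
qed

end
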